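(* Let $\alpha$ be an intersection of hyperplanes of the Coxeter complex $\mathcal C W$, where $W$ is one of $A_n,B_n,D_n,\widetilde A_n,\widetilde B_n,\widetilde C_n,\widetilde D_n$ (for the last four, the complex is the toroidal Coxeter complex). Then $\alpha$ is in the minimal building set $\mathrm{Min}(\mathcal C W)$ if and only if $\alpha$ is the support of a $1$-bracketing.
   Context: Complexes and particles. Spherical: $A_n$: unit sphere of $\mathbb R^{n+1}/\mathbb R(1,\dots,1)$ with hyperplanes $x_i=x_j$ ($n+1$ labeled particles on the line); $B_n$: unit sphere of $\mathbb R^n$ with hyperplanes $x_i=\pm x_j$, $x_i=0$ ($n$ symmetric pairs $\{x_i,-x_i\}$ on the line with a fixed particle at $0$); $D_n$: unit sphere of $\mathbb R^n$ with hyperplanes $x_i=\pm x_j$ ($n$ symmetric pairs, no fixed particle). Toroidal, with $\mathbb S=\mathbb R/2\mathbb Z$: $\widetilde A_n$: $\mathbb S^{n+1}$ modulo rotations, hyperplanes $x_i=x_j$ ($n+1$ particles on the circle); on $\mathbb S^n$ ($n$ symmetric pairs $\{x_i,-x_i\}$ on the circle, with the points $0$ and $1$ on the axis of symmetry): $\widetilde B_n$: $x_i=\pm x_j$, $x_i=1$ (fixed particle at $1$); $\widetilde C_n$: $x_i=\pm x_j$, $x_i=1$, $x_i=0$ (fixed particles at $0$ and $1$); $\widetilde D_n$: $x_i=\pm x_j$ (no fixed particles). Here $i\ne j$. In the torus an intersection of hyperplanes means a connected component of the intersection. For an intersection $\alpha$ of hyperplanes, $\mathcal H_s\alpha$ is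 the set of hyperplanes containing $\alpha$. It is reducible if it is a disjoint union $\mathcal H_s\alpha=\mathcal H_s\beta\sqcup\mathcal H_s\gamma$ with $\beta,\gamma$ intersections of hyperplanes and $\alpha=\beta\cap\gamma$, and irreducible otherwise. $\mathrm{Min}(\mathcal C W)$ is the De Concini–Procesi minimal building set of the arrangement (a collection of subspaces for which blow-ups commute for a given dimension and for which every crossing in the resulting blown-up space is normal, i.e. locally isomorphic to a coordinate arrangement); it is known (Davis–Januszkiewicz–Scott) that $\alpha\in\mathrm{Min}(\mathcal C W)$ if and only if $\mathcal H_s\alpha$ is irreducible. Bracketings. A bracket is drawn around adjacent particles of a configuration diagram (in some ordering of the particles) and represents the collision of the included particles. In the symmetric cases a bracket not meeting the axis comes with its mirror image and the two count as one bracket, while a bracket meeting the axis is a single symmetric bracket, again counted as one. At an axis point carrying no fixed particle, a particle and its inverse may pass each other without collision, so there is no meaningful bracketing of just the symmetric pair closest to that axis point. A $k$-bracketing of a diagram is a set of $k$ brackets representing multiple independent particle collisions; a $1$-bracketing has one bracket. Its bracket may contain a fixed particle, or contain a particle and its inverse but no fixed particle, or contain no particle together with its inverse. The support of a bracketing is the subspace in which particles sharing a bracket have collided, i.e. the smallest intersection of hyperplanes associated to the bracketing.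
   Formalization: A bracket around an axis point with no fixed particle must contain at least three symmetric pairs; with exactly two pairs (e.g. x1=x2=0 in D_n) the support is reducible, so the claim fails for such brackets, and they are not counted as 1-bracketings. *)

theory Defs
  imports "HOL-Analysis.Analysis" "HOL-Library.Sublist"
begin

section \<open>Arrangements, intersections of hyperplanes, building sets\<close>

text \<open>
  A hyperplane is stored together with a normal vector: a pair \<open>(v, h)\<close> where \<open>h\<close> is a set of
  points of the ambient space (a sphere or a torus) and \<open>v\<close> is a normal vector of \<open>h\<close> (on a torus,
  of any lift of \<open>h\<close> to the universal cover). A hyperplane may be listed several times, with
  proportional normal vectors.
\<close>

type_synonym ('n, 'p) arrangement = "((real, 'n) vec \<times> 'p set) set"

definition hyps_containing :: "('n::finite, 'p) arrangement \<Rightarrow> 'p set \<Rightarrow> ('n, 'p) arrangement" where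
  "hyps_containing H \<alpha> = {(v, h) \<in> H. \<alpha> \<subseteq> h}"

text \<open>
  Only nonempty families of hyperplanes are intersected, so the ambient space itself is not an
  intersection of hyperplanes. On the sphere the intersection of linear rank equal to the dimension
  of the linear ambient space is the empty set; it is kept, and plays the role of the origin of the
  linear arrangement.
\<close>

definition spherical_flats :: "('n::finite, 'p) arrangement \<Rightarrow> 'p set set" where
  "spherical_flats H = {\<Inter> (snd ` K) | K. K \<subseteq> H \<and> K \<noteq> {}}"

definition toroidal_flats :: "'p topology \<Rightarrow> ('n::finite, 'p) arrangement \<Rightarrow> 'p set set" where
  "toroidal_flats T H =
     (\<Union>K \<in> {K. K \<subseteq> H \<and> K \<noteq> {}}. connected_components_of (subtopology T (\<Inter> (snd ` K))))"

text \<open>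
  The space of linear forms vanishing on (the directions of) \<open>\<alpha>\<close>; its dimension is the
  codimension of \<open>\<alpha>\<close>.
\<close>

definition conormal :: "('n::finite, 'p) arrangement \<Rightarrow> 'p set \<Rightarrow> (real ^ 'n) set" where
  "conormal H \<alpha> = span (fst ` hyps_containing H \<alpha>)"

definition minimal_above :: "'p set set \<Rightarrow> 'p set \<Rightarrow> 'p set set" where
  "minimal_above G \<alpha> = {\<beta> \<in> G. \<alpha> \<subseteq> \<beta> \<and> \<not> (\<exists>\<gamma> \<in> G. \<alpha> \<subseteq> \<gamma> \<and> \<gamma> \<subset> \<beta>)}"

text \<open>
  Building sets in the sense of De Concini and Procesi: for every intersection of hyperplanes
  \<open>\<alpha>\<close>, the conormal space of \<open>\<alpha>\<close> is the direct sum of the conormal spaces of the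
  inclusion-minimal members of \<open>G\<close> containing \<open>\<alpha>\<close> (these are the members with maximal conormal
  space). Directness of the sum is expressed by additivity of dimensions. On a torus this is the
  condition of De Concini and Procesi for the linear arrangement tangent to the given one
  along \<open>\<alpha>\<close>.
\<close>

definition building_set :: "'p set set \<Rightarrow> ('n::finite, 'p) arrangement \<Rightarrow> 'p set set \<Rightarrow> bool" where
  "building_set F H G \<longleftrightarrow>
     G \<subseteq> F \<and>
     (\<forall>\<alpha> \<in> F.
        conormal H \<alpha> = span (\<Union>\<beta> \<in> minimal_above G \<alpha>. conormal H \<beta>) \<and>
        dim (conormal H \<alpha>) = (\<Sum>\<beta> \<in> minimal_above G \<alpha>. dim (conormal H \<beta>)))"

definition Min_building :: "'p set set \<Rightarrow> ('n::finite, 'p) arrangement \<Rightarrow> 'p set set" where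
  "Min_building F H = (LEAST G. building_set F H G)"

section \<open>The spherical and toroidal Coxeter complexes\<close>

text \<open>
  Particles are labelled by the finite type \<open>'n\<close>. Thus the complexes named after the types
  \<open>B\<close>, \<open>C\<close>, \<open>D\<close> have index \<open>n = CARD('n)\<close>, whereas the complexes of the two types \<open>A\<close>, which
  have \<open>n + 1\<close> particles, have index \<open>n = CARD('n) - 1\<close>.
\<close>

text \<open>
  The quotient of the Euclidean space by the line spanned by \<open>(1, \<dots>, 1)\<close> is identified with the
  orthogonal complement of that line.
\<close>

definition sphere_A :: "(real ^ 'n) set" where
  "sphere_A = {x. (\<Sum>i\<in>UNIV. x $ i) = 0 \<and> norm x = 1}"

definition cox_A :: "('n::finite, real ^ 'n) arrangement" where
  "cox_A = {(axis i 1 - axis j 1, {x \<in> sphere_A. x $ i = x $ j}) | i j. i \<noteq> j}"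

definition sphere_BD :: "(real ^ 'n) set" where
  "sphere_BD = {x. norm x = 1}"

text \<open>
  The argument \<open>P\<close> of the symmetric arrangements is the set of positions of the fixed particles, a
  subset of the set of axis points.
\<close>

definition cox_sym :: "real set \<Rightarrow> ('n::finite, real ^ 'n) arrangement" where
  "cox_sym P =
     {(axis i 1 - axis j 1, {x \<in> sphere_BD. x $ i = x $ j}) | i j. i \<noteq> j} \<union>
     {(axis i 1 + axis j 1, {x \<in> sphere_BD. x $ i = - x $ j}) | i j. i \<noteq> j} \<union>
     {(axis i 1, {x \<in> sphere_BD. x $ i = a}) | i a. a \<in> P}"

definition cox_B :: "('n::finite, real ^ 'n) arrangement" where
  "cox_B = cox_sym {0}"

definition cox_D :: "('n::finite, real ^ 'n) arrangement" where
  "cox_D = cox_sym {}"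

text \<open>
  The circle of reals modulo 2 is identified with the complex unit circle by
  \<open>t \<mapsto> cis (pi * t)\<close>. The inverse \<open>- t\<close> of a particle then is its complex conjugate, and the axis
  points \<open>0\<close> and \<open>1\<close> become the complex numbers \<open>1\<close> and \<open>- 1\<close> respectively.
\<close>

definition torus :: "(complex ^ 'n) set" where
  "torus = {z. \<forall>i. norm (z $ i) = 1}"

definition rotation_orbit :: "complex ^ 'n \<Rightarrow> (complex ^ 'n) set" where
  "rotation_orbit z = {(\<chi> i. c * z $ i) | c. norm c = 1}"

text \<open>The quotient topology on the torus modulo simultaneous rotation of all particles.\<close>

definition orbit_space :: "(complex ^ 'n::finite) set topology" where
  "orbit_space = topology (\<lambda>U. U \<subseteq> rotation_orbit ` torus \<and>
     openin (top_of_set torus) {z \<in> torus. rotation_orbit z \<in> U})"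

definition cox_A_tilde :: "('n::finite, (complex ^ 'n) set) arrangement" where
  "cox_A_tilde =
     {(axis i 1 - axis j 1, rotation_orbit ` {z \<in> torus. z $ i = z $ j}) | i j. i \<noteq> j}"

definition cox_sym_tilde :: "complex set \<Rightarrow> ('n::finite, complex ^ 'n) arrangement" where
  "cox_sym_tilde P =
     {(axis i 1 - axis j 1, {z \<in> torus. z $ i = z $ j}) | i j. i \<noteq> j} \<union>
     {(axis i 1 + axis j 1, {z \<in> torus. z $ i = cnj (z $ j)}) | i j. i \<noteq> j} \<union>
     {(axis i 1, {z \<in> torus. z $ i = a}) | i a. a \<in> P}"

definition cox_B_tilde :: "('n::finite, complex ^ 'n) arrangement" where
  "cox_B_tilde = cox_sym_tilde {- 1}"

definition cox_C_tilde :: "('n::finite, complex ^ 'n) arrangement" where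
  "cox_C_tilde = cox_sym_tilde {- 1, 1}"

definition cox_D_tilde :: "('n::finite, complex ^ 'n) arrangement" where
  "cox_D_tilde = cox_sym_tilde {}"

section \<open>Brackets and their supports\<close>

text \<open>
  Without symmetry, a diagram lists all particles in their order on the line or, on the circle, in
  their cyclic order read from some starting point. A bracket is drawn around at least two adjacent
  particles; on the circle the starting point can be chosen outside the bracket.
\<close>

definition diagram :: "'n list \<Rightarrow> bool" where
  "diagram ws \<longleftrightarrow> distinct ws \<and> set ws = UNIV"

definition brackets_A :: "'n list set" where
  "brackets_A = {us. \<exists>ws. diagram ws \<and> sublist us ws \<and> 2 \<le> length us}"

definition support_A :: "'n list \<Rightarrow> (real ^ 'n) set" where
  "support_A us = {x \<in> sphere_A. \<forall>i \<in> set us. \<forall>j \<in> set us. x $ i = x $ j}"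

definition support_A_tilde :: "'n list \<Rightarrow> (complex ^ 'n) set set" where
  "support_A_tilde us =
     rotation_orbit ` {z \<in> torus. \<forall>i \<in> set us. \<forall>j \<in> set us. z $ i = z $ j}"

text \<open>In the symmetric cases \<open>Neg i\<close> is the mirror image (inverse) of the particle \<open>Pos i\<close>.\<close>

datatype 'n particle = Pos (label: 'n) | Neg (label: 'n)

fun mirror :: "'n particle \<Rightarrow> 'n particle" where
  "mirror (Pos i) = Neg i"
| "mirror (Neg i) = Pos i"

fun line_pos :: "real ^ 'n \<Rightarrow> 'n particle \<Rightarrow> real" where
  "line_pos x (Pos i) = x $ i"
| "line_pos x (Neg i) = - x $ i"

fun circle_pos :: "complex ^ 'n \<Rightarrow> 'n particle \<Rightarrow> complex" where
  "circle_pos z (Pos i) = z $ i"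
| "circle_pos z (Neg i) = cnj (z $ i)"

text \<open>
  A symmetric diagram is determined by the word \<open>ws\<close> of its particles on one side of the axis, read
  away from the axis point \<open>0\<close> (on the circle: towards the axis point \<open>1\<close>); it contains exactly one
  particle of each symmetric pair. The full diagram on the line is \<open>rev (map mirror ws)\<close>, then the
  fixed particle if there is one, then \<open>ws\<close>; on the circle this is closed up through the axis
  point \<open>1\<close>.
\<close>

definition half_diagram :: "'n particle list \<Rightarrow> bool" where
  "half_diagram ws \<longleftrightarrow> distinct (map label ws) \<and> set (map label ws) = UNIV"

text \<open>
  \<open>Off_Axis us\<close> is the bracket around \<open>us\<close> together with its mirror image. \<open>On_Axis a us\<close> is the
  symmetric bracket around the axis point at position \<open>a\<close>, containing the particles \<open>us\<close>, their
  mirror images and the fixed particle at \<open>a\<close> if there is one.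
\<close>

datatype ('a, 'n) bracket = Off_Axis "'n particle list" | On_Axis 'a "'n particle list"

text \<open>
  The number of symmetric pairs in a bracket around the axis point \<open>a\<close>. If \<open>a\<close> carries no fixed
  particle, a particle and its inverse pass each other at \<open>a\<close> without collision, so one pair alone
  gives no collision. A bracket around exactly two pairs is not admitted as a single bracket either:
  that configuration is the simultaneous occurrence of the two independent collisions
  \<open>x\<^sub>i = x\<^sub>j\<close> and \<open>x\<^sub>i = - x\<^sub>j\<close>, which is a 2-bracketing. (The corresponding intersection is a
  reducible normal crossing of these two hyperplanes, the root system \<open>D\<^sub>2\<close> being
  \<open>A\<^sub>1 \<times> A\<^sub>1\<close>.)
\<close>

definition axial_size_ok :: "'a set \<Rightarrow> 'a \<Rightarrow> 'n particle list \<Rightarrow> bool" where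
  "axial_size_ok P a us \<longleftrightarrow> (if a \<in> P then 1 else 3) \<le> length us"

definition line_brackets :: "real set \<Rightarrow> (real, 'n) bracket set" where
  "line_brackets P =
     {Off_Axis us | us. \<exists>ws. half_diagram ws \<and> sublist us ws \<and> 2 \<le> length us} \<union>
     {On_Axis 0 us | us. \<exists>ws. half_diagram ws \<and> prefix us ws \<and> axial_size_ok P 0 us}"

definition circle_brackets :: "complex set \<Rightarrow> (complex, 'n) bracket set" where
  "circle_brackets P =
     {Off_Axis us | us. \<exists>ws. half_diagram ws \<and> sublist us ws \<and> 2 \<le> length us} \<union>
     {On_Axis 1 us | us. \<exists>ws. half_diagram ws \<and> prefix us ws \<and> axial_size_ok P 1 us} \<union>
     {On_Axis (- 1) us | us. \<exists>ws. half_diagram ws \<and> suffix us ws \<and> axial_size_ok P (- 1) us}"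

text \<open>
  On the circle, equality of the positions of a particle and its inverse leaves both axis points
  possible; the support of an axial bracket is the component belonging to its own axis point.
\<close>

fun support :: "'p set \<Rightarrow> ('p \<Rightarrow> 'n particle \<Rightarrow> 'a) \<Rightarrow> ('a, 'n) bracket \<Rightarrow> 'p set" where
  "support X pos (Off_Axis us) = {x \<in> X. \<forall>p \<in> set us. \<forall>q \<in> set us. pos x p = pos x q}"
| "support X pos (On_Axis a us) = {x \<in> X. \<forall>p \<in> set us \<union> mirror ` set us. pos x p = a}"

definition line_support :: "(real, 'n::finite) bracket \<Rightarrow> (real ^ 'n) set" where
  "line_support = support sphere_BD line_pos"

definition circle_support :: "(complex, 'n::finite) bracket \<Rightarrow> (complex ^ 'n) set" where
  "circle_support = support torus circle_pos"

end

theory Submission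
  imports Defs
begin

text \<open>
  The statement splits into a general fact about arrangements and a computation with roots.

  \<^emph>\<open>Minimal building sets consist of the irreducible flats.\<close> The normal vectors of the
  hyperplanes through a flat \<open>\<alpha>\<close> form a finite set of nonzero vectors, its roots. Call a set of
  vectors indecomposable if it cannot be distributed over two subspaces with trivial intersection
  without one of them receiving everything. Splitting repeatedly, one obtains independent
  indecomposable blocks (\<open>indecomposable_decomposition\<close>), and an indecomposable subset of the
  roots lies inside a single block. So the flats belonging to the blocks of \<open>\<alpha>\<close> are exactly the
  smallest irreducible flats containing \<open>\<alpha>\<close>, and their conormal spaces have direct sum
  \<open>conormal \<alpha>\<close>: the irreducible flats form a building set. Conversely, a building set \<open>G\<close>
  contains every flat of codimension one, because a sum of conormal spaces can give a line only if
  that line occurs among them. Hence every root of \<open>\<alpha>\<close> lies in the conormal space of some minimal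
  member of \<open>G\<close> above \<open>\<alpha>\<close>. These spaces are independent, so if \<open>\<alpha>\<close> is irreducible there is
  only one of them, it is all of \<open>conormal \<alpha>\<close>, and \<open>\<alpha>\<close> itself is in \<open>G\<close>. The locale
  \<open>flat_geometry\<close> isolates what this argument needs: flats through a common flat are ordered
  by their conormal spaces, and every set of roots of \<open>\<alpha>\<close> cuts out a flat.

  These properties hold for the spheres, and for the torus modulo rotations, since each point meets
  the same hyperplanes as some vector does in a linear arrangement (\<open>linear_realization\<close>). In
  the remaining tori a component of an intersection is the image of a linear subspace under the
  exponential map based at any of its points (\<open>component_eq_leaf\<close>).

  \<^emph>\<open>Irreducible flats are supports of brackets.\<close> If \<open>x\<close>, \<open>y\<close> and \<open>x + y\<close> are roots up to sign,
  then \<open>x\<close> and \<open>y\<close> belong to the same block (\<open>summand_in_same_part\<close>). This connects all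
  differences \<open>e\<^sub>p - e\<^sub>q\<close> of particles in a bracket off the axis, and all roots
  \<open>\<plusminus> e\<^sub>i \<plusminus> e\<^sub>j\<close> of an axial bracket as soon as there is a third label or a root \<open>e\<^sub>i\<close>. With two
  labels and no fixed particle the roots \<open>e\<^sub>i - e\<^sub>j\<close> and \<open>e\<^sub>i + e\<^sub>j\<close> stay apart, which is the
  exceptional case in the definition of brackets. For the converse, start from one root of an irreducible
  flat \<open>\<alpha>\<close> and collect the labels of all particles that have collided along \<open>\<alpha>\<close> with a particle
  of that root. Every other root uses either only these labels or none of them, and vectors with
  disjoint sets of coordinates are independent; so all roots of \<open>\<alpha>\<close> use only the collected labels,
  and \<open>\<alpha>\<close> is the support of a bracket around them.
\<close>

section \<open>Indecomposable sets of vectors\<close>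

text \<open>
  Phrased with subspaces rather than with a partition of \<open>R\<close>, the notion is insensitive to the
  signs of vectors and to enlarging \<open>R\<close> within its span, see \<open>indecomposable_between_span\<close>.
\<close>

definition indecomposable :: "'a::real_vector set \<Rightarrow> bool" where
  "indecomposable R \<longleftrightarrow> R \<noteq> {} \<and>
     (\<forall>U W. subspace U \<and> subspace W \<and> U \<inter> W \<subseteq> {0} \<and> R \<subseteq> U \<union> W \<longrightarrow> R \<subseteq> U \<or> R \<subseteq> W)"

lemma indecomposableD:
  assumes "indecomposable R" "subspace U" "subspace W" "U \<inter> W \<subseteq> {0}" "R \<subseteq> U \<union> W"
  shows "R \<subseteq> U \<or> R \<subseteq> W"
  using assms unfolding indecomposable_def by blast

text \<open>
  The roots of a flat are rarely known exactly: a convenient family \<open>K\<close> of them is given up to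
  sign, and the remaining ones are only known to lie in \<open>span K\<close>. This suffices, since a part
  containing \<open>K\<close> contains its span.
\<close>

lemma indecomposable_between_span:
  assumes "indecomposable K" "K \<subseteq> R \<union> uminus ` R" "R \<subseteq> span K"
  shows "indecomposable R"
  unfolding indecomposable_def
proof (intro conjI allI impI)
  show "R \<noteq> {}"
    using assms(1,2) by (auto simp: indecomposable_def)
  fix U W :: "'a set"
  assume *: "subspace U \<and> subspace W \<and> U \<inter> W \<subseteq> {0} \<and> R \<subseteq> U \<union> W"
  then have "K \<subseteq> U \<union> W"
    using assms(2) subspace_neg by blast
  then have "K \<subseteq> U \<or> K \<subseteq> W"
    using indecomposableD[OF assms(1)] * by blast
  then have "span K \<subseteq> U \<or> span K \<subseteq> W"
    using * by (metis span_minimal)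
  then show "R \<subseteq> U \<or> R \<subseteq> W"
    using assms(3) by blast
qed

lemma dim_Un_independent:
  fixes A B :: "'a::euclidean_space set"
  assumes "span A \<inter> span B \<subseteq> {0}"
  shows "dim (A \<union> B) = dim A + dim B"
proof -
  have "dim {x + y |x y. x \<in> span A \<and> y \<in> span B} + dim (span A \<inter> span B) = dim (span A) + dim (span B)"
    by (rule dim_sums_Int) auto
  then have "dim (A \<union> B) + dim (span A \<inter> span B) = dim A + dim B"
    by (simp add: span_Un[symmetric])
  moreover have "dim (span A \<inter> span B) = 0"
    using assms by simp
  ultimately show ?thesis
    by linarith
qed

lemma independent_if_dim_Un:
  fixes A B :: "'a::euclidean_space set"
  assumes "dim A + dim B \<le> dim (A \<union> B)"
  shows "span A \<inter> span B \<subseteq> {0}"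
proof -
  have "dim {x + y |x y. x \<in> span A \<and> y \<in> span B} + dim (span A \<inter> span B) = dim (span A) + dim (span B)"
    by (rule dim_sums_Int) auto
  then have "dim (A \<union> B) + dim (span A \<inter> span B) = dim A + dim B"
    by (simp add: span_Un[symmetric])
  then have "dim (span A \<inter> span B) = 0"
    using assms by linarith
  then show ?thesis
    by simp
qed

lemma dim_UN_le:
  fixes V :: "'i \<Rightarrow> 'a::euclidean_space set"
  assumes "finite I"
  shows "dim (\<Union>i\<in>I. V i) \<le> (\<Sum>i\<in>I. dim (V i))"
  using assms
proof (induction I)
  case (insert i I)
  have "dim {x + y |x y. x \<in> span (V i) \<and> y \<in> span (\<Union>i\<in>I. V i)}
      + dim (span (V i) \<inter> span (\<Union>i\<in>I. V i)) = dim (span (V i)) + dim (span (\<Union>i\<in>I. V i))"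
    by (rule dim_sums_Int) auto
  then have "dim (V i \<union> (\<Union>i\<in>I. V i)) \<le> dim (V i) + dim (\<Union>i\<in>I. V i)"
    by (simp add: span_Un[symmetric])
  then show ?case
    using insert by (simp add: Union_insert)
qed simp

text \<open>
  Independence is passed on from a splitting of \<open>A\<close> to a splitting of \<open>A \<union> B\<close>: if \<open>x = a + b\<close>
  with \<open>x\<close> and \<open>a\<close> in \<open>span A\<close>, then \<open>b\<close> is in \<open>span A \<inter> span B\<close> and vanishes.
\<close>

lemma span_Int_span_Un_trivial:
  assumes "span A \<inter> span B \<subseteq> {0}" "D \<subseteq> A" "span D \<inter> span E \<subseteq> {0}" "E \<subseteq> A"
  shows "span D \<inter> span (E \<union> B) \<subseteq> {0}"
proof
  fix x assume x: "x \<in> span D \<inter> span (E \<union> B)"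
  then obtain a b where ab: "x = a + b" "a \<in> span E" "b \<in> span B"
    by (auto simp: span_Un)
  have "x \<in> span A" "a \<in> span A"
    using x ab assms span_mono by blast+
  then have "b \<in> span A"
    using ab by (metis add_diff_cancel_left' span_diff)
  then have "b = 0"
    using assms(1) ab by blast
  then show "x \<in> {0}"
    using x ab assms by auto
qed

text \<open>
  As long as a set is not indecomposable it can be cut into two proper independent parts. Zero
  must be excluded because it lies in both subspaces of a cut, so the parts might overlap.
\<close>

lemma indecomposable_decomposition:
  fixes R :: "'a::euclidean_space set"
  assumes "finite R" "0 \<notin> R"
  shows "\<exists>\<D>. finite \<D> \<and> \<Union>\<D> = R \<and> dim R = (\<Sum>D\<in>\<D>. dim D) \<and>
           (\<forall>D\<in>\<D>. indecomposable D \<and> span D \<inter> span (R - D) \<subseteq> {0})"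
  using assms
proof (induction R rule: finite_psubset_induct)
  case (psubset R)
  consider "R = {}" | "indecomposable R" | "R \<noteq> {}" "\<not> indecomposable R" by blast
  then show ?case
  proof cases
    case 1
    then show ?thesis by (intro exI[of _ "{}"]) auto
  next
    case 2
    then show ?thesis by (intro exI[of _ "{R}"]) auto
  next
    case 3
    then obtain U W where UW: "subspace U" "subspace W" "U \<inter> W \<subseteq> {0}" "R \<subseteq> U \<union> W"
      "\<not> R \<subseteq> U" "\<not> R \<subseteq> W"
      unfolding indecomposable_def by blast
    define A B where "A = R \<inter> U" and "B = R \<inter> W"
    have AB: "A \<subset> R" "B \<subset> R" "A \<union> B = R" "A \<inter> B = {}"
      using UW psubset.prems by (auto simp: A_def B_def)
    have "span A \<subseteq> U" "span B \<subseteq> W"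
      using UW by (auto simp: A_def B_def span_minimal)
    then have ind: "span A \<inter> span B \<subseteq> {0}"
      using UW by blast
    have nz: "0 \<notin> A" "0 \<notin> B"
      using AB psubset.prems by auto
    obtain \<A> where
      \<A>: "finite \<A> \<and> \<Union>\<A> = A \<and> dim A = (\<Sum>D\<in>\<A>. dim D) \<and>
         (\<forall>D\<in>\<A>. indecomposable D \<and> span D \<inter> span (A - D) \<subseteq> {0})"
      using psubset.IH[OF AB(1) nz(1)] by (rule exE)
    obtain \<B> where
      \<B>: "finite \<B> \<and> \<Union>\<B> = B \<and> dim B = (\<Sum>D\<in>\<B>. dim D) \<and>
         (\<forall>D\<in>\<B>. indecomposable D \<and> span D \<inter> span (B - D) \<subseteq> {0})"
      using psubset.IH[OF AB(2) nz(2)] by (rule exE)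
    note \<A> = \<A>[THEN conjunct1] \<A>[THEN conjunct2, THEN conjunct1]
        \<A>[THEN conjunct2, THEN conjunct2, THEN conjunct1]
        \<A>[THEN conjunct2, THEN conjunct2, THEN conjunct2, rule_format]
    note \<B> = \<B>[THEN conjunct1] \<B>[THEN conjunct2, THEN conjunct1]
        \<B>[THEN conjunct2, THEN conjunct2, THEN conjunct1]
        \<B>[THEN conjunct2, THEN conjunct2, THEN conjunct2, rule_format]
    have disj: "\<A> \<inter> \<B> = {}"
    proof (rule ccontr)
      assume "\<A> \<inter> \<B> \<noteq> {}"
      then obtain D where D: "D \<in> \<A>" "D \<in> \<B>" by blast
      then have "D \<subseteq> A \<inter> B"
        using \<A>(2) \<B>(2) by blast
      moreover have "D \<noteq> {}"
        using \<A>(4)[OF D(1)] by (simp add: indecomposable_def)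
      ultimately show False
        using AB(4) by blast
    qed
    have "span D \<inter> span (R - D) \<subseteq> {0}" if D: "D \<in> \<A> \<union> \<B>" for D
    proof (cases "D \<in> \<A>")
      case True
      have eq: "R - D = (A - D) \<union> B"
        using AB \<A>(2) True by blast
      show ?thesis
        unfolding eq by (rule span_Int_span_Un_trivial[OF ind]) (use True \<A>(2) \<A>(4)[OF True] in auto)
    next
      case False
      then have D: "D \<in> \<B>" using D by blast
      have eq: "R - D = (B - D) \<union> A"
        using AB \<B>(2) D by blast
      have ind': "span B \<inter> span A \<subseteq> {0}"
        using ind by blast
      show ?thesis
        unfolding eq by (rule span_Int_span_Un_trivial[OF ind']) (use D \<B>(2) \<B>(4)[OF D] in auto)
    qed
    then have "\<forall>D\<in>\<A> \<union> \<B>. indecomposable D \<and> span D \<inter> span (R - D) \<subseteq> {0}"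
      using \<A>(4) \<B>(4) by blast
    moreover have "dim R = (\<Sum>D\<in>\<A> \<union> \<B>. dim D)"
      using dim_Un_independent[OF ind] AB(3) \<A>(3) \<B>(3)
      by (simp add: sum.union_disjoint[OF \<A>(1) \<B>(1) disj])
    moreover have "finite (\<A> \<union> \<B>)" "\<Union>(\<A> \<union> \<B>) = R"
      using \<A>(1,2) \<B>(1,2) AB(3) by simp_all
    ultimately show ?thesis
      by (intro exI[of _ "\<A> \<union> \<B>"] conjI)
  qed
qed

section \<open>Minimal building sets\<close>

definition roots :: "('n::finite, 'p) arrangement \<Rightarrow> 'p set \<Rightarrow> (real ^ 'n) set" where
  "roots H \<alpha> = fst ` hyps_containing H \<alpha>"

lemma conormal_eq_span_roots: "conormal H \<alpha> = span (roots H \<alpha>)"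
  by (simp add: conormal_def roots_def)

lemma roots_iff: "v \<in> roots H \<alpha> \<longleftrightarrow> (\<exists>h. (v, h) \<in> H \<and> \<alpha> \<subseteq> h)"
  by (force simp: roots_def hyps_containing_def)

lemma roots_antimono: "\<alpha> \<subseteq> \<beta> \<Longrightarrow> roots H \<beta> \<subseteq> roots H \<alpha>"
  unfolding roots_iff subset_iff by blast

text \<open>
  The flats containing a given flat \<open>\<gamma>\<close> behave like those of a central linear arrangement:
  they are reverse ordered by their conormal spaces, and any nonempty set of roots of a flat spans
  the conormal space of a flat. The reference to a common flat \<open>\<gamma>\<close> matters on a torus, where
  disjoint flats may have the same conormal space.
\<close>

locale flat_geometry =
  fixes F :: "'p set set" and H :: "('n::finite, 'p) arrangement"
  assumes finite_hyperplanes: "finite H"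
    and normal_nonzero: "(v, h) \<in> H \<Longrightarrow> v \<noteq> 0"
    and roots_nonempty: "\<alpha> \<in> F \<Longrightarrow> roots H \<alpha> \<noteq> {}"
    and antitone: "\<lbrakk>\<alpha> \<in> F; \<beta> \<in> F; \<gamma> \<in> F; \<gamma> \<subseteq> \<alpha>; \<gamma> \<subseteq> \<beta>; roots H \<alpha> \<subseteq> span (roots H \<beta>)\<rbrakk> \<Longrightarrow> \<beta> \<subseteq> \<alpha>"
    and ex_flat: "\<lbrakk>\<alpha> \<in> F; A \<subseteq> roots H \<alpha>; A \<noteq> {}\<rbrakk> \<Longrightarrow>
      \<exists>\<beta>\<in>F. \<alpha> \<subseteq> \<beta> \<and> A \<subseteq> roots H \<beta> \<and> roots H \<beta> \<subseteq> span A"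
begin

lemma finite_roots: "finite (roots H \<alpha>)"
  unfolding roots_def hyps_containing_def
  by (intro finite_imageI finite_subset[OF _ finite_hyperplanes]) auto

lemma zero_notin_roots: "0 \<notin> roots H \<alpha>"
  unfolding roots_iff using normal_nonzero by blast

lemma flat_eqI:
  assumes "\<alpha> \<in> F" "\<beta> \<in> F" "\<alpha> \<subseteq> \<beta>" "roots H \<alpha> \<subseteq> span (roots H \<beta>)"
  shows "\<alpha> = \<beta>"
  using antitone[of \<alpha> \<beta> \<alpha>] assms by blast

lemma finite_flats_above:
  assumes "\<alpha> \<in> F"
  shows "finite {\<beta> \<in> F. \<alpha> \<subseteq> \<beta>}"
proof (rule finite_imageD)
  show "finite (roots H ` {\<beta> \<in> F. \<alpha> \<subseteq> \<beta>})"
    by (rule finite_subset[of _ "Pow (roots H \<alpha>)"]) (auto simp: finite_roots dest: roots_antimono)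
  show "inj_on (roots H) {\<beta> \<in> F. \<alpha> \<subseteq> \<beta>}"
    using antitone[OF _ _ assms] by (auto simp: inj_on_def) (metis span_superset subsetD)+
qed

abbreviation "irreducible_flats \<equiv> {\<alpha> \<in> F. indecomposable (roots H \<alpha>)}"

text \<open>
  The blocks of the roots of \<open>\<alpha>\<close> are the root sets of the minimal irreducible flats above \<open>\<alpha>\<close>;
  this identification of \<open>minimal_above\<close> is the core of the proof.
\<close>

lemma building_set_irreducible_flats: "building_set F H irreducible_flats"
  unfolding building_set_def conormal_eq_span_roots
proof (intro conjI ballI)
  fix \<alpha> assume \<alpha>: "\<alpha> \<in> F"
  let ?R = "roots H \<alpha>" and ?M = "minimal_above irreducible_flats \<alpha>"
  obtain \<D> where \<D>: "finite \<D>" "\<Union>\<D> = ?R" "dim ?R = (\<Sum>D\<in>\<D>. dim D)"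
    "\<And>D. D \<in> \<D> \<Longrightarrow> indecomposable D" "\<And>D. D \<in> \<D> \<Longrightarrow> span D \<inter> span (?R - D) \<subseteq> {0}"
    using indecomposable_decomposition[OF finite_roots zero_notin_roots] by metis
  have ne: "D \<noteq> {}" if "D \<in> \<D>" for D
    using \<D>(4)[OF that] by (simp add: indecomposable_def)
  \<comment> \<open>A root in the span of a block cannot belong to another block, so the flat cut out by a block has
     no roots besides those of the block.\<close>
  have closed: "r \<in> D" if "D \<in> \<D>" "r \<in> span D" "r \<in> ?R" for r D
  proof (rule ccontr)
    assume "r \<notin> D"
    then have "r \<in> span D \<inter> span (?R - D)"
      using that by (auto simp: span_base)
    then have "r = 0"
      using \<D>(5)[OF that(1)] by blast
    then show False
      using that(3) zero_notin_roots[of \<alpha>] by simp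
  qed
  have absorb: "\<exists>D\<in>\<D>. S \<subseteq> D" if S: "S \<subseteq> ?R" "indecomposable S" for S
  proof -
    obtain s where s: "s \<in> S" using S by (auto simp: indecomposable_def)
    then obtain D where D: "D \<in> \<D>" "s \<in> D" using S \<D>(2) by blast
    have "S \<subseteq> span D \<union> span (?R - D)"
      using S span_superset[of D] span_superset[of "?R - D"] by blast
    then have "S \<subseteq> span D \<or> S \<subseteq> span (?R - D)"
      using indecomposableD[OF S(2) _ _ \<D>(5)[OF D(1)]] by simp
    moreover have "s \<in> span D" "s \<noteq> 0"
      using D S s zero_notin_roots by (auto simp: span_base)
    ultimately have "S \<subseteq> span D"
      using \<D>(5)[OF D(1)] s by blast
    then show ?thesis
      using closed D S by blast
  qed
  have "\<forall>D\<in>\<D>. \<exists>\<beta>. \<beta> \<in> F \<and> \<alpha> \<subseteq> \<beta> \<and> D \<subseteq> roots H \<beta> \<and> roots H \<beta> \<subseteq> span D"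
  proof
    fix D assume D: "D \<in> \<D>"
    then have "D \<subseteq> ?R" using \<D>(2) by blast
    then show "\<exists>\<beta>. \<beta> \<in> F \<and> \<alpha> \<subseteq> \<beta> \<and> D \<subseteq> roots H \<beta> \<and> roots H \<beta> \<subseteq> span D"
      using ex_flat[OF \<alpha> _ ne[OF D]] by (simp add: Bex_def)
  qed
  from bchoice[OF this] obtain f where
    f: "\<forall>D\<in>\<D>. f D \<in> F \<and> \<alpha> \<subseteq> f D \<and> D \<subseteq> roots H (f D) \<and> roots H (f D) \<subseteq> span D"
    by (rule exE)
  note f = f[rule_format]
  have rf: "roots H (f D) = D" if "D \<in> \<D>" for D
    using f[OF that] closed[OF that] roots_antimono[of \<alpha> "f D" H] by blast
  have irr: "f D \<in> irreducible_flats" if "D \<in> \<D>" for D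
    using that f rf \<D>(4) by simp
  have below: "\<exists>D\<in>\<D>. f D \<subseteq> \<gamma>" if \<gamma>: "\<gamma> \<in> irreducible_flats" "\<alpha> \<subseteq> \<gamma>" for \<gamma>
  proof -
    obtain D where D: "D \<in> \<D>" "roots H \<gamma> \<subseteq> D"
      using absorb[of "roots H \<gamma>"] \<gamma> roots_antimono by blast
    then have "roots H \<gamma> \<subseteq> span (roots H (f D))"
      using rf span_superset by blast
    then have "f D \<subseteq> \<gamma>"
      using antitone[of \<gamma> "f D" \<alpha>] f[OF D(1)] \<gamma> \<alpha> by simp
    then show ?thesis using D(1) by (rule bexI)
  qed
  have f_anti: "D = D'" if dd: "D \<in> \<D>" "D' \<in> \<D>" "D \<subseteq> D'" for D D'
  proof (rule ccontr)
    assume "D \<noteq> D'"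
    have "D' \<subseteq> span D \<union> span (?R - D)"
      using \<D>(2) dd(2) span_superset[of D] span_superset[of "?R - D"] by blast
    then have "D' \<subseteq> span D \<or> D' \<subseteq> span (?R - D)"
      using indecomposableD[OF \<D>(4)[OF dd(2)] _ _ \<D>(5)[OF dd(1)]] by simp
    moreover obtain d where "d \<in> D" "d \<in> D'" "d \<noteq> 0"
      using ne[OF dd(1)] dd zero_notin_roots[of \<alpha>] \<D>(2) by blast
    ultimately have "D' \<subseteq> span D"
      using \<D>(5)[OF dd(1)] span_base[of d D] by blast
    then show False
      using closed[OF dd(1)] \<D>(2) dd \<open>D \<noteq> D'\<close> by blast
  qed
  have M: "?M = f ` \<D>"
  proof
    show "?M \<subseteq> f ` \<D>"
    proof
      fix \<gamma> assume \<gamma>: "\<gamma> \<in> ?M"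
      then obtain D where D: "D \<in> \<D>" "f D \<subseteq> \<gamma>"
        using below[of \<gamma>] by (auto simp: minimal_above_def)
      then have "f D = \<gamma>"
        using irr[OF D(1)] f[OF D(1)] \<gamma> unfolding minimal_above_def by blast
      then show "\<gamma> \<in> f ` \<D>" using D(1) by blast
    qed
    show "f ` \<D> \<subseteq> ?M"
    proof (intro image_subsetI)
      fix D assume D: "D \<in> \<D>"
      have "\<not> \<gamma> \<subset> f D" if \<gamma>: "\<gamma> \<in> irreducible_flats" "\<alpha> \<subseteq> \<gamma>" for \<gamma>
      proof
        assume "\<gamma> \<subset> f D"
        moreover obtain D' where "D' \<in> \<D>" "f D' \<subseteq> \<gamma>" using below[OF \<gamma>] by blast
        moreover then have "D = D'"
          using \<open>\<gamma> \<subset> f D\<close> f_anti[OF D, of D'] rf[OF D] rf[of D']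
            roots_antimono[of "f D'" "f D" H] by simp
        ultimately show False by simp
      qed
      then show "f D \<in> ?M"
        using irr[OF D] f[OF D] by (auto simp: minimal_above_def)
    qed
  qed
  have inj: "inj_on f \<D>"
  proof (rule inj_onI)
    fix D D' assume D: "D \<in> \<D>" "D' \<in> \<D>" "f D = f D'"
    have "D = roots H (f D)" using rf[OF D(1)] by (rule sym)
    also have "\<dots> = D'" unfolding D(3) by (rule rf[OF D(2)])
    finally show "D = D'" .
  qed
  have U: "(\<Union>\<beta>\<in>?M. span (roots H \<beta>)) = (\<Union>D\<in>\<D>. span D)"
    unfolding M UN_simps using rf by (intro SUP_cong) simp_all
  have "span (\<Union>D\<in>\<D>. span D) = span ?R"
  proof (rule span_eq[THEN iffD2], intro conjI)
    show "(\<Union>D\<in>\<D>. span D) \<subseteq> span ?R"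
      using \<D>(2) span_mono[of _ ?R] by blast
    show "?R \<subseteq> span (\<Union>D\<in>\<D>. span D)"
    proof
      fix r assume "r \<in> ?R"
      then obtain D where "D \<in> \<D>" "r \<in> D" using \<D>(2) by blast
      then show "r \<in> span (\<Union>D\<in>\<D>. span D)"
        by (blast intro: span_base)
    qed
  qed
  then show "span ?R = span (\<Union>\<beta>\<in>?M. span (roots H \<beta>))"
    using U by simp
  have "(\<Sum>\<beta>\<in>?M. dim (span (roots H \<beta>))) = (\<Sum>D\<in>\<D>. dim D)"
    unfolding M sum.reindex[OF inj] by (rule sum.cong) (simp_all add: rf)
  then show "dim (span ?R) = (\<Sum>\<beta>\<in>?M. dim (span (roots H \<beta>)))"
    using \<D>(3) by simp
qed auto

text \<open>
  A building set contains all flats of codimension one, so the minimal members above an irreducible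
  flat capture all its roots; being independent, they reduce to a single one.
\<close>

lemma irreducible_flats_subset_building_set:
  assumes "building_set F H G"
  shows "irreducible_flats \<subseteq> G"
proof
  have GF: "G \<subseteq> F"
    using assms by (simp add: building_set_def)
  have fin: "finite (minimal_above G \<alpha>)" if "\<alpha> \<in> F" for \<alpha>
    by (rule finite_subset[OF _ finite_flats_above[OF that]]) (use GF in \<open>auto simp: minimal_above_def\<close>)
  have sp: "span (roots H \<alpha>) = span (\<Union>\<beta>\<in>minimal_above G \<alpha>. span (roots H \<beta>))"
    and dm: "dim (roots H \<alpha>) = (\<Sum>\<beta>\<in>minimal_above G \<alpha>. dim (roots H \<beta>))" if "\<alpha> \<in> F" for \<alpha>
    using assms that unfolding building_set_def conormal_eq_span_roots dim_span by blast+
  have ex_min: "\<exists>\<gamma>. \<gamma> \<in> minimal_above G \<alpha>" if \<alpha>: "\<alpha> \<in> F" for \<alpha>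
  proof (rule ccontr)
    assume "\<not> ?thesis"
    then have "span (roots H \<alpha>) = {0}"
      using sp[OF \<alpha>] by auto
    moreover obtain v where "v \<in> roots H \<alpha>"
      using roots_nonempty[OF \<alpha>] by (auto simp: ex_in_conv)
    ultimately show False
      using span_base[of v "roots H \<alpha>"] zero_notin_roots[of \<alpha>] by simp
  qed
  have ray: "\<exists>\<beta>\<in>G. \<alpha> \<subseteq> \<beta> \<and> v \<in> roots H \<beta>" if \<alpha>: "\<alpha> \<in> F" "v \<in> roots H \<alpha>" for \<alpha> v
  proof -
    obtain \<beta> where \<beta>: "\<beta> \<in> F" "\<alpha> \<subseteq> \<beta>" "v \<in> roots H \<beta>" "roots H \<beta> \<subseteq> span {v}"
      using ex_flat[OF \<alpha>(1), of "{v}"] \<alpha>(2) by auto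
    obtain \<gamma> where "\<gamma> \<in> minimal_above G \<beta>"
      using ex_min \<beta> by blast
    then have \<gamma>: "\<gamma> \<in> G" "\<gamma> \<in> F" "\<beta> \<subseteq> \<gamma>"
      using GF by (auto simp: minimal_above_def)
    obtain u where u: "u \<in> roots H \<gamma>"
      using roots_nonempty[OF \<gamma>(2)] by (auto simp: ex_in_conv)
    then have "u \<noteq> 0"
      using zero_notin_roots[of \<gamma>] by metis
    have "u \<in> span {v}"
      using u roots_antimono[OF \<gamma>(3), of H] \<beta>(4) by blast
    then obtain c where c: "u = c *\<^sub>R v"
      by (auto simp: span_singleton)
    then have "v = inverse c *\<^sub>R u" using \<open>u \<noteq> 0\<close> by simp
    then have "v \<in> span (roots H \<gamma>)"
      using u by (simp add: span_base span_scale del: scaleR_scaleR)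
    then have "span {v} \<subseteq> span (roots H \<gamma>)"
      by (simp add: span_minimal)
    then have "roots H \<beta> \<subseteq> span (roots H \<gamma>)"
      using \<beta>(4) by simp
    then have "\<beta> = \<gamma>"
      using \<beta>(1) \<gamma>(2,3) by (intro flat_eqI)
    then show ?thesis using \<beta>(2,3) \<gamma>(1) by (intro bexI[of _ \<gamma>]) simp_all
  qed
  fix \<alpha> assume "\<alpha> \<in> irreducible_flats"
  then have \<alpha>: "\<alpha> \<in> F" "indecomposable (roots H \<alpha>)" by auto
  let ?M = "minimal_above G \<alpha>"
  have cover: "\<exists>\<gamma>\<in>?M. v \<in> roots H \<gamma>" if v: "v \<in> roots H \<alpha>" for v
  proof -
    obtain \<beta> where \<beta>: "\<beta> \<in> G" "\<alpha> \<subseteq> \<beta>" "v \<in> roots H \<beta>"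
      using ray[OF \<alpha>(1) v] by blast
    let ?S = "{\<gamma> \<in> G. \<alpha> \<subseteq> \<gamma> \<and> \<gamma> \<subseteq> \<beta>}"
    have "finite ?S"
      by (rule finite_subset[OF _ finite_flats_above[OF \<alpha>(1)]]) (use GF in auto)
    then obtain \<gamma> where \<gamma>: "\<gamma> \<in> ?S" "\<And>\<delta>. \<delta> \<in> ?S \<Longrightarrow> \<delta> \<subseteq> \<gamma> \<Longrightarrow> \<gamma> = \<delta>"
      using finite_has_minimal[of ?S] \<beta>(1,2) by (metis (lifting) empty_iff mem_Collect_eq order_refl)
    have "\<gamma> \<in> ?M"
      unfolding minimal_above_def
    proof (intro CollectI conjI notI)
      assume "\<exists>\<delta>\<in>G. \<alpha> \<subseteq> \<delta> \<and> \<delta> \<subset> \<gamma>"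
      then obtain \<delta> where "\<delta> \<in> G" "\<alpha> \<subseteq> \<delta>" "\<delta> \<subset> \<gamma>" by auto
      then show False using \<gamma>(1) \<gamma>(2)[of \<delta>] by auto
    qed (use \<gamma>(1) in simp_all)
    moreover have "v \<in> roots H \<gamma>"
      using \<gamma>(1) \<beta>(3) roots_antimono[of \<gamma> \<beta> H] by blast
    ultimately show ?thesis by blast
  qed
  obtain \<gamma> where \<gamma>: "\<gamma> \<in> ?M"
    using ex_min[OF \<alpha>(1)] by blast
  then have \<gamma>F: "\<gamma> \<in> F" "\<gamma> \<in> G" "\<alpha> \<subseteq> \<gamma>"
    using GF by (auto simp: minimal_above_def)
  \<comment> \<open>Additivity of dimensions makes one minimal member independent of all the others together.\<close>
  define A B where "A = roots H \<gamma>" and "B = (\<Union>\<delta>\<in>?M - {\<gamma>}. roots H \<delta>)"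
  have sub: "roots H \<alpha> \<subseteq> A \<union> B"
    using cover unfolding A_def B_def by fastforce
  have "dim A + dim B \<le> dim A + (\<Sum>\<delta>\<in>?M - {\<gamma>}. dim (roots H \<delta>))"
    unfolding B_def using fin[OF \<alpha>(1)] by (simp add: dim_UN_le)
  also have "\<dots> = dim (roots H \<alpha>)"
    unfolding dm[OF \<alpha>(1)] sum.remove[OF fin[OF \<alpha>(1)] \<gamma>] by (simp add: A_def)
  also have "\<dots> \<le> dim (A \<union> B)"
    using sub by (rule dim_subset)
  finally have ind: "span A \<inter> span B \<subseteq> {0}"
    by (rule independent_if_dim_Un)
  have "roots H \<alpha> \<subseteq> span A \<union> span B"
    using sub span_superset[of A] span_superset[of B] by auto
  then have "roots H \<alpha> \<subseteq> span A \<or> roots H \<alpha> \<subseteq> span B"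
    using indecomposableD[OF \<alpha>(2) _ _ ind] by simp
  moreover have "\<not> roots H \<alpha> \<subseteq> span B"
  proof
    assume "roots H \<alpha> \<subseteq> span B"
    then have "A \<subseteq> span A \<inter> span B"
      using roots_antimono[OF \<gamma>F(3), of H] span_superset[of A] unfolding A_def by blast
    moreover obtain v where "v \<in> A"
      using roots_nonempty[OF \<gamma>F(1)] by (auto simp: A_def)
    ultimately have "v = 0" "v \<in> roots H \<gamma>"
      using ind by (auto simp: A_def)
    then show False
      using zero_notin_roots[of \<gamma>] by simp
  qed
  ultimately have "\<alpha> = \<gamma>"
    using \<alpha> \<gamma>F by (intro flat_eqI) (auto simp: A_def)
  then show "\<alpha> \<in> G" using \<gamma>F by simp
qed

theorem Min_building_eq_irreducible_flats: "Min_building F H = irreducible_flats"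
  unfolding Min_building_def
  by (rule Least_equality) (use building_set_irreducible_flats irreducible_flats_subset_building_set in auto)

end

section \<open>Arrangements that look linear\<close>

lemma orthogonal_annihilates_span:
  fixes v w :: "'a::euclidean_space"
  assumes "v \<in> span A" "\<And>a. a \<in> A \<Longrightarrow> a \<bullet> w = 0"
  shows "v \<bullet> w = 0"
  using assms orthogonal_to_span[of v A w] by (auto simp: orthogonal_def inner_commute)

lemma in_span_if_annihilated:
  fixes v :: "'a::euclidean_space"
  assumes "\<And>w. (\<And>a. a \<in> A \<Longrightarrow> a \<bullet> w = 0) \<Longrightarrow> v \<bullet> w = 0"
  shows "v \<in> span A"
proof -
  obtain y z where yz: "y \<in> span A" "\<And>w. w \<in> span A \<Longrightarrow> orthogonal z w" "v = y + z"
    using orthogonal_subspace_decomp_exists[of A v] by metis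
  have "v \<bullet> z = 0"
    using assms[of z] yz(2) span_base[of _ A] by (auto simp: orthogonal_def inner_commute)
  moreover have "y \<bullet> z = 0"
    using yz(1,2) by (auto simp: orthogonal_def inner_commute)
  ultimately have "z = 0"
    using yz(3) by (simp add: inner_add_left)
  then show ?thesis using yz by simp
qed

text \<open>
  Only incidences are compared with a linear arrangement: every point lies on the same hyperplanes
  as some vector, and conversely for vectors outside the centre. Vectors in the centre need not come
  from a point, since the sphere omits the origin; the centre may be larger than the origin, as the
  line \<open>(1, \<dots>, 1)\<close> shows for particles without symmetry.
\<close>

locale linear_realization =
  fixes X :: "'p set" and H :: "('n::finite, 'p) arrangement"
  assumes finite_H: "finite H"
    and nonzero: "(v, h) \<in> H \<Longrightarrow> v \<noteq> 0"
    and hyperplane_subset: "(v, h) \<in> H \<Longrightarrow> h \<subseteq> X"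
    and vector_of_point: "x \<in> X \<Longrightarrow> \<exists>w. \<forall>(v, h) \<in> H. x \<in> h \<longleftrightarrow> v \<bullet> w = 0"
    and point_of_vector: "(u, g) \<in> H \<Longrightarrow> u \<bullet> w \<noteq> 0 \<Longrightarrow> \<exists>x. \<forall>(v, h) \<in> H. x \<in> h \<longleftrightarrow> v \<bullet> w = 0"
begin

text \<open>
  A hyperplane whose normal vector is outside the span of the others misses some vector orthogonal to
  them. Such a vector is not central, so it comes from a point of the intersection.
\<close>

lemma roots_Inter_subset_span:
  assumes "K \<subseteq> H"
  shows "roots H (\<Inter>(snd ` K)) \<subseteq> span (fst ` K)"
proof
  fix v assume "v \<in> roots H (\<Inter>(snd ` K))"
  then obtain h where h: "(v, h) \<in> H" "\<Inter>(snd ` K) \<subseteq> h"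
    by (auto simp: roots_iff)
  show "v \<in> span (fst ` K)"
  proof (rule in_span_if_annihilated)
    fix w assume w: "\<And>a. a \<in> fst ` K \<Longrightarrow> a \<bullet> w = 0"
    show "v \<bullet> w = 0"
    proof (rule ccontr)
      assume "v \<bullet> w \<noteq> 0"
      then obtain x where x: "\<forall>(v, h) \<in> H. x \<in> h \<longleftrightarrow> v \<bullet> w = 0"
        using point_of_vector[OF h(1)] by blast
      have "x \<in> \<Inter>(snd ` K)"
        using x w assms by fastforce
      then show False
        using x h \<open>v \<bullet> w \<noteq> 0\<close> by auto
    qed
  qed
qed

lemma flat_geometry: "flat_geometry (spherical_flats H) H"
proof
  show "finite H" by (rule finite_H)
  show "v \<noteq> 0" if "(v, h) \<in> H" for v h using nonzero[OF that] .
next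
  fix \<alpha> assume "\<alpha> \<in> spherical_flats H"
  then obtain K where "K \<subseteq> H" "K \<noteq> {}" "\<alpha> = \<Inter>(snd ` K)"
    by (auto simp: spherical_flats_def)
  then show "roots H \<alpha> \<noteq> {}"
    by (force simp: roots_def hyps_containing_def)
next
  fix \<alpha> \<beta> assume "\<alpha> \<in> spherical_flats H" and "\<beta> \<in> spherical_flats H" and
    sub: "roots H \<alpha> \<subseteq> span (roots H \<beta>)"
  then obtain K L where K: "K \<subseteq> H" "\<alpha> = \<Inter>(snd ` K)" and L: "L \<subseteq> H" "L \<noteq> {}" "\<beta> = \<Inter>(snd ` L)"
    by (auto simp: spherical_flats_def)
  show "\<beta> \<subseteq> \<alpha>"
  proof
    fix x assume x: "x \<in> \<beta>"
    then have "x \<in> X"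
      using L hyperplane_subset by fastforce
    then obtain w where w: "\<forall>(v, h) \<in> H. x \<in> h \<longleftrightarrow> v \<bullet> w = 0"
      using vector_of_point by blast
    have "x \<in> h" if vh: "(v, h) \<in> K" for v h
    proof -
      have "v \<in> roots H \<alpha>"
        using vh K by (force simp: roots_iff)
      then have "v \<in> span (roots H \<beta>)"
        using sub by blast
      then have "v \<bullet> w = 0"
        by (rule orthogonal_annihilates_span) (use w x in \<open>auto simp: roots_iff\<close>)
      then show ?thesis
        using w vh K by auto
    qed
    then show "x \<in> \<alpha>" using K(2) by auto
  qed
next
  fix \<alpha> A assume A: "A \<subseteq> roots H \<alpha>" "A \<noteq> {}"
  define K where "K = {(v, h) \<in> H. v \<in> A \<and> \<alpha> \<subseteq> h}"
  have K: "K \<subseteq> H" "fst ` K = A" "\<alpha> \<subseteq> \<Inter>(snd ` K)"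
    using A by (force simp: K_def roots_iff image_iff)+
  moreover have "K \<noteq> {}" using K(2) A(2) by blast
  moreover have "A \<subseteq> roots H (\<Inter>(snd ` K))"
    unfolding K(2)[symmetric] using K(1) by (force simp: roots_iff)
  ultimately show "\<exists>\<beta>\<in>spherical_flats H. \<alpha> \<subseteq> \<beta> \<and> A \<subseteq> roots H \<beta> \<and> roots H \<beta> \<subseteq> span A"
    using roots_Inter_subset_span[OF K(1)] unfolding spherical_flats_def
    by (intro bexI[of _ "\<Inter>(snd ` K)"]) auto
qed

end

section \<open>Toric arrangements\<close>

lemma cis_eq_iff: "cis a = cis b \<longleftrightarrow> (\<exists>k::int. a - b = 2 * pi * k)"
proof -
  have "cis a = cis b \<longleftrightarrow> cis (a - b) = 1"
    by (metis cis_divide cis_neq_zero divide_eq_1_iff)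
  also have "\<dots> \<longleftrightarrow> cos (a - b) = 1"
    using cos_one_sin_zero by (auto simp: complex_eq_iff)
  finally show ?thesis
    by (simp add: cos_one_2pi_int algebra_simps)
qed

lemma cis_Arg_of_norm_1: "norm z = 1 \<Longrightarrow> cis (Arg z) = z"
  by (subst cis_Arg) (auto simp: sgn_eq)

text \<open>
  The exponential map based at \<open>p\<close>, with tangent vectors measured in radians.
\<close>

definition torus_shift :: "complex ^ 'n \<Rightarrow> real ^ 'n \<Rightarrow> complex ^ 'n" where
  "torus_shift p t = (\<chi> i. p $ i * cis (t $ i))"

lemma torus_shift_nth [simp]: "torus_shift p t $ i = p $ i * cis (t $ i)"
  by (simp add: torus_shift_def)

lemma torus_shift_zero [simp]: "torus_shift p 0 = p"
  by (simp add: vec_eq_iff)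

lemma torus_shift_add: "torus_shift (torus_shift p s) t = torus_shift p (s + t)"
  by (simp add: vec_eq_iff cis_mult[symmetric] mult.assoc)

lemma continuous_on_torus_shift: "continuous_on S (torus_shift p)"
  unfolding torus_shift_def by (intro continuous_intros)

text \<open>
  For a set \<open>V\<close> of rational vectors this is the translate through \<open>p\<close> of a subtorus.
\<close>

definition leaf :: "complex ^ 'n \<Rightarrow> (real ^ 'n) set \<Rightarrow> (complex ^ 'n) set" where
  "leaf p V = torus_shift p ` {t. \<forall>v\<in>V. v \<bullet> t = 0}"

lemma in_leaf_iff: "z \<in> leaf p V \<longleftrightarrow> (\<exists>t. z = torus_shift p t \<and> (\<forall>v\<in>V. v \<bullet> t = 0))"
  by (auto simp: leaf_def)

lemma self_in_leaf: "p \<in> leaf p V"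
  unfolding in_leaf_iff by (intro exI[of _ 0]) simp

lemma connected_leaf: "connected (leaf p V)"
  unfolding leaf_def
proof (intro connected_continuous_image continuous_on_torus_shift convex_connected)
  show "convex {t. \<forall>v\<in>V. v \<bullet> t = (0::real)}"
    by (simp add: convex_def inner_add_right)
qed

lemma leaf_mono:
  fixes V V' :: "(real ^ 'n::finite) set"
  assumes "V \<subseteq> span V'"
  shows "leaf p V' \<subseteq> leaf p V"
  unfolding leaf_def using assms orthogonal_annihilates_span[of _ V'] by (intro image_mono) blast

lemma leaf_base_change:
  assumes "q \<in> leaf p V"
  shows "leaf q V = leaf p V"
proof -
  obtain s where s: "q = torus_shift p s" "\<forall>v\<in>V. v \<bullet> s = 0"
    using assms by (auto simp: in_leaf_iff)
  have "z \<in> leaf q V" if z: "z \<in> leaf p V" for z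
  proof -
    obtain t where "z = torus_shift p t" "\<forall>v\<in>V. v \<bullet> t = 0"
      using z by (auto simp: in_leaf_iff)
    with s show ?thesis
      unfolding in_leaf_iff by (intro exI[of _ "t - s"]) (simp add: torus_shift_add inner_diff_right)
  qed
  moreover have "z \<in> leaf p V" if z: "z \<in> leaf q V" for z
  proof -
    obtain t where "z = torus_shift q t" "\<forall>v\<in>V. v \<bullet> t = 0"
      using z by (auto simp: in_leaf_iff)
    with s show ?thesis
      unfolding in_leaf_iff by (intro exI[of _ "s + t"]) (simp add: torus_shift_add inner_add_right)
  qed
  ultimately show ?thesis by blast
qed

text \<open>
  A hyperplane is the image of the affine hyperplanes \<open>v \<bullet> t = 2 * pi * k\<close>. The bound on the
  normal vectors allows a single neighbourhood size in \<open>small_shift\<close> and holds with equality for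
  the roots \<open>\<plusminus> e\<^sub>i \<plusminus> e\<^sub>j\<close>.
\<close>

locale toric_arrangement =
  fixes H :: "('n::finite, complex ^ 'n) arrangement"
  assumes finite_H: "finite H"
    and nonzero: "(v, h) \<in> H \<Longrightarrow> v \<noteq> 0"
    and small: "(v, h) \<in> H \<Longrightarrow> (\<Sum>i\<in>UNIV. \<bar>v $ i\<bar>) \<le> 2"
    and hyperplane_subset: "(v, h) \<in> H \<Longrightarrow> h \<subseteq> torus"
    and shift_in_iff: "(v, h) \<in> H \<Longrightarrow> p \<in> h \<Longrightarrow> torus_shift p t \<in> h \<longleftrightarrow> (\<exists>k::int. v \<bullet> t = 2 * pi * k)"
begin

text \<open>
  A displacement that moves every particle by less than half a turn changes \<open>v \<bullet> s\<close> by less than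
  \<open>2 * pi\<close>, so it stays on a hyperplane only along the hyperplane.
\<close>

lemma small_shift:
  assumes vh: "(v, h) \<in> H" "z \<in> h" "torus_shift z s \<in> h" and s: "\<And>i. \<bar>s $ i\<bar> < pi"
  shows "v \<bullet> s = 0"
proof -
  obtain k :: int where k: "v \<bullet> s = 2 * pi * k"
    using shift_in_iff[OF vh(1,2)] vh(3) by blast
  obtain j where j: "v $ j \<noteq> 0"
    using nonzero[OF vh(1)] by (auto simp: vec_eq_iff)
  have "\<bar>v \<bullet> s\<bar> \<le> (\<Sum>i\<in>UNIV. \<bar>v $ i\<bar> * \<bar>s $ i\<bar>)"
    unfolding inner_vec_def by (rule order_trans[OF sum_abs]) (simp add: abs_mult)
  also have "\<dots> < (\<Sum>i\<in>UNIV. \<bar>v $ i\<bar> * pi)"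
  proof (rule sum_strict_mono_ex1)
    show "\<forall>i\<in>UNIV. \<bar>v $ i\<bar> * \<bar>s $ i\<bar> \<le> \<bar>v $ i\<bar> * pi"
      using less_imp_le[OF s] by (simp add: mult_left_mono)
    show "\<exists>i\<in>UNIV. \<bar>v $ i\<bar> * \<bar>s $ i\<bar> < \<bar>v $ i\<bar> * pi"
      using s[of j] j by (intro bexI[of _ j]) auto
  qed simp
  also have "\<dots> \<le> 2 * pi"
    using small[OF vh(1)] by (simp add: sum_distrib_right[symmetric])
  finally have "2 * pi * \<bar>real_of_int k\<bar> < 2 * pi * 1"
    using k by (simp add: abs_mult)
  then have "\<bar>real_of_int k\<bar> < 1"
    by (rule mult_left_less_imp_less) simp
  then have "k = 0" by linarith
  then show ?thesis using k by simp
qed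

lemma leaf_subset_Inter:
  assumes "K \<subseteq> H" "p \<in> \<Inter>(snd ` K)"
  shows "leaf p (fst ` K) \<subseteq> \<Inter>(snd ` K)"
proof -
  have "torus_shift p t \<in> h" if "(v, h) \<in> K" "\<forall>v\<in>fst ` K. v \<bullet> t = 0" for v h t
  proof -
    have "v \<bullet> t = 2 * pi * of_int 0" "p \<in> h" using that assms(2) by force+
    then show ?thesis
      using shift_in_iff[of v h p t] assms(1) that(1) by blast
  qed
  then show ?thesis by (force simp: in_leaf_iff)
qed

text \<open>
  Near a point \<open>z\<close> of the intersection, avoiding the antipodes of all coordinates of \<open>z\<close>, every
  point is a displacement of \<open>z\<close> by less than half a turn, to which \<open>small_shift\<close> applies.
\<close>

lemma openin_leaf:
  assumes K: "K \<subseteq> H" "K \<noteq> {}" and p: "p \<in> \<Inter>(snd ` K)"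
  shows "openin (top_of_set (\<Inter>(snd ` K))) (leaf p (fst ` K))"
proof (subst openin_subopen, intro ballI)
  let ?I = "\<Inter>(snd ` K)"
  fix z assume z: "z \<in> leaf p (fst ` K)"
  let ?N = "\<Inter>i. {y :: complex ^ 'n. y $ i \<noteq> - z $ i}"
  have I_torus: "?I \<subseteq> torus"
    using K hyperplane_subset by fastforce
  have zI: "z \<in> ?I"
    using z leaf_subset_Inter[OF K(1) p] by blast
  have "open ?N"
    by (intro open_INT ballI open_Collect_neq continuous_intros) auto
  moreover have "z \<in> ?N"
  proof (intro INT_I CollectI notI)
    fix i assume "z $ i = - z $ i"
    then have "z $ i = 0" by (simp add: complex_eq_iff)
    moreover have "norm (z $ i) = 1"
      using subsetD[OF I_torus zI] by (simp add: torus_def)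
    ultimately show False by simp
  qed
  moreover have "?I \<inter> ?N \<subseteq> leaf p (fst ` K)"
  proof
    fix y assume y: "y \<in> ?I \<inter> ?N"
    have norms: "norm (y $ i) = 1" "norm (z $ i) = 1" for i
      using y zI I_torus by (auto simp: torus_def)
    define s :: "real ^ 'n" where "s = (\<chi> i. Arg (y $ i / z $ i))"
    have ne: "z $ i \<noteq> 0" "y $ i \<noteq> 0" for i
      using norms[of i] by auto
    have "cis (s $ i) = y $ i / z $ i" for i
      using norms[of i] by (simp add: s_def cis_Arg_of_norm_1 norm_divide)
    then have y_eq: "y = torus_shift z s"
      using ne by (simp add: vec_eq_iff)
    have "\<bar>s $ i\<bar> < pi" for i
    proof -
      have "s $ i \<noteq> pi"
      proof
        assume "s $ i = pi"
        then have "y $ i = - z $ i"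
          by (simp add: y_eq)
        then show False using y by blast
      qed
      moreover have "- pi < s $ i \<and> s $ i \<le> pi"
        by (simp add: s_def Arg_bounded)
      ultimately show ?thesis by linarith
    qed
    then have s0: "v \<bullet> s = 0" if "v \<in> fst ` K" for v
      using that small_shift[of v _ z s] zI y K(1) unfolding y_eq by fastforce
    obtain t where t: "z = torus_shift p t" "\<forall>v\<in>fst ` K. v \<bullet> t = 0"
      using z by (auto simp: in_leaf_iff)
    have "y = torus_shift p (t + s)"
      by (simp add: y_eq t torus_shift_add)
    then show "y \<in> leaf p (fst ` K)"
      using t s0 unfolding in_leaf_iff by (intro exI[of _ "t + s"]) (auto simp: inner_add_right)
  qed
  ultimately show "\<exists>T. openin (top_of_set ?I) T \<and> z \<in> T \<and> T \<subseteq> leaf p (fst ` K)"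
    using zI by (intro exI[of _ "?I \<inter> ?N"]) (auto simp: openin_open)
qed

text \<open>
  Leaves are connected, open in the intersection, and either equal or disjoint; hence they are also
  closed in the intersection.
\<close>

lemma component_eq_leaf:
  assumes K: "K \<subseteq> H" "K \<noteq> {}" and p: "p \<in> \<Inter>(snd ` K)"
  shows "connected_component_of_set (top_of_set (\<Inter>(snd ` K))) p = leaf p (fst ` K)"
proof
  let ?I = "\<Inter>(snd ` K)" and ?L = "leaf p (fst ` K)"
  let ?C = "connected_component_of_set (top_of_set ?I) p"
  have conn: "connectedin (top_of_set ?I) ?L"
    using connected_leaf leaf_subset_Inter[OF K(1) p]
    by (simp add: connectedin_subtopology)
  then show "?L \<subseteq> ?C"
    using self_in_leaf by (intro connected_component_of_maximal)
  have C: "connected ?C" "?C \<subseteq> ?I"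
    using connectedin_connected_component_of[of "top_of_set ?I" p] by (simp_all add: connectedin_subtopology)
  have meet: "q \<in> ?L" if q: "q \<in> ?I" and z: "z \<in> leaf q (fst ` K)" "z \<in> ?L" for q z
  proof -
    obtain s t where st: "z = torus_shift q s" "\<forall>v\<in>fst ` K. v \<bullet> s = 0" "z = torus_shift p t" "\<forall>v\<in>fst ` K. v \<bullet> t = 0"
      using z unfolding in_leaf_iff by blast
    have "q = torus_shift (torus_shift q s) (- s)" by (simp add: torus_shift_add)
    also have "\<dots> = torus_shift p (t - s)" by (simp add: st(1)[symmetric] st(3) torus_shift_add)
    finally show ?thesis using st unfolding in_leaf_iff by (intro exI[of _ "t - s"]) (auto simp: inner_diff_right)
  qed
  have co: "openin (top_of_set ?I) (?I - ?L)"
  proof -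
    have "?I - ?L = (\<Union>q\<in>?I - ?L. leaf q (fst ` K))"
    proof
      show "?I - ?L \<subseteq> (\<Union>q\<in>?I - ?L. leaf q (fst ` K))"
        using self_in_leaf by blast
      show "(\<Union>q\<in>?I - ?L. leaf q (fst ` K)) \<subseteq> ?I - ?L"
      proof
        fix z assume "z \<in> (\<Union>q\<in>?I - ?L. leaf q (fst ` K))"
        then obtain q where q: "q \<in> ?I" "q \<notin> ?L" "z \<in> leaf q (fst ` K)" by auto
        have "z \<in> ?I"
          using leaf_subset_Inter[OF K(1) q(1)] q(3) by (rule subsetD)
        moreover have "z \<notin> ?L"
          using meet[OF q(1,3)] q(2) by (rule contrapos_nn[rotated])
        ultimately show "z \<in> ?I - ?L" by (rule DiffI)
      qed
    qed
    moreover have "openin (top_of_set ?I) (\<Union>q\<in>?I - ?L. leaf q (fst ` K))"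
    proof (rule openin_Union)
      fix S assume "S \<in> (\<lambda>q. leaf q (fst ` K)) ` (?I - ?L)"
      then obtain q where "S = leaf q (fst ` K)" "q \<in> ?I" by (elim imageE DiffE)
      then show "openin (top_of_set ?I) S" using openin_leaf[OF K, of q] by simp
    qed
    ultimately show ?thesis by simp
  qed
  show "?C \<subseteq> ?L"
  proof (rule ccontr)
    assume "\<not> ?C \<subseteq> ?L"
    moreover have "p \<in> ?C" using p by (simp add: connected_component_of_refl)
    moreover obtain T1 T2 where T: "open T1" "?L = ?I \<inter> T1" "open T2" "?I - ?L = ?I \<inter> T2"
      using openin_leaf[OF K p] co by (auto simp: openin_open)
    moreover have "T1 \<inter> T2 \<inter> ?C = {}" "?C \<subseteq> T1 \<union> T2"
      using T(2,4) C(2) by auto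
    moreover have "p \<in> ?I \<inter> T1"
      unfolding T(2)[symmetric] by (rule self_in_leaf)
    moreover then have "T1 \<inter> ?C \<noteq> {}"
      using \<open>p \<in> ?C\<close> by blast
    moreover have "T2 \<inter> ?C \<noteq> {}"
      using \<open>\<not> ?C \<subseteq> ?L\<close> T(4) C(2) by blast
    ultimately show False
      using connectedD[OF C(1), of T1 T2] by simp
  qed
qed

lemma toroidal_flats_eq:
  "toroidal_flats (top_of_set torus) H = {leaf p (fst ` K) | p K. K \<subseteq> H \<and> K \<noteq> {} \<and> p \<in> \<Inter>(snd ` K)}"
proof -
  have "connected_components_of (subtopology (top_of_set torus) (\<Inter>(snd ` K))) =
      {leaf p (fst ` K) | p. p \<in> \<Inter>(snd ` K)}" if K: "K \<subseteq> H" "K \<noteq> {}" for K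
  proof -
    have "\<Inter>(snd ` K) \<subseteq> torus" using K hyperplane_subset by fastforce
    then have "subtopology (top_of_set torus) (\<Inter>(snd ` K)) = top_of_set (\<Inter>(snd ` K))"
      by (simp add: subtopology_subtopology inf_absorb2)
    then show ?thesis
      unfolding connected_components_of_def using component_eq_leaf[OF K] by auto
  qed
  then have "toroidal_flats (top_of_set torus) H =
      (\<Union>K\<in>{K. K \<subseteq> H \<and> K \<noteq> {}}. {leaf p (fst ` K) | p. p \<in> \<Inter>(snd ` K)})"
    unfolding toroidal_flats_def by (intro SUP_cong refl) simp
  then show ?thesis
    by (rule trans) blast
qed

text \<open>
  If \<open>v \<bullet> w\<close> is nonzero for some direction \<open>w\<close> of the leaf, a multiple of \<open>w\<close> has product \<open>pi\<close>
  with \<open>v\<close> and leaves the hyperplane.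
\<close>

lemma leaf_subset_hyperplane_iff:
  assumes vh: "(v, h) \<in> H" "p \<in> h"
  shows "leaf p V \<subseteq> h \<longleftrightarrow> v \<in> span V"
proof
  assume sub: "leaf p V \<subseteq> h"
  show "v \<in> span V"
  proof (rule in_span_if_annihilated)
    fix w assume w: "\<And>a. a \<in> V \<Longrightarrow> a \<bullet> w = 0"
    show "v \<bullet> w = 0"
    proof (rule ccontr)
      assume ne: "v \<bullet> w \<noteq> 0"
      let ?t = "(pi / (v \<bullet> w)) *\<^sub>R w"
      have "torus_shift p ?t \<in> h"
      proof (rule subsetD[OF sub])
        show "torus_shift p ?t \<in> leaf p V"
          unfolding in_leaf_iff using w by (intro exI[of _ ?t]) simp
      qed
      then obtain k :: int where "v \<bullet> ?t = 2 * pi * k"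
        using shift_in_iff[OF vh] by blast
      then have "pi * 1 = pi * (2 * real_of_int k)" using ne by simp
      then have "1 = 2 * real_of_int k"
        using mult_left_cancel[OF pi_neq_zero] by blast
      then have "1 = 2 * k" by linarith
      then show False by presburger
    qed
  qed
next
  assume v: "v \<in> span V"
  show "leaf p V \<subseteq> h"
    unfolding leaf_def
  proof (intro image_subsetI)
    fix t assume "t \<in> {t. \<forall>v\<in>V. v \<bullet> t = 0}"
    then have "v \<bullet> t = 2 * pi * of_int 0"
      using orthogonal_annihilates_span[OF v] by simp
    then show "torus_shift p t \<in> h"
      using shift_in_iff[OF vh] by blast
  qed
qed

lemma roots_leaf: "roots H (leaf p V) = {v. \<exists>h. (v, h) \<in> H \<and> p \<in> h \<and> v \<in> span V}"
proof -
  have "(v, h) \<in> H \<and> leaf p V \<subseteq> h \<longleftrightarrow> (v, h) \<in> H \<and> p \<in> h \<and> v \<in> span V" for v h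
    using leaf_subset_hyperplane_iff[of v h p V] self_in_leaf[of p V] by blast
  then show ?thesis
    by (simp add: roots_iff set_eq_iff)
qed

lemma flat_eq_leaf_roots:
  assumes "\<alpha> \<in> toroidal_flats (top_of_set torus) H" "p \<in> \<alpha>"
  shows "\<alpha> = leaf p (roots H \<alpha>)"
proof -
  obtain q K where K: "K \<subseteq> H" "q \<in> \<Inter>(snd ` K)" "\<alpha> = leaf q (fst ` K)"
    using assms(1) toroidal_flats_eq by auto
  then have \<alpha>: "\<alpha> = leaf p (fst ` K)"
    using leaf_base_change assms(2) by blast
  have "roots H \<alpha> \<subseteq> span (fst ` K)"
    unfolding \<alpha> roots_leaf by blast
  moreover have "fst ` K \<subseteq> roots H \<alpha>"
    using K leaf_subset_Inter[OF K(1,2)] by (fastforce simp: roots_iff)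
  ultimately have "leaf p (roots H \<alpha>) = leaf p (fst ` K)"
    by (intro equalityI leaf_mono) (auto intro: span_base)
  then show ?thesis using \<alpha> by simp
qed

lemma flat_geometry: "flat_geometry (toroidal_flats (top_of_set torus) H) H"
proof
  let ?F = "toroidal_flats (top_of_set torus) H"
  show "finite H" by (rule finite_H)
  show "v \<noteq> 0" if "(v, h) \<in> H" for v h using nonzero[OF that] .
  have ne: "\<alpha> \<noteq> {}" if "\<alpha> \<in> ?F" for \<alpha>
    using that self_in_leaf unfolding toroidal_flats_eq by fastforce
  show "roots H \<alpha> \<noteq> {}" if \<alpha>: "\<alpha> \<in> ?F" for \<alpha>
  proof -
    obtain q K where K: "K \<subseteq> H" "K \<noteq> {}" "q \<in> \<Inter>(snd ` K)" "\<alpha> = leaf q (fst ` K)"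
      using \<alpha> unfolding toroidal_flats_eq by auto
    then have "fst ` K \<subseteq> roots H \<alpha>"
      using leaf_subset_Inter[OF K(1,3)] by (fastforce simp: roots_iff)
    then show ?thesis using K(2) by blast
  qed
  show "\<beta> \<subseteq> \<alpha>" if fl: "\<alpha> \<in> ?F" "\<beta> \<in> ?F" "\<gamma> \<in> ?F" "\<gamma> \<subseteq> \<alpha>" "\<gamma> \<subseteq> \<beta>" "roots H \<alpha> \<subseteq> span (roots H \<beta>)"
    for \<alpha> \<beta> \<gamma>
  proof -
    obtain p where "p \<in> \<alpha>" "p \<in> \<beta>" using ne[OF fl(3)] fl(4,5) by blast
    then show ?thesis
      using flat_eq_leaf_roots[OF fl(1), of p] flat_eq_leaf_roots[OF fl(2), of p] leaf_mono[OF fl(6), of p] by simp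
  qed
  show "\<exists>\<beta>\<in>?F. \<alpha> \<subseteq> \<beta> \<and> A \<subseteq> roots H \<beta> \<and> roots H \<beta> \<subseteq> span A"
    if \<alpha>: "\<alpha> \<in> ?F" and A: "A \<subseteq> roots H \<alpha>" "A \<noteq> {}" for \<alpha> A
  proof -
    obtain p where p: "p \<in> \<alpha>" using ne[OF \<alpha>] by blast
    define K where "K = {(v, h) \<in> H. v \<in> A \<and> \<alpha> \<subseteq> h}"
    have K: "K \<subseteq> H" "fst ` K = A" "\<alpha> \<subseteq> \<Inter>(snd ` K)"
      using A by (force simp: K_def roots_iff image_iff)+
    have "K \<noteq> {}" using K(2) A(2) by blast
    then have F: "leaf p A \<in> ?F"
      unfolding toroidal_flats_eq using K p by blast
    moreover have "\<alpha> \<subseteq> leaf p A"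
      using flat_eq_leaf_roots[OF \<alpha> p] leaf_mono[of A "roots H \<alpha>" p] A(1) span_superset[of "roots H \<alpha>"] by auto
    moreover have "A \<subseteq> roots H (leaf p A)"
    proof
      fix v assume v: "v \<in> A"
      then have "v \<in> roots H \<alpha>" using A(1) by blast
      then obtain h where "(v, h) \<in> H" "\<alpha> \<subseteq> h"
        by (auto simp: roots_iff)
      then show "v \<in> roots H (leaf p A)"
        unfolding roots_leaf using p span_base[OF v] by blast
    qed
    moreover have "roots H (leaf p A) \<subseteq> span A"
      unfolding roots_leaf by blast
    ultimately show ?thesis by blast
  qed
qed

end

section \<open>Linking vectors by three-term relations\<close>

text \<open>
  Indecomposability of root sets is always established by this step: in a distribution over two
  independent subspaces, a vector follows any vector with which it has its sum in the family.
\<close>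

lemma summand_in_same_part:
  assumes UW: "subspace U" "subspace W" "U \<inter> W \<subseteq> {0}"
    and x: "x \<in> U" "x \<noteq> 0" and y: "y \<in> U \<union> W" "x + y \<in> U \<union> W"
  shows "y \<in> U"
proof (rule ccontr)
  assume "y \<notin> U"
  then have "y \<in> W" "x + y \<notin> U"
    using y subspace_diff[OF UW(1), of "x + y" x] x(1) by auto
  then have "x \<in> W"
    using y subspace_diff[OF UW(2), of "x + y" y] by simp
  then show False using UW(3) x by blast
qed

text \<open>
  By the symmetry between the two subspaces, one chosen vector \<open>r\<close> may be assumed to lie in the
  first of them.
\<close>

lemma indecomposableI:
  assumes "R \<noteq> {}"
    and "\<And>U W. \<lbrakk>subspace U; subspace W; U \<inter> W \<subseteq> {0}; R \<subseteq> U \<union> W; r \<in> U\<rbrakk> \<Longrightarrow> R \<subseteq> U"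
    and "r \<in> R"
  shows "indecomposable R"
  unfolding indecomposable_def
proof (intro conjI allI impI)
  fix U W :: "'a set"
  assume "subspace U \<and> subspace W \<and> U \<inter> W \<subseteq> {0} \<and> R \<subseteq> U \<union> W"
  then have *: "subspace U" "subspace W" "U \<inter> W \<subseteq> {0}" "R \<subseteq> U \<union> W" "W \<inter> U \<subseteq> {0}" "R \<subseteq> W \<union> U"
    by blast+
  consider "r \<in> U" | "r \<in> W" using *(4) assms(3) by blast
  then show "R \<subseteq> U \<or> R \<subseteq> W"
    using assms(2)[OF *(1-4)] assms(2)[OF *(2,1,5,6)] by cases simp_all
qed (fact assms(1))

text \<open>
  For a fixed \<open>f p0 - f p1\<close>, the relation \<open>(f p0 - f p1) + (f p1 - f q) = f p0 - f q\<close> drags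
  every \<open>f p1 - f q\<close> along, and these generate all differences.
\<close>

lemma indecomposable_differences:
  fixes f :: "'i \<Rightarrow> 'a::real_vector"
  assumes inj: "inj_on f S" and p: "p0 \<in> S" "p1 \<in> S" "p0 \<noteq> p1"
  shows "indecomposable {f p - f q | p q. p \<in> S \<and> q \<in> S \<and> p \<noteq> q}" (is "indecomposable ?R")
proof (rule indecomposableI[where r = "f p0 - f p1"])
  show r: "f p0 - f p1 \<in> ?R" using p by blast
  then show "?R \<noteq> {}" by blast
  fix U W :: "'a set"
  assume UW: "subspace U" "subspace W" "U \<inter> W \<subseteq> {0}" and R: "?R \<subseteq> U \<union> W" and rU: "f p0 - f p1 \<in> U"
  have mem: "f p - f q \<in> U \<union> W" if "p \<in> S" "q \<in> S" for p q
    using R that subspace_0[OF UW(1)] by (cases "p = q") auto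
  have ne: "f p0 - f p1 \<noteq> 0"
    using inj p by (auto dest: inj_onD)
  have base: "f p1 - f q \<in> U" if q: "q \<in> S" for q
    using mem[OF p(2) q] mem[OF p(1) q]
    by (intro summand_in_same_part[OF UW rU ne]) simp_all
  show "?R \<subseteq> U"
  proof
    fix v assume "v \<in> ?R"
    then obtain p q where v: "v = f p - f q" "p \<in> S" "q \<in> S" by blast
    then have "v = (f p1 - f q) - (f p1 - f p)" by simp
    then show "v \<in> U"
      using base[OF v(2)] base[OF v(3)] subspace_diff[OF UW(1)] by metis
  qed
qed

section \<open>Particles without symmetry\<close>

lemma axis_diff_inner: "(axis i 1 - axis j 1) \<bullet> (w :: real ^ 'n::finite) = w $ i - w $ j"
  by (simp add: inner_diff_left inner_axis')

lemma inj_axis: "inj (\<lambda>i. axis i (1::real) :: real ^ 'n::finite)"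
  by (auto simp: inj_def axis_eq_axis)

lemma subspace_coordinates: "subspace {v :: real ^ 'n. \<forall>k\<in>L. v $ k = 0}"
  by (auto simp: subspace_def)

lemma complementary_coordinates:
  "{v :: real ^ 'n. \<forall>k\<in>- L. v $ k = 0} \<inter> {v. \<forall>k\<in>L. v $ k = 0} \<subseteq> {0}"
  by (auto simp: vec_eq_iff) (metis ComplI)

text \<open>
  The form in which irreducibility of a flat is exploited: if no vector of the family mixes
  coordinates inside and outside \<open>L\<close>, then one vector that uses \<open>L\<close> confines all of them to \<open>L\<close>.
\<close>

lemma indecomposable_supported:
  fixes R :: "(real ^ 'n) set"
  assumes R: "indecomposable R"
    and split: "\<And>v. v \<in> R \<Longrightarrow> (\<forall>k\<in>- L. v $ k = 0) \<or> (\<forall>k\<in>L. v $ k = 0)"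
    and u: "u \<in> R" "k \<in> L" "u $ k \<noteq> 0"
    and v: "v \<in> R" "l \<notin> L"
  shows "v $ l = 0"
proof -
  have "R \<subseteq> {v. \<forall>k\<in>- L. v $ k = 0} \<or> R \<subseteq> {v. \<forall>k\<in>L. v $ k = 0}"
    by (rule indecomposableD[OF R subspace_coordinates subspace_coordinates complementary_coordinates])
      (use split in blast)
  then show ?thesis using u v by blast
qed

text \<open>
  Common ground for particles on the line and on the circle: \<open>hyp i j\<close> is the set of points at
  which \<open>i\<close> and \<open>j\<close> have collided, and for these collisions a point can be replaced by a vector.
\<close>

locale type_A_arrangement =
  fixes X :: "'p set" and hyp :: "'n::finite \<Rightarrow> 'n \<Rightarrow> 'p set" and H :: "('n, 'p) arrangement"
  assumes H_eq: "H = {(axis i 1 - axis j 1, hyp i j) | i j. i \<noteq> j}"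
    and hyp_subset: "hyp i j \<subseteq> X"
    and values_of_point: "x \<in> X \<Longrightarrow> \<exists>w :: real ^ 'n. \<forall>i j. i \<noteq> j \<longrightarrow> (x \<in> hyp i j \<longleftrightarrow> w $ i = w $ j)"
    and point_of_values: "w $ k \<noteq> w $ l \<Longrightarrow> \<exists>x. \<forall>i j. i \<noteq> j \<longrightarrow> (x \<in> hyp i j \<longleftrightarrow> (w :: real ^ 'n) $ i = w $ j)"
begin

lemma linear_realization: "linear_realization X H"
proof
  have "H \<subseteq> (\<lambda>(i, j). (axis i 1 - axis j 1, hyp i j)) ` UNIV"
    unfolding H_eq by auto
  then show "finite H" by (rule finite_subset) simp
  show "v \<noteq> 0" if "(v, h) \<in> H" for v h
    using that unfolding H_eq by (auto simp: axis_eq_axis)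
  show "h \<subseteq> X" if "(v, h) \<in> H" for v h
    using that hyp_subset unfolding H_eq by auto
  show "\<exists>w. \<forall>(v, h)\<in>H. x \<in> h \<longleftrightarrow> v \<bullet> w = 0" if x: "x \<in> X" for x
  proof -
    obtain w :: "real ^ 'n" where "\<forall>i j. i \<noteq> j \<longrightarrow> (x \<in> hyp i j \<longleftrightarrow> w $ i = w $ j)"
      using values_of_point[OF x] by blast
    then show ?thesis
      unfolding H_eq by (intro exI[of _ w]) (auto simp: axis_diff_inner)
  qed
  show "\<exists>x. \<forall>(v, h)\<in>H. x \<in> h \<longleftrightarrow> v \<bullet> w = 0" if u: "(u, g) \<in> H" "u \<bullet> w \<noteq> 0" for u g w
  proof -
    obtain k l where "w $ k \<noteq> w $ l"
      using u unfolding H_eq by (auto simp: axis_diff_inner)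
    then obtain x where "\<forall>i j. i \<noteq> j \<longrightarrow> (x \<in> hyp i j \<longleftrightarrow> w $ i = w $ j)"
      using point_of_values by blast
    then show ?thesis
      unfolding H_eq by (intro exI[of _ x]) (auto simp: axis_diff_inner)
  qed
qed

sublocale linear_realization X H by (rule linear_realization)
sublocale flat_geometry "spherical_flats H" H by (rule flat_geometry)

definition collision :: "'n set \<Rightarrow> 'p set" where
  "collision S = (\<Inter>(i, j)\<in>{(i, j). i \<in> S \<and> j \<in> S \<and> i \<noteq> j}. hyp i j)"

lemma collision_flat:
  assumes S: "k \<in> S" "l \<in> S" "k \<noteq> l"
  shows "collision S \<in> spherical_flats H" "indecomposable (roots H (collision S))"
    "{axis i 1 - axis j 1 | i j. i \<in> S \<and> j \<in> S \<and> i \<noteq> j} \<subseteq> roots H (collision S)"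
proof -
  let ?Q = "{(i, j). i \<in> S \<and> j \<in> S \<and> i \<noteq> j}"
  let ?R = "{axis i (1::real) - axis j 1 | i j. i \<in> S \<and> j \<in> S \<and> i \<noteq> j}"
  define K :: "('n, 'p) arrangement" where "K = (\<lambda>(i, j). (axis i 1 - axis j 1, hyp i j)) ` ?Q"
  have "K \<subseteq> H" unfolding K_def H_eq by auto
  moreover have "K \<noteq> {}" unfolding K_def using S by blast
  moreover have "snd ` K = (\<lambda>(i, j). hyp i j) ` ?Q"
    unfolding K_def image_image by (rule image_cong) auto
  then have "\<Inter>(snd ` K) = collision S"
    unfolding collision_def by simp
  moreover have "fst ` K = ?R"
  proof -
    have "fst ` K = (\<lambda>(i, j). axis i (1::real) - axis j 1) ` ?Q"
      unfolding K_def image_image by (rule image_cong) auto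
    also have "\<dots> = ?R" by auto
    finally show ?thesis .
  qed
  ultimately have K: "K \<subseteq> H" "K \<noteq> {}" "\<Inter>(snd ` K) = collision S" "fst ` K = ?R" .
  show "collision S \<in> spherical_flats H"
    using K unfolding spherical_flats_def by blast
  show R: "?R \<subseteq> roots H (collision S)"
  proof
    fix v assume "v \<in> ?R"
    then obtain h where h: "(v, h) \<in> K" unfolding K(4)[symmetric] by auto
    then have "\<Inter>(snd ` K) \<subseteq> h" by force
    then show "v \<in> roots H (collision S)"
      unfolding roots_iff K(3)[symmetric] using h K(1) by blast
  qed
  have "indecomposable ?R"
    by (rule indecomposable_differences[OF inj_on_subset[OF inj_axis] S]) simp
  then show "indecomposable (roots H (collision S))"
    by (rule indecomposable_between_span) (use R roots_Inter_subset_span[OF K(1)] K(3,4) in auto)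
qed

text \<open>
  Coincidence along the flat is an equivalence relation on labels. A root joins two labels of the
  same class, so the class of one root separates coordinates, and all roots belong to it.
\<close>

lemma irreducible_flat_is_collision:
  assumes \<alpha>: "\<alpha> \<in> spherical_flats H" "indecomposable (roots H \<alpha>)"
  shows "\<exists>S k l. k \<in> S \<and> l \<in> S \<and> k \<noteq> l \<and> \<alpha> = collision S"
proof -
  obtain u where u: "u \<in> roots H \<alpha>"
    using \<alpha>(2) by (auto simp: indecomposable_def)
  then obtain i j where ij: "i \<noteq> j" "u = axis i 1 - axis j 1" "\<alpha> \<subseteq> hyp i j"
    by (auto simp: roots_iff H_eq)
  have "\<forall>x\<in>\<alpha>. \<exists>w :: real ^ 'n. \<forall>i j. i \<noteq> j \<longrightarrow> (x \<in> hyp i j \<longleftrightarrow> w $ i = w $ j)"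
  proof
    fix x assume "x \<in> \<alpha>"
    then have "x \<in> X" using ij(3) hyp_subset[of i j] by blast
    then show "\<exists>w :: real ^ 'n. \<forall>i j. i \<noteq> j \<longrightarrow> (x \<in> hyp i j \<longleftrightarrow> w $ i = w $ j)"
      by (rule values_of_point)
  qed
  from bchoice[OF this] obtain w :: "'p \<Rightarrow> real ^ 'n" where
    w: "\<forall>x\<in>\<alpha>. \<forall>i j. i \<noteq> j \<longrightarrow> (x \<in> hyp i j \<longleftrightarrow> w x $ i = w x $ j)"
    by (rule exE)
  define same where "same k l \<longleftrightarrow> (\<forall>x\<in>\<alpha>. w x $ k = w x $ l)" for k l
  have same_iff: "same k l \<longleftrightarrow> \<alpha> \<subseteq> hyp k l" if "k \<noteq> l" for k l
  proof -
    have "x \<in> hyp k l \<longleftrightarrow> w x $ k = w x $ l" if "x \<in> \<alpha>" for x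
      using w that \<open>k \<noteq> l\<close> by simp
    then show ?thesis unfolding same_def by blast
  qed
  have equiv: "same k i \<longleftrightarrow> same l i" if "same k l" for k l
    using that by (simp add: same_def)
  define S where "S = {k. same k i}"
  have ijS: "i \<in> S" "j \<in> S"
    using same_iff[OF ij(1)] ij(3) by (simp_all add: S_def same_def)
  have same_S: "same k l" if "k \<in> S" "l \<in> S" for k l
    using that by (simp add: S_def same_def)
  have supp: "v $ l = 0" if v: "v \<in> roots H \<alpha>" "l \<notin> S" for v l
  proof (rule indecomposable_supported[OF \<alpha>(2) _ u ijS(1) _ v])
    show "u $ i \<noteq> 0" using ij by (simp add: axis_def)
    fix v assume "v \<in> roots H \<alpha>"
    then obtain k l where kl: "k \<noteq> l" "v = axis k 1 - axis l 1" "\<alpha> \<subseteq> hyp k l"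
      by (auto simp: roots_iff H_eq)
    then have "k \<in> S \<longleftrightarrow> l \<in> S"
      using equiv[of k l] same_iff[OF kl(1)] by (simp add: S_def)
    then show "(\<forall>k\<in>- S. v $ k = 0) \<or> (\<forall>k\<in>S. v $ k = 0)"
      using kl by (auto simp: axis_def)
  qed
  have "\<alpha> \<subseteq> collision S"
    unfolding collision_def using same_S same_iff by blast
  moreover have "roots H \<alpha> \<subseteq> roots H (collision S)"
  proof
    fix v assume v: "v \<in> roots H \<alpha>"
    then obtain k l where kl: "k \<noteq> l" "v = axis k 1 - axis l 1" "\<alpha> \<subseteq> hyp k l"
      by (auto simp: roots_iff H_eq)
    then have "v $ k \<noteq> 0" "v $ l \<noteq> 0" by (simp_all add: axis_def)
    then have "k \<in> S" "l \<in> S" using supp[OF v] by blast+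
    then show "v \<in> roots H (collision S)"
      by (intro subsetD[OF collision_flat(3)[OF ijS ij(1)]]) (use kl in blast)
  qed
  ultimately have "\<alpha> = collision S"
    using \<alpha>(1) collision_flat(1)[OF ijS ij(1)] span_superset[of "roots H (collision S)"]
    by (intro flat_eqI) (assumption | rule subset_trans)+
  then show ?thesis using ijS ij(1) by blast
qed

theorem Min_building_iff_collision:
  assumes "\<alpha> \<in> spherical_flats H"
  shows "\<alpha> \<in> Min_building (spherical_flats H) H \<longleftrightarrow> (\<exists>us\<in>brackets_A. \<alpha> = collision (set us))"
proof -
  have bracket: "\<exists>us\<in>brackets_A. S = set us" if S: "k \<in> S" "l \<in> S" "k \<noteq> l" for S and k l :: 'n
  proof -
    obtain us where us: "set us = S" "distinct us"
      using finite_distinct_list[of S] by auto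
    obtain ws where ws: "set ws = - S" "distinct ws"
      using finite_distinct_list[of "- S"] by auto
    have "card {k, l} \<le> card S" using S by (intro card_mono) auto
    then have "2 \<le> length us"
      using us S(3) distinct_card[of us] by simp
    moreover have "diagram (us @ ws)"
      using us ws by (auto simp: diagram_def)
    ultimately show ?thesis
      using us unfolding brackets_A_def by (intro bexI[of _ us]) auto
  qed
  have two: "\<exists>k l. k \<in> set us \<and> l \<in> set us \<and> k \<noteq> l" if "us \<in> brackets_A" for us :: "'n list"
  proof -
    have "distinct us" "2 \<le> length us"
      using that set_mono_sublist distinct_append by (auto simp: brackets_A_def diagram_def sublist_def)
    moreover from this obtain k l vs where "us = k # l # vs"
      by (auto simp: numeral_2_eq_2 Suc_le_length_iff)
    ultimately show ?thesis by auto
  qed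
  have "indecomposable (roots H \<alpha>) \<longleftrightarrow> (\<exists>us\<in>brackets_A. \<alpha> = collision (set us))"
  proof
    assume irr: "indecomposable (roots H \<alpha>)"
    obtain S k l where S: "k \<in> S" "l \<in> S" "k \<noteq> l" "\<alpha> = collision S"
      using irreducible_flat_is_collision[OF assms irr] by (elim exE conjE)
    then show "\<exists>us\<in>brackets_A. \<alpha> = collision (set us)"
      using bracket[OF S(1-3)] by auto
  next
    assume "\<exists>us\<in>brackets_A. \<alpha> = collision (set us)"
    then obtain us where us: "us \<in> brackets_A" "\<alpha> = collision (set us)" by (elim bexE)
    obtain k l where "k \<in> set us" "l \<in> set us" "k \<noteq> l"
      using two[OF us(1)] by (elim exE conjE)
    then show "indecomposable (roots H \<alpha>)"
      unfolding us(2) by (rule collision_flat(2))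
  qed
  then show ?thesis
    unfolding Min_building_eq_irreducible_flats using assms by simp
qed

end

section \<open>Signed particles and their root vectors\<close>

text \<open>
  With \<open>e\<^sub>p = \<plusminus> e\<^sub>i\<close> for a signed particle, the roots \<open>\<plusminus> e\<^sub>i \<plusminus> e\<^sub>j\<close> become differences \<open>e\<^sub>p - e\<^sub>q\<close>,
  as in the case without symmetry.
\<close>

fun particle_vec :: "'n particle \<Rightarrow> real ^ 'n" where
  "particle_vec (Pos i) = axis i 1"
| "particle_vec (Neg i) = - axis i 1"

text \<open>
  Line and circle are treated together; \<open>mir\<close> is the reflection \<open>uminus\<close> or \<open>cnj\<close>.
\<close>

fun position :: "('a \<Rightarrow> 'a) \<Rightarrow> 'a ^ 'n \<Rightarrow> 'n particle \<Rightarrow> 'a" where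
  "position mir x (Pos i) = x $ i"
| "position mir x (Neg i) = mir (x $ i)"

lemma label_mirror [simp]: "label (mirror p) = label p"
  by (cases p) simp_all

lemma mirror_mirror [simp]: "mirror (mirror p) = p"
  by (cases p) simp_all

lemma label_eq_iff: "label p = label q \<longleftrightarrow> p = q \<or> p = mirror q"
  by (cases p; cases q) auto

lemma particle_vec_mirror [simp]: "particle_vec (mirror p) = - particle_vec p"
  by (cases p) simp_all

lemma particle_vec_nth_eq_0 [simp]: "particle_vec p $ k = 0 \<longleftrightarrow> k \<noteq> label p"
  by (cases p) (auto simp: axis_def)

lemma particle_vec_diff_nth:
  assumes "label p \<noteq> label q"
  shows "(particle_vec p - particle_vec q) $ label p \<noteq> 0" "(particle_vec p - particle_vec q) $ label q \<noteq> 0"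
proof -
  have "particle_vec q $ label p = 0" "particle_vec p $ label q = 0"
    using assms by auto
  then have "(particle_vec p - particle_vec q) $ label p = particle_vec p $ label p"
    "(particle_vec p - particle_vec q) $ label q = - particle_vec q $ label q"
    unfolding vector_minus_component by linarith+
  then show "(particle_vec p - particle_vec q) $ label p \<noteq> 0" "(particle_vec p - particle_vec q) $ label q \<noteq> 0"
    by (simp_all only:) simp_all
qed

lemma inj_particle_vec: "inj particle_vec"
proof (rule injI)
  fix p q :: "'n::finite particle" assume eq: "particle_vec p = particle_vec q"
  have "particle_vec q $ label p \<noteq> 0"
    unfolding eq[symmetric] by simp
  then have "p = q \<or> p = mirror q"
    by (simp add: label_eq_iff[symmetric])
  moreover have "p \<noteq> mirror q"
  proof
    assume "p = mirror q"
    then have "- (particle_vec q $ label q) = particle_vec q $ label q"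
      using arg_cong[OF eq, of "\<lambda>v. v $ label q"] by simp
    then have "particle_vec q $ label q = 0" by linarith
    then show False by simp
  qed
  ultimately show "p = q" by blast
qed

definition differences :: "'n particle set \<Rightarrow> (real ^ 'n) set" where
  "differences S = {particle_vec p - particle_vec q | p q. p \<in> S \<and> q \<in> S \<and> p \<noteq> q}"

text \<open>
  The root systems of type \<open>D\<close> and, if \<open>b\<close> holds, of type \<open>B\<close> on the labels \<open>L\<close>.
\<close>

definition axial_roots :: "bool \<Rightarrow> 'n set \<Rightarrow> (real ^ 'n) set" where
  "axial_roots b L =
     {particle_vec p - particle_vec q | p q. label p \<in> L \<and> label q \<in> L \<and> label p \<noteq> label q} \<union>
     {axis i 1 | i. b \<and> i \<in> L}"

lemma particle_vec_pair_in_axial_roots: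
  "label p \<in> L \<Longrightarrow> label q \<in> L \<Longrightarrow> label p \<noteq> label q \<Longrightarrow> particle_vec p - particle_vec q \<in> axial_roots b L"
  unfolding axial_roots_def by blast

lemma axial_roots_subset_subspace:
  assumes U: "subspace U" and e: "\<And>i. i \<in> L \<Longrightarrow> axis i 1 \<in> U"
  shows "axial_roots b L \<subseteq> U"
proof -
  have "particle_vec p \<in> U" if "label p \<in> L" for p
    using e[of "label p"] that subspace_neg[OF U, of "axis (label p) 1"] by (cases p) simp_all
  then have "particle_vec p - particle_vec q \<in> U" if "label p \<in> L" "label q \<in> L" for p q
    using that subspace_diff[OF U] by blast
  then show ?thesis
    unfolding axial_roots_def using e by auto
qed

text \<open>
  In type \<open>B\<close> the root \<open>e\<^sub>i\<close> is linked to every \<open>- e\<^sub>j\<close> through \<open>e\<^sub>i - e\<^sub>j\<close>. In type \<open>D\<close> a third label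
  \<open>s\<close> links \<open>e\<^sub>i - e\<^sub>j\<close> with both \<open>e\<^sub>j - e\<^sub>s\<close> and \<open>e\<^sub>j + e\<^sub>s\<close>, whose span contains \<open>e\<^sub>j\<close> and \<open>e\<^sub>s\<close>;
  with two labels only, \<open>e\<^sub>i - e\<^sub>j\<close> and \<open>e\<^sub>i + e\<^sub>j\<close> would be independent.
\<close>

lemma indecomposable_axial_roots:
  fixes L :: "'n::finite set"
  assumes "b \<and> L \<noteq> {} \<or> 3 \<le> card L"
  shows "indecomposable (axial_roots b L)"
proof (cases "b \<and> L \<noteq> {}")
  case True
  then obtain i where i: "i \<in> L" and b by blast
  have r: "axis i 1 \<in> axial_roots b L"
    using i \<open>b\<close> by (auto simp: axial_roots_def)
  show ?thesis
  proof (rule indecomposableI[OF _ _ r])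
    show "axial_roots b L \<noteq> {}" using r by blast
    fix U W :: "(real ^ 'n) set"
    assume UW: "subspace U" "subspace W" "U \<inter> W \<subseteq> {0}" and R: "axial_roots b L \<subseteq> U \<union> W"
      and rU: "axis i 1 \<in> U"
    have "axis j 1 \<in> U" if j: "j \<in> L" "j \<noteq> i" for j
    proof -
      have "axis j 1 \<in> U \<union> W"
        using R j \<open>b\<close> by (auto simp: axial_roots_def)
      then have "- axis j 1 \<in> U \<union> W"
        using subspace_neg UW by blast
      moreover have "axis i 1 + - axis j 1 \<in> U \<union> W"
        using subsetD[OF R particle_vec_pair_in_axial_roots[of "Pos i" L "Pos j" b]] i j by simp
      ultimately have "- axis j 1 \<in> U"
        by (intro summand_in_same_part[OF UW rU]) (simp_all add: axis_eq_0_iff)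
      then show ?thesis using subspace_neg[OF UW(1)] by fastforce
    qed
    then show "axial_roots b L \<subseteq> U"
      using rU by (intro axial_roots_subset_subspace[OF UW(1)]) metis
  qed
next
  case False
  then have "3 \<le> card L" using assms by blast
  then obtain T where "T \<subseteq> L" "card T = 3"
    using obtain_subset_with_card_n by metis
  then obtain i j k where ijk: "i \<in> L" "j \<in> L" "k \<in> L" "i \<noteq> j" "j \<noteq> k" "i \<noteq> k"
    unfolding card_3_iff by blast
  have r: "axis i 1 - axis j 1 \<in> axial_roots b L"
    using particle_vec_pair_in_axial_roots[of "Pos i" L "Pos j" b] ijk by simp
  show ?thesis
  proof (rule indecomposableI[OF _ _ r])
    show "axial_roots b L \<noteq> {}" using r by blast
    fix U W :: "(real ^ 'n) set"
    assume UW: "subspace U" "subspace W" "U \<inter> W \<subseteq> {0}" and R: "axial_roots b L \<subseteq> U \<union> W"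
      and rU: "axis i 1 - axis j 1 \<in> U"
    have ne: "axis i 1 - axis j 1 \<noteq> (0 :: real ^ 'n)"
      using ijk by (simp add: axis_eq_axis)
    have both: "axis j 1 \<in> U \<and> axis s 1 \<in> U" if s: "s \<in> L" "s \<noteq> i" "s \<noteq> j" for s
    proof -
      have "particle_vec (Pos j) - particle_vec p \<in> U" if p: "label p = s" for p
      proof (rule summand_in_same_part[OF UW rU ne])
        show "particle_vec (Pos j) - particle_vec p \<in> U \<union> W"
          using s p ijk by (intro subsetD[OF R] particle_vec_pair_in_axial_roots) auto
        have "particle_vec (Pos i) - particle_vec p \<in> U \<union> W"
          using s p ijk by (intro subsetD[OF R] particle_vec_pair_in_axial_roots) auto
        then show "axis i 1 - axis j 1 + (particle_vec (Pos j) - particle_vec p) \<in> U \<union> W"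
          by simp
      qed
      from this[of "Pos s"] this[of "Neg s"]
      have d: "axis j 1 - axis s 1 \<in> U" and a: "axis j 1 + axis s 1 \<in> U" by simp_all
      have "(1/2) *\<^sub>R ((axis j 1 + axis s 1) + (axis j 1 - axis s 1)) \<in> U"
        by (rule subspace_scale[OF UW(1) subspace_add[OF UW(1) a d]])
      moreover have "(1/2) *\<^sub>R ((axis j 1 + axis s 1) - (axis j 1 - axis s 1)) \<in> U"
        by (rule subspace_scale[OF UW(1) subspace_diff[OF UW(1) a d]])
      moreover have "(1/2) *\<^sub>R ((x + y) + (x - y)) = x" "(1/2) *\<^sub>R ((x + y) - (x - y)) = y"
        for x y :: "real ^ 'n"
        by (simp_all add: vec_eq_iff)
      ultimately show ?thesis by (simp only: simp_thms)
    qed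
    have "axis j 1 \<in> U" using both[of k] ijk by simp
    moreover then have "(axis i 1 - axis j 1) + axis j 1 \<in> U"
      using rU by (intro subspace_add UW(1))
    ultimately show "axial_roots b L \<subseteq> U"
      using both by (intro axial_roots_subset_subspace[OF UW(1)]) (metis diff_add_cancel)
  qed
qed

section \<open>Symmetric arrangements\<close>

definition symmetric_arrangement ::
  "('a ^ 'n::finite) set \<Rightarrow> ('a \<Rightarrow> 'a) \<Rightarrow> 'a set \<Rightarrow> ('n, 'a ^ 'n) arrangement" where
  "symmetric_arrangement X mir P =
     {(axis i 1 - axis j 1, {x \<in> X. x $ i = x $ j}) | i j. i \<noteq> j} \<union>
     {(axis i 1 + axis j 1, {x \<in> X. x $ i = mir (x $ j)}) | i j. i \<noteq> j} \<union>
     {(axis i 1, {x \<in> X. x $ i = a}) | i a. a \<in> P}"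

text \<open>
  \<open>A\<close> is the set of axis points and \<open>P\<close> the set of positions of fixed particles.
\<close>

locale mirror_positions =
  fixes X :: "('a ^ 'n::finite) set" and mir :: "'a \<Rightarrow> 'a" and A P :: "'a set"
  assumes mir_mir [simp]: "mir (mir a) = a"
    and mir_axis: "a \<in> A \<Longrightarrow> mir a = a"
    and P_subset: "P \<subseteq> A"
    and finite_P: "finite P"
begin

abbreviation "pos \<equiv> position mir"
abbreviation "H \<equiv> symmetric_arrangement X mir P"

definition meet :: "'n particle \<Rightarrow> 'n particle \<Rightarrow> ('a ^ 'n) set" where
  "meet p q = {x \<in> X. pos x p = pos x q}"

lemma pos_mirror: "pos x (mirror p) = mir (pos x p)"
  by (cases p) simp_all

lemma pos_eq_axis_iff: "a \<in> A \<Longrightarrow> pos x p = a \<longleftrightarrow> x $ label p = a"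
proof (cases p)
  case (Neg i)
  assume "a \<in> A"
  then have "mir (x $ i) = a \<longleftrightarrow> x $ i = a"
    using mir_mir[of "x $ i"] mir_axis[of a] by auto
  then show ?thesis using Neg by simp
qed simp

lemma hyperplane_cases:
  assumes "(v, h) \<in> H"
  obtains (pair) p q where "label p \<noteq> label q" "v = particle_vec p - particle_vec q" "h = meet p q"
  | (axial) i a where "a \<in> P" "v = axis i 1" "h = {x \<in> X. x $ i = a}"
proof -
  consider "\<exists>i j. (v = axis i 1 - axis j 1 \<and> h = {x \<in> X. x $ i = x $ j}) \<and> i \<noteq> j"
    | "\<exists>i j. (v = axis i 1 + axis j 1 \<and> h = {x \<in> X. x $ i = mir (x $ j)}) \<and> i \<noteq> j"
    | "\<exists>i a. (v = axis i 1 \<and> h = {x \<in> X. x $ i = a}) \<and> a \<in> P"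
    using assms unfolding symmetric_arrangement_def Un_iff mem_Collect_eq prod.inject
    by (elim disjE) (erule that)+
  then show ?thesis
  proof cases
    case 1
    then obtain i j where "i \<noteq> j" "v = axis i 1 - axis j 1" "h = {x \<in> X. x $ i = x $ j}"
      by (elim exE conjE)
    then show ?thesis using pair[of "Pos i" "Pos j"] by (simp add: meet_def)
  next
    case 2
    then obtain i j where "i \<noteq> j" "v = axis i 1 + axis j 1" "h = {x \<in> X. x $ i = mir (x $ j)}"
      by (elim exE conjE)
    then show ?thesis using pair[of "Pos i" "Neg j"] by (simp add: meet_def)
  next
    case 3
    then show ?thesis using axial by (elim exE conjE)
  qed
qed

text \<open>
  Passing to the mirror images of both particles negates the difference of their vectors and leaves
  their meeting locus unchanged.
\<close>

lemma pair_hyperplane: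
  assumes "label p \<noteq> label q"
  shows "\<exists>v. (v, meet p q) \<in> H \<and> (v = particle_vec p - particle_vec q \<or> v = - (particle_vec p - particle_vec q))"
proof -
  have minus: "(axis i 1 - axis j 1, {x \<in> X. x $ i = x $ j}) \<in> H"
    and plus: "(axis i 1 + axis j 1, {x \<in> X. x $ i = mir (x $ j)}) \<in> H" if "i \<noteq> j" for i j
    using that unfolding symmetric_arrangement_def by blast+
  have swap: "mir a = b \<longleftrightarrow> a = mir b" "mir a = mir b \<longleftrightarrow> a = b" for a b
    using mir_mir by metis+
  obtain i j where pq: "p = Pos i \<or> p = Neg i" "q = Pos j \<or> q = Neg j" "i \<noteq> j"
    using assms by (cases p; cases q) auto
  from pq(1,2) show ?thesis
  proof (elim disjE)
    assume "p = Pos i" "q = Pos j"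
    then show ?thesis using minus[OF pq(3)] by (intro exI[of _ "axis i 1 - axis j 1"]) (simp add: meet_def)
  next
    assume "p = Pos i" "q = Neg j"
    then show ?thesis using plus[OF pq(3)] by (intro exI[of _ "axis i 1 + axis j 1"]) (simp add: meet_def)
  next
    assume "p = Neg i" "q = Pos j"
    then show ?thesis using plus[OF pq(3)]
      by (intro exI[of _ "axis i 1 + axis j 1"]) (simp add: meet_def swap)
  next
    assume "p = Neg i" "q = Neg j"
    then show ?thesis using minus[OF pq(3)]
      by (intro exI[of _ "axis i 1 - axis j 1"]) (simp add: meet_def swap)
  qed
qed

lemma axial_hyperplane: "a \<in> P \<Longrightarrow> (axis i 1, {x \<in> X. x $ i = a}) \<in> H"
  unfolding symmetric_arrangement_def by blast

lemma hyperplane_subset: "(v, h) \<in> H \<Longrightarrow> h \<subseteq> X"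
  by (erule hyperplane_cases) (auto simp: meet_def)

lemma normal_nonzero: "(v, h) \<in> H \<Longrightarrow> v \<noteq> 0"
proof (erule hyperplane_cases)
  fix p q :: "'n particle" assume "label p \<noteq> label q" "v = particle_vec p - particle_vec q"
  then have "v $ label p \<noteq> 0" using particle_vec_diff_nth(1) by blast
  then show "v \<noteq> 0" by auto
qed (simp add: axis_eq_0_iff)

lemma finite_arrangement: "finite H"
proof -
  have "H \<subseteq> (\<lambda>(i, j). (axis i 1 - axis j 1, {x \<in> X. x $ i = x $ j})) ` UNIV \<union>
      (\<lambda>(i, j). (axis i 1 + axis j 1, {x \<in> X. x $ i = mir (x $ j)})) ` UNIV \<union>
      (\<lambda>(i, a). (axis i 1, {x \<in> X. x $ i = a})) ` (UNIV \<times> P)"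
    unfolding symmetric_arrangement_def by auto
  then show ?thesis
    by (rule finite_subset) (simp add: finite_P)
qed

definition off_axis_flat :: "'n particle set \<Rightarrow> ('a ^ 'n) set" where
  "off_axis_flat S = {x \<in> X. \<forall>p\<in>S. \<forall>q\<in>S. pos x p = pos x q}"

definition axial_flat :: "'n set \<Rightarrow> 'a \<Rightarrow> ('a ^ 'n) set" where
  "axial_flat L a = {x \<in> X. \<forall>i\<in>L. x $ i = a}"

lemma pos_axial_flat:
  assumes "a \<in> A" "x \<in> axial_flat L a" "label p \<in> L"
  shows "pos x p = a"
  unfolding pos_eq_axis_iff[OF assms(1)] using assms by (simp add: axial_flat_def)

text \<open>
  The arrangement lists only one of the two opposite normal vectors \<open>\<plusminus> (e\<^sub>i + e\<^sub>j)\<close>, so a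
  collision of two signed particles determines its normal vector up to sign only.
\<close>

definition off_axis_hyps :: "'n particle set \<Rightarrow> ('n, 'a ^ 'n) arrangement" where
  "off_axis_hyps S = {(v, meet p q) | v p q. (v, meet p q) \<in> H \<and> p \<in> S \<and> q \<in> S \<and> p \<noteq> q \<and>
     (v = particle_vec p - particle_vec q \<or> v = - (particle_vec p - particle_vec q))}"

definition axial_hyps :: "'n set \<Rightarrow> 'a \<Rightarrow> ('n, 'a ^ 'n) arrangement" where
  "axial_hyps L a = {(v, meet p q) | v p q. (v, meet p q) \<in> H \<and> label p \<in> L \<and> label q \<in> L \<and> label p \<noteq> label q \<and>
     (v = particle_vec p - particle_vec q \<or> v = - (particle_vec p - particle_vec q))} \<union>
     {(axis i 1, {x \<in> X. x $ i = a}) | i. a \<in> P \<and> i \<in> L}"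

lemma off_axis_hyps_subset: "off_axis_hyps S \<subseteq> H"
  unfolding off_axis_hyps_def by blast

lemma axial_hyps_subset: "axial_hyps L a \<subseteq> H"
  unfolding axial_hyps_def using axial_hyperplane by blast

lemma off_axis_hyps_pair:
  assumes "p \<in> S" "q \<in> S" "p \<noteq> q" "inj_on label S"
  shows "\<exists>v. (v, meet p q) \<in> off_axis_hyps S \<and> (v = particle_vec p - particle_vec q \<or> v = - (particle_vec p - particle_vec q))"
proof -
  have "label p \<noteq> label q" using assms by (auto dest: inj_onD)
  then show ?thesis
    using pair_hyperplane assms unfolding off_axis_hyps_def by blast
qed

lemma axial_hyps_pair:
  assumes "label p \<in> L" "label q \<in> L" "label p \<noteq> label q"
  shows "\<exists>v. (v, meet p q) \<in> axial_hyps L a \<and> (v = particle_vec p - particle_vec q \<or> v = - (particle_vec p - particle_vec q))"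
  using pair_hyperplane[OF assms(3)] assms unfolding axial_hyps_def by blast

lemma fst_off_axis_hyps: "fst ` off_axis_hyps S \<subseteq> span (differences S)"
proof -
  have base: "particle_vec p - particle_vec q \<in> span (differences S)" if "p \<in> S" "q \<in> S" "p \<noteq> q" for p q
    by (rule span_base) (use that in \<open>unfold differences_def, blast\<close>)
  have "v \<in> span (differences S)"
    if "p \<in> S" "q \<in> S" "p \<noteq> q" "v = particle_vec p - particle_vec q \<or> v = - (particle_vec p - particle_vec q)" for v p q
    using that(4) base[OF that(1-3)] span_neg by blast
  then show ?thesis
    unfolding off_axis_hyps_def by fastforce
qed

lemma fst_axial_hyps: "fst ` axial_hyps L a \<subseteq> span (axial_roots (a \<in> P) L)"
proof -
  have "particle_vec p - particle_vec q \<in> span (axial_roots (a \<in> P) L)"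
    if "label p \<in> L" "label q \<in> L" "label p \<noteq> label q" for p q
    using particle_vec_pair_in_axial_roots[OF that] by (rule span_base)
  then have *: "v \<in> span (axial_roots (a \<in> P) L)"
    if "label p \<in> L" "label q \<in> L" "label p \<noteq> label q"
      "v = particle_vec p - particle_vec q \<or> v = - (particle_vec p - particle_vec q)" for v p q
    using that span_neg by blast
  have **: "axis i 1 \<in> span (axial_roots (a \<in> P) L)" if "a \<in> P" "i \<in> L" for i
    using that by (intro span_base) (auto simp: axial_roots_def)
  show ?thesis
    unfolding axial_hyps_def using * ** by auto
qed

lemma Inter_off_axis_hyps:
  assumes "inj_on label S" "p0 \<in> S" "q0 \<in> S" "p0 \<noteq> q0"
  shows "\<Inter>(snd ` off_axis_hyps S) = off_axis_flat S" "off_axis_hyps S \<noteq> {}"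
proof -
  show "off_axis_hyps S \<noteq> {}"
    using off_axis_hyps_pair[OF assms(2-4,1)] by blast
  show "\<Inter>(snd ` off_axis_hyps S) = off_axis_flat S"
  proof
    show "off_axis_flat S \<subseteq> \<Inter>(snd ` off_axis_hyps S)"
    proof (intro INT_greatest)
      fix vh assume "vh \<in> off_axis_hyps S"
      then obtain p q where "snd vh = meet p q" "p \<in> S" "q \<in> S"
        unfolding off_axis_hyps_def by force
      then show "off_axis_flat S \<subseteq> snd vh"
        unfolding off_axis_flat_def meet_def by blast
    qed
    show "\<Inter>(snd ` off_axis_hyps S) \<subseteq> off_axis_flat S"
    proof
      fix x assume x: "x \<in> \<Inter>(snd ` off_axis_hyps S)"
      have m: "x \<in> meet p q" if pq: "p \<in> S" "q \<in> S" "p \<noteq> q" for p q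
      proof -
        obtain v where "(v, meet p q) \<in> off_axis_hyps S"
          using off_axis_hyps_pair[OF pq assms(1)] by blast
        then show ?thesis using x by force
      qed
      have "pos x p = pos x q" if "p \<in> S" "q \<in> S" for p q
        using m[OF that] unfolding meet_def by (cases "p = q") simp_all
      moreover have "x \<in> X"
        using m[OF assms(2-4)] by (simp add: meet_def)
      ultimately show "x \<in> off_axis_flat S"
        unfolding off_axis_flat_def by blast
    qed
  qed
qed

lemma axial_hyps_nonempty:
  assumes "a \<in> P \<and> L \<noteq> {} \<or> 2 \<le> card L"
  shows "axial_hyps L a \<noteq> {}"
proof (cases "a \<in> P \<and> L \<noteq> {}")
  case True
  then show ?thesis unfolding axial_hyps_def by blast
next
  case False
  then have "2 \<le> card L" using assms by blast
  then obtain T where "T \<subseteq> L" "card T = 2"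
    using obtain_subset_with_card_n by metis
  then obtain i j where "i \<in> L" "j \<in> L" "i \<noteq> j"
    unfolding card_2_iff by blast
  then show ?thesis
    using axial_hyps_pair[of "Pos i" L "Pos j" a] by auto
qed

lemma axial_flat_subset_Inter:
  assumes "a \<in> A"
  shows "axial_flat L a \<subseteq> \<Inter>(snd ` axial_hyps L a)"
proof (intro INT_greatest)
  fix vh assume "vh \<in> axial_hyps L a"
  then consider p q where "snd vh = meet p q" "label p \<in> L" "label q \<in> L"
    | i where "snd vh = {x \<in> X. x $ i = a}" "i \<in> L"
    unfolding axial_hyps_def by force
  then show "axial_flat L a \<subseteq> snd vh"
  proof cases
    case 1
    have "pos x p = pos x q" if "x \<in> axial_flat L a" for x
    proof -
      have "pos x p = a" "pos x q = a"
        using that 1 pos_axial_flat[OF assms] by blast+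
      then show ?thesis by simp
    qed
    then show ?thesis
      unfolding 1 by (auto simp: meet_def axial_flat_def)
  qed (auto simp: axial_flat_def)
qed

lemma differences_up_to_sign:
  assumes "inj_on label S"
  shows "differences S \<subseteq> roots H (off_axis_flat S) \<union> uminus ` roots H (off_axis_flat S)"
proof
  fix d assume "d \<in> differences S"
  then obtain p q where pq: "p \<in> S" "q \<in> S" "p \<noteq> q" "d = particle_vec p - particle_vec q"
    unfolding differences_def by blast
  then obtain v where v: "(v, meet p q) \<in> H" "v = d \<or> v = - d"
    using off_axis_hyps_pair[OF pq(1-3) assms] off_axis_hyps_subset by blast
  have "off_axis_flat S \<subseteq> meet p q"
    using pq unfolding off_axis_flat_def meet_def by blast
  then have "v \<in> roots H (off_axis_flat S)"
    unfolding roots_iff using v(1) by blast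
  moreover have "d = v \<or> d = - v" using v(2) by auto
  ultimately show "d \<in> roots H (off_axis_flat S) \<union> uminus ` roots H (off_axis_flat S)" by blast
qed

lemma axial_roots_up_to_sign:
  assumes "a \<in> A"
  shows "axial_roots (a \<in> P) L \<subseteq> roots H (axial_flat L a) \<union> uminus ` roots H (axial_flat L a)"
proof
  fix d assume "d \<in> axial_roots (a \<in> P) L"
  then consider p q where "label p \<in> L" "label q \<in> L" "label p \<noteq> label q" "d = particle_vec p - particle_vec q"
    | i where "a \<in> P" "i \<in> L" "d = axis i 1"
    unfolding axial_roots_def by blast
  then show "d \<in> roots H (axial_flat L a) \<union> uminus ` roots H (axial_flat L a)"
  proof cases
    case 1
    then obtain v where v: "(v, meet p q) \<in> H" "v = d \<or> v = - d"
      using axial_hyps_pair[OF 1(1-3)] axial_hyps_subset by blast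
    have "axial_flat L a \<subseteq> meet p q"
    proof
      fix x assume x: "x \<in> axial_flat L a"
      then have "pos x p = a" "pos x q = a"
        using 1 pos_axial_flat[OF assms] by blast+
      then show "x \<in> meet p q"
        using x by (simp add: meet_def axial_flat_def)
    qed
    then have "v \<in> roots H (axial_flat L a)"
      unfolding roots_iff using v(1) by blast
    moreover have "d = v \<or> d = - v" using v(2) by auto
    ultimately show ?thesis by blast
  next
    case 2
    have "axial_flat L a \<subseteq> {x \<in> X. x $ i = a}"
      using 2 by (auto simp: axial_flat_def)
    then have "d \<in> roots H (axial_flat L a)"
      unfolding roots_iff using axial_hyperplane[OF 2(1)] 2(3) by blast
    then show ?thesis by blast
  qed
qed

end

section \<open>Irreducible flats of symmetric arrangements\<close>

text \<open>
  What distinguishes line and circle is confined to the assumptions. A particle that coincides with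
  its inverse along a flat must stay at one axis point; on the circle this holds because flats are
  connected. The last two assumptions say that candidate supports are flats with roots in
  the expected span.
\<close>

locale symmetric_complex = mirror_positions X mir A P
  for X :: "('a ^ 'n::finite) set" and mir :: "'a \<Rightarrow> 'a" and A P :: "'a set" +
  fixes F :: "('a ^ 'n) set set"
  assumes geometry: "flat_geometry F (symmetric_arrangement X mir P)"
    and constant_on_flat: "\<lbrakk>\<alpha> \<in> F; \<And>x. x \<in> \<alpha> \<Longrightarrow> mir (x $ i) = x $ i\<rbrakk> \<Longrightarrow> \<exists>a\<in>A. \<forall>x\<in>\<alpha>. x $ i = a"
    and constant_unique: "\<lbrakk>\<alpha> \<in> F; a \<in> A; b \<in> A; \<forall>x\<in>\<alpha>. x $ i = a; \<forall>x\<in>\<alpha>. x $ i = b\<rbrakk> \<Longrightarrow> a = b"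
    and off_axis_flat_in: "\<lbrakk>inj_on label S; p \<in> S; q \<in> S; p \<noteq> q\<rbrakk> \<Longrightarrow>
      off_axis_flat S \<in> F \<and> roots (symmetric_arrangement X mir P) (off_axis_flat S) \<subseteq> span (differences S)"
    and axial_flat_in: "\<lbrakk>a \<in> A; a \<in> P \<and> L \<noteq> {} \<or> 2 \<le> card L\<rbrakk> \<Longrightarrow>
      axial_flat L a \<in> F \<and> roots (symmetric_arrangement X mir P) (axial_flat L a) \<subseteq> span (axial_roots (a \<in> P) L)"
begin

sublocale flat_geometry F H by (rule geometry)

lemma indecomposable_off_axis_flat:
  assumes S: "inj_on label S" "p \<in> S" "q \<in> S" "p \<noteq> q"
  shows "indecomposable (roots H (off_axis_flat S))"
proof (rule indecomposable_between_span)
  show "indecomposable (differences S)"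
    unfolding differences_def by (rule indecomposable_differences[OF inj_on_subset[OF inj_particle_vec] S(2-4)]) simp
qed (use differences_up_to_sign[OF S(1)] off_axis_flat_in[OF S] in blast)+

lemma indecomposable_axial_flat:
  assumes a: "a \<in> A" "a \<in> P \<and> L \<noteq> {} \<or> 3 \<le> card L"
  shows "indecomposable (roots H (axial_flat L a))"
proof (rule indecomposable_between_span[OF indecomposable_axial_roots[OF a(2)] axial_roots_up_to_sign[OF a(1)]])
  have "a \<in> P \<and> L \<noteq> {} \<or> 2 \<le> card L" using a(2) by auto
  then show "roots H (axial_flat L a) \<subseteq> span (axial_roots (a \<in> P) L)"
    using axial_flat_in[OF a(1)] by blast
qed

context
  fixes \<alpha>
  assumes flat: "\<alpha> \<in> F" and irreducible: "indecomposable (roots H \<alpha>)"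
begin

definition same :: "'n particle \<Rightarrow> 'n particle \<Rightarrow> bool" where
  "same p q \<longleftrightarrow> (\<forall>x\<in>\<alpha>. pos x p = pos x q)"

lemma same_refl: "same p p"
  and same_sym: "same p q \<Longrightarrow> same q p"
  and same_trans: "same p q \<Longrightarrow> same q r \<Longrightarrow> same p r"
  and same_mirror: "same p q \<Longrightarrow> same (mirror p) (mirror q)"
  unfolding same_def pos_mirror by simp_all

lemma flat_subset: "\<alpha> \<subseteq> X"
proof -
  obtain v where "v \<in> roots H \<alpha>"
    using irreducible unfolding indecomposable_def by blast
  then show ?thesis
    using hyperplane_subset unfolding roots_iff by blast
qed

lemma same_iff_subset_meet: "same p q \<longleftrightarrow> \<alpha> \<subseteq> meet p q"
  unfolding same_def meet_def using flat_subset by blast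

text \<open>
  A set of labels that is closed under collisions along the flat separates the coordinates of all
  its roots.
\<close>

lemma roots_supported:
  assumes closed: "\<And>p q. label p \<noteq> label q \<Longrightarrow> same p q \<Longrightarrow> label p \<in> L \<Longrightarrow> label q \<in> L"
    and u: "u \<in> roots H \<alpha>" "k \<in> L" "u $ k \<noteq> 0"
    and v: "v \<in> roots H \<alpha>" "l \<notin> L"
  shows "v $ l = 0"
proof (rule indecomposable_supported[OF irreducible _ u v])
  fix v assume "v \<in> roots H \<alpha>"
  then obtain h where h: "(v, h) \<in> H" "\<alpha> \<subseteq> h" unfolding roots_iff by blast
  from h(1) show "(\<forall>k\<in>- L. v $ k = 0) \<or> (\<forall>k\<in>L. v $ k = 0)"
  proof (cases rule: hyperplane_cases)
    case (pair p q)
    then have "same p q" using h(2) same_iff_subset_meet by simp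
    then have iff: "label p \<in> L \<longleftrightarrow> label q \<in> L"
      using closed[of p q] closed[of q p] pair(1) same_sym by metis
    have zero: "v $ k = 0" if "k \<noteq> label p" "k \<noteq> label q" for k
    proof -
      have "particle_vec p $ k = 0" "particle_vec q $ k = 0"
        using that by simp_all
      then show ?thesis unfolding pair(2) vector_minus_component by (simp only: diff_0_right)
    qed
    show ?thesis
    proof (cases "label p \<in> L")
      case True
      have "v $ k = 0" if "k \<in> - L" for k
        by (rule zero) (use that True iff in auto)
      then show ?thesis by blast
    next
      case False
      have "v $ k = 0" if "k \<in> L" for k
        by (rule zero) (use that False iff in auto)
      then show ?thesis by blast
    qed
  next
    case (axial i a)
    have "v $ k = 0" if "k \<noteq> i" for k
      using that unfolding axial(2) by (simp add: axis_def)
    then show ?thesis by (metis ComplD)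
  qed
qed

text \<open>
  The particles that coincide with \<open>p\<close> along the flat contain no mirror pair, since otherwise \<open>p\<close>
  would coincide with its own mirror image. Their labels confine the roots, which are therefore the
  differences within this class.
\<close>

lemma irreducible_off_axis:
  assumes pq: "label p \<noteq> label q" "same p q" "\<not> same p (mirror p)"
    and u: "u \<in> roots H \<alpha>" "u $ label p \<noteq> 0"
  shows "\<exists>S. inj_on label S \<and> p \<in> S \<and> q \<in> S \<and> p \<noteq> q \<and> \<alpha> = off_axis_flat S"
proof -
  define S where "S = {r. same p r}"
  have S: "p \<in> S" "q \<in> S" "p \<noteq> q"
    using pq by (auto simp: S_def same_refl)
  have no_mirror: "mirror r \<notin> S" if "r \<in> S" for r
  proof
    assume "mirror r \<in> S"
    then have "same p (mirror r)" "same p r" using that by (simp_all add: S_def)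
    moreover then have "same (mirror r) (mirror p)"
      using same_mirror[of r p] same_sym[of p r] by blast
    ultimately show False using pq(3) same_trans by blast
  qed
  have inj: "inj_on label S"
  proof (rule inj_onI)
    fix r s assume "r \<in> S" "s \<in> S" "label r = label s"
    then show "r = s" using no_mirror[of s] by (auto simp: label_eq_iff)
  qed
  have in_S: "s \<in> S" if "r \<in> S" "same r s" for r s
    using that same_trans unfolding S_def by blast
  have closed: "label s \<in> label ` S" if rs: "same r s" "label r \<in> label ` S" for r s
  proof -
    obtain r' where r': "r' \<in> S" "r = r' \<or> r = mirror r'"
      using rs(2) by (auto simp: label_eq_iff)
    then consider "r \<in> S" | "mirror r \<in> S" by auto
    then show ?thesis
    proof cases
      case 1
      then show ?thesis using in_S rs(1) by blast
    next
      case 2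
      then have "mirror s \<in> S" using in_S[OF 2] same_mirror[OF rs(1)] by blast
      then have "label (mirror s) \<in> label ` S" by (rule imageI)
      then show ?thesis by simp
    qed
  qed
  have supp: "k \<in> label ` S" if vk: "v \<in> roots H \<alpha>" "v $ k \<noteq> 0" for v k
  proof (rule ccontr)
    assume k: "k \<notin> label ` S"
    have "v $ k = 0"
    proof (rule roots_supported[OF _ u(1) _ u(2) vk(1) k])
      show "label s \<in> label ` S" if "same r s" "label r \<in> label ` S" for r s
        using that by (rule closed)
      show "label p \<in> label ` S" using S(1) by (rule imageI)
    qed
    then show False using vk(2) by simp
  qed
  have "\<alpha> \<subseteq> off_axis_flat S"
  proof
    fix x assume x: "x \<in> \<alpha>"
    have "pos x r = pos x p" if "r \<in> S" for r
      using that x unfolding S_def same_def by simp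
    then show "x \<in> off_axis_flat S"
      unfolding off_axis_flat_def using x flat_subset by auto
  qed
  moreover have "roots H \<alpha> \<subseteq> roots H (off_axis_flat S)"
  proof
    fix v assume v: "v \<in> roots H \<alpha>"
    then obtain h where h: "(v, h) \<in> H" "\<alpha> \<subseteq> h" unfolding roots_iff by blast
    from h(1) have "off_axis_flat S \<subseteq> h"
    proof (cases rule: hyperplane_cases)
      case (pair r s)
      have rs: "same r s" using h(2) pair(3) same_iff_subset_meet by simp
      have "label r \<in> label ` S"
        using supp[OF v] particle_vec_diff_nth(1)[OF pair(1)] unfolding pair(2) by blast
      then obtain r' where r': "r' \<in> S" "r = r' \<or> r = mirror r'"
        by (auto simp: label_eq_iff)
      then consider "r \<in> S" | "mirror r \<in> S" by auto
      then show ?thesis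
      proof cases
        case 1
        then have "s \<in> S" using in_S rs by blast
        then show ?thesis
          unfolding pair(3) meet_def off_axis_flat_def using 1 by blast
      next
        case 2
        then have s: "mirror s \<in> S" using in_S same_mirror[OF rs] by blast
        show ?thesis
        proof
          fix x assume x: "x \<in> off_axis_flat S"
          then have "pos x (mirror r) = pos x (mirror s)" "x \<in> X"
            unfolding off_axis_flat_def using 2 s by blast+
          then have "mir (mir (pos x r)) = mir (mir (pos x s))"
            unfolding pos_mirror by simp
          then show "x \<in> h"
            using \<open>x \<in> X\<close> by (simp add: pair(3) meet_def)
        qed
      qed
    next
      case (axial i a)
      have "i \<in> label ` S"
        by (rule supp[OF v]) (simp add: axial(2) axis_def)
      then obtain r where r: "r \<in> S" "label r = i" by blast
      have "a \<in> A" using axial(1) P_subset by blast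
      have "same r (mirror r)"
        unfolding same_def
      proof
        fix x assume "x \<in> \<alpha>"
        then have "x $ i = a" using h(2) axial(3) by blast
        then have "pos x r = a" "pos x (mirror r) = a"
          unfolding pos_eq_axis_iff[OF \<open>a \<in> A\<close>] using r(2) by simp_all
        then show "pos x r = pos x (mirror r)" by simp
      qed
      then show ?thesis using in_S[OF r(1)] no_mirror[OF r(1)] by blast
    qed
    then show "v \<in> roots H (off_axis_flat S)"
      unfolding roots_iff using h(1) by blast
  qed
  ultimately have "\<alpha> = off_axis_flat S"
    using flat off_axis_flat_in[OF inj S] span_superset[of "roots H (off_axis_flat S)"]
    by (intro flat_eqI) blast+
  then show ?thesis using inj S by blast
qed

text \<open>
  The labels resting at the axis point \<open>a\<close> confine the roots. If \<open>a\<close> carries no fixed particle,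
  there are no roots \<open>e\<^sub>i\<close>; then there are at least two such labels, and two labels are impossible since
  their roots lie on the two independent lines spanned by \<open>e\<^sub>j - e\<^sub>k\<close> and \<open>e\<^sub>j + e\<^sub>k\<close>.
\<close>

lemma irreducible_axial:
  assumes a: "a \<in> A" "\<forall>x\<in>\<alpha>. x $ i = a" and u: "u \<in> roots H \<alpha>" "u $ i \<noteq> 0"
  shows "\<exists>L. (a \<in> P \<and> L \<noteq> {} \<or> 3 \<le> card L) \<and> \<alpha> = axial_flat L a"
proof -
  define L where "L = {j. \<forall>x\<in>\<alpha>. x $ j = a}"
  have i: "i \<in> L" using a(2) by (simp add: L_def)
  have L_iff: "label p \<in> L \<longleftrightarrow> (\<forall>x\<in>\<alpha>. pos x p = a)" for p
    unfolding pos_eq_axis_iff[OF a(1)] by (simp add: L_def)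
  have closed: "label q \<in> L" if "same p q" "label p \<in> L" for p q
    using that unfolding L_iff same_def by simp
  have supp: "k \<in> L" if vk: "v \<in> roots H \<alpha>" "v $ k \<noteq> 0" for v k
  proof (rule ccontr)
    assume k: "k \<notin> L"
    have "v $ k = 0"
      by (rule roots_supported[OF _ u(1) i u(2) vk(1) k]) (rule closed)
    then show False using vk(2) by simp
  qed
  have sub: "\<alpha> \<subseteq> axial_flat L a"
    using flat_subset by (auto simp: axial_flat_def L_def)
  have axial_root: "b = a \<and> j \<in> L"
    if h: "(axis j 1, {x \<in> X. x $ j = b}) \<in> H" "\<alpha> \<subseteq> {x \<in> X. x $ j = b}" "b \<in> P" for j b
  proof -
    have "axis j 1 \<in> roots H \<alpha>" unfolding roots_iff using h by blast
    then have j: "j \<in> L" by (rule supp) (simp add: axis_def)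
    have "\<forall>x\<in>\<alpha>. x $ j = b" using h(2) by blast
    moreover have "\<forall>x\<in>\<alpha>. x $ j = a" using j by (simp add: L_def)
    ultimately show ?thesis
      using constant_unique[OF flat] P_subset h(3) a(1) j by blast
  qed
  have pair_root: "label p \<in> L \<and> label q \<in> L"
    if "(particle_vec p - particle_vec q, meet p q) \<in> H" "\<alpha> \<subseteq> meet p q" "label p \<noteq> label q" for p q
  proof -
    have "particle_vec p - particle_vec q \<in> roots H \<alpha>" unfolding roots_iff using that by blast
    then show ?thesis using supp particle_vec_diff_nth[OF that(3)] by blast
  qed
  have big: "a \<in> P \<and> L \<noteq> {} \<or> 3 \<le> card L"
  proof (cases "a \<in> P")
    case True
    then show ?thesis using i by blast
  next
    case False
    have roots_pair: "\<exists>p q. label p \<in> L \<and> label q \<in> L \<and> label p \<noteq> label q \<and> v = particle_vec p - particle_vec q"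
      if v: "v \<in> roots H \<alpha>" for v
    proof -
      obtain h where h: "(v, h) \<in> H" "\<alpha> \<subseteq> h" using v unfolding roots_iff by blast
      from h(1) show ?thesis
      proof (cases rule: hyperplane_cases)
        case (pair p q)
        then show ?thesis using pair_root[of p q] h by blast
      next
        case (axial j b)
        then show ?thesis using axial_root[of j b] h False by blast
      qed
    qed
    obtain p q where pq: "label p \<in> L" "label q \<in> L" "label p \<noteq> label q"
      using roots_pair[OF u(1)] by blast
    have "card {label p, label q} \<le> card L"
      using pq by (intro card_mono) simp_all
    then have "2 \<le> card L" using pq(3) by simp
    moreover have "card L \<noteq> 2"
    proof
      assume "card L = 2"
      then obtain j k where jk: "L = {j, k}" "j \<noteq> k" unfolding card_2_iff by blast
      let ?m = "axis j 1 - axis k 1 :: real ^ 'n" and ?p = "axis j 1 + axis k 1 :: real ^ 'n"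
      have cover: "roots H \<alpha> \<subseteq> span {?m} \<union> span {?p}"
      proof
        fix v assume "v \<in> roots H \<alpha>"
        from roots_pair[OF this] obtain p q where
          pq: "label p \<in> L" "label q \<in> L" "label p \<noteq> label q" "v = particle_vec p - particle_vec q"
          by blast
        then have "label p = j \<and> label q = k \<or> label p = k \<and> label q = j"
          using jk by auto
        then have "v = ?m \<or> v = - ?m \<or> v = ?p \<or> v = - ?p"
          unfolding pq(4) by (cases p; cases q) auto
        then show "v \<in> span {?m} \<union> span {?p}"
          using span_base[of ?m "{?m}"] span_base[of ?p "{?p}"] span_neg by blast
      qed
      have comp: "?m $ j = 1" "?m $ k = -1" "?p $ j = 1" "?p $ k = 1"
        using jk(2) by (simp_all add: axis_def)
      have trivial: "span {?m} \<inter> span {?p} \<subseteq> {0}"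
      proof
        fix v assume "v \<in> span {?m} \<inter> span {?p}"
        then obtain c d where cd: "v = c *\<^sub>R ?m" "v = d *\<^sub>R ?p"
          unfolding span_singleton by blast
        have "v $ j = c" "v $ k = - c" unfolding cd(1) vector_scaleR_component comp by simp_all
        moreover have "v $ j = d" "v $ k = d" unfolding cd(2) vector_scaleR_component comp by simp_all
        ultimately have "c = 0" by linarith
        then show "v \<in> {0}" unfolding cd(1) by simp
      qed
      have "roots H \<alpha> \<subseteq> span {?m} \<or> roots H \<alpha> \<subseteq> span {?p}"
        by (rule indecomposableD[OF irreducible subspace_span subspace_span trivial cover])
      moreover have "x \<in> roots H \<alpha> \<or> - x \<in> roots H \<alpha>" if "x = ?m \<or> x = ?p" for x
      proof -
        have ex: "particle_vec r - particle_vec s \<in> roots H \<alpha> \<or> - (particle_vec r - particle_vec s) \<in> roots H \<alpha>"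
          if rs: "label r = j" "label s = k" for r s
        proof -
          obtain v where v: "(v, meet r s) \<in> H" "v = particle_vec r - particle_vec s \<or> v = - (particle_vec r - particle_vec s)"
            using pair_hyperplane[of r s] rs jk(2) by blast
          have "same r s"
            unfolding same_def
          proof
            fix x assume "x \<in> \<alpha>"
            moreover have "label r \<in> L" "label s \<in> L" using rs jk(1) by simp_all
            ultimately have "pos x r = a" "pos x s = a"
              unfolding L_iff by blast+
            then show "pos x r = pos x s" by simp
          qed
          then have "v \<in> roots H \<alpha>"
            using v(1) same_iff_subset_meet unfolding roots_iff by blast
          then show ?thesis using v(2) by blast
        qed
        show ?thesis
          using that ex[of "Pos j" "Pos k"] ex[of "Pos j" "Neg k"] by auto
      qed
      then have "?m \<in> span (roots H \<alpha>)" "?p \<in> span (roots H \<alpha>)"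
        using span_base[of _ "roots H \<alpha>"] span_neg[of _ "roots H \<alpha>"] by (metis minus_minus)+
      ultimately have "?p \<in> span {?m} \<or> ?m \<in> span {?p}"
        using span_minimal[OF _ subspace_span, of "roots H \<alpha>"] by blast
      then have "?m = 0 \<or> ?p = 0"
        using trivial span_base[of ?m "{?m}"] span_base[of ?p "{?p}"] by blast
      then show False using comp by (metis zero_index zero_neq_one)
    qed
    ultimately show ?thesis by linarith
  qed
  have "a \<in> P \<and> L \<noteq> {} \<or> 2 \<le> card L" using big by auto
  then have fl: "axial_flat L a \<in> F"
    using axial_flat_in[OF a(1)] by blast
  moreover have "roots H \<alpha> \<subseteq> roots H (axial_flat L a)"
  proof
    fix v assume "v \<in> roots H \<alpha>"
    then obtain h where h: "(v, h) \<in> H" "\<alpha> \<subseteq> h" unfolding roots_iff by blast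
    from h(1) have "axial_flat L a \<subseteq> h"
    proof (cases rule: hyperplane_cases)
      case (pair p q)
      then have pq: "label p \<in> L" "label q \<in> L" using pair_root[of p q] h by blast+
      show ?thesis
      proof
        fix x assume x: "x \<in> axial_flat L a"
        have "pos x p = a" "pos x q = a"
          using pos_axial_flat[OF a(1) x] pq by blast+
        then show "x \<in> h"
          using x by (simp add: pair(3) meet_def axial_flat_def)
      qed
    next
      case (axial j b)
      then have "b = a" "j \<in> L" using axial_root[of j b] h by blast+
      then show ?thesis by (auto simp: axial(3) axial_flat_def)
    qed
    then show "v \<in> roots H (axial_flat L a)"
      unfolding roots_iff using h(1) by blast
  qed
  ultimately have "\<alpha> = axial_flat L a"
    using flat sub span_superset[of "roots H (axial_flat L a)"] by (intro flat_eqI) blast+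
  then show ?thesis using big by blast
qed

text \<open>
  Start from any root. If it is a collision of \<open>p\<close> and \<open>q\<close>, what matters is whether \<open>p\<close> also
  coincides with its mirror image, that is, rests at an axis point.
\<close>

lemma irreducible_flat_cases:
  "(\<exists>S p q. inj_on label S \<and> p \<in> S \<and> q \<in> S \<and> p \<noteq> q \<and> \<alpha> = off_axis_flat S) \<or>
   (\<exists>a\<in>A. \<exists>L. (a \<in> P \<and> L \<noteq> {} \<or> 3 \<le> card L) \<and> \<alpha> = axial_flat L a)"
proof -
  obtain u where u: "u \<in> roots H \<alpha>"
    using irreducible unfolding indecomposable_def by blast
  then obtain h where h: "(u, h) \<in> H" "\<alpha> \<subseteq> h" unfolding roots_iff by blast
  from h(1) show ?thesis
  proof (cases rule: hyperplane_cases)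
    case (pair p q)
    have same: "same p q" using h(2) pair(3) same_iff_subset_meet by simp
    have nz: "u $ label p \<noteq> 0"
      unfolding pair(2) by (rule particle_vec_diff_nth(1)[OF pair(1)])
    show ?thesis
    proof (cases "same p (mirror p)")
      case False
      then show ?thesis
        using irreducible_off_axis[OF pair(1) same False u nz] by blast
    next
      case True
      have "mir (x $ label p) = x $ label p" if "x \<in> \<alpha>" for x
      proof -
        have "pos x p = mir (pos x p)"
          using True that unfolding same_def pos_mirror by blast
        then show ?thesis by (cases p) simp_all
      qed
      then obtain a where a: "a \<in> A" "\<forall>x\<in>\<alpha>. x $ label p = a"
        using constant_on_flat[OF flat] by blast
      show ?thesis
        using irreducible_axial[OF a u nz] a(1) by (intro disjI2 bexI)
    qed
  next
    case (axial i a)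
    have a: "a \<in> A" using axial(1) P_subset by blast
    have "\<forall>x\<in>\<alpha>. x $ i = a" using h(2) axial(3) by blast
    moreover have "u $ i \<noteq> 0" by (simp add: axial(2) axis_def)
    ultimately show ?thesis
      using irreducible_axial[OF a _ u] a by (intro disjI2 bexI)
  qed
qed

end

lemma support_Off_Axis: "support X pos (Off_Axis us) = off_axis_flat (set us)"
  by (simp add: off_axis_flat_def)

lemma support_On_Axis:
  assumes "a \<in> A"
  shows "support X pos (On_Axis a us) = axial_flat (label ` set us) a"
  unfolding support.simps pos_eq_axis_iff[OF assms] axial_flat_def by auto

lemma ex_labels_list:
  fixes L :: "'n set"
  shows "\<exists>us. distinct (map label us) \<and> label ` set us = L \<and> length us = card L"
proof -
  obtain ls where "set ls = L" "distinct ls"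
    using finite_distinct_list[of L] by auto
  then show ?thesis
    by (intro exI[of _ "map Pos ls"]) (auto simp: comp_def image_image distinct_card[symmetric])
qed

theorem Min_building_iff_bracket:
  assumes \<alpha>: "\<alpha> \<in> F"
  shows "\<alpha> \<in> Min_building F H \<longleftrightarrow>
    (\<exists>us. distinct (map label us) \<and> 2 \<le> length us \<and> \<alpha> = support X pos (Off_Axis us)) \<or>
    (\<exists>a\<in>A. \<exists>us. distinct (map label us) \<and> axial_size_ok P a us \<and> \<alpha> = support X pos (On_Axis a us))"
    (is "_ \<longleftrightarrow> ?off \<or> ?on")
proof -
  have "?off \<or> ?on" if irr: "indecomposable (roots H \<alpha>)"
    using irreducible_flat_cases[OF \<alpha> irr]
  proof
    assume "\<exists>S p q. inj_on label S \<and> p \<in> S \<and> q \<in> S \<and> p \<noteq> q \<and> \<alpha> = off_axis_flat S"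
    then obtain S p q where S: "inj_on label S" "p \<in> S" "q \<in> S" "p \<noteq> q" "\<alpha> = off_axis_flat S"
      by (elim exE conjE)
    have "finite S"
      using S(1) by (rule inj_on_finite[of _ _ UNIV]) simp_all
    then obtain us where us: "set us = S" "distinct us"
      using finite_distinct_list by blast
    have "card {p, q} \<le> card S" using S \<open>finite S\<close> by (intro card_mono) auto
    then have "2 \<le> length us"
      using us S(4) distinct_card[of us] by simp
    moreover have "distinct (map label us)"
      using us S(1) by (simp add: distinct_map)
    moreover have "\<alpha> = support X pos (Off_Axis us)"
      unfolding support_Off_Axis us(1) by (rule S(5))
    ultimately show ?thesis by blast
  next
    assume "\<exists>a\<in>A. \<exists>L. (a \<in> P \<and> L \<noteq> {} \<or> 3 \<le> card L) \<and> \<alpha> = axial_flat L a"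
    then obtain a L where a: "a \<in> A" "\<alpha> = axial_flat L a" and L: "a \<in> P \<and> L \<noteq> {} \<or> 3 \<le> card L"
      by (elim exE conjE bexE)
    obtain us where us: "distinct (map label us)" "label ` set us = L" "length us = card L"
      using ex_labels_list by blast
    have "1 \<le> card L" if "L \<noteq> {}"
      using that card_gt_0_iff[of L] by (simp add: Suc_le_eq)
    then have "axial_size_ok P a us"
      using L unfolding axial_size_ok_def us(3) by (cases "L = {}") auto
    moreover have "\<alpha> = support X pos (On_Axis a us)"
      unfolding support_On_Axis[OF a(1)] us(2) by (rule a(2))
    ultimately show ?thesis using us(1) a(1) by blast
  qed
  moreover have "indecomposable (roots H \<alpha>)" if off: "?off"
  proof -
    obtain us where us: "distinct (map label us)" "2 \<le> length us" "\<alpha> = support X pos (Off_Axis us)"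
      using off by blast
    obtain p q vs where "us = p # q # vs"
      using us(2) by (auto simp: numeral_2_eq_2 Suc_le_length_iff)
    then have "p \<in> set us" "q \<in> set us" "p \<noteq> q" "inj_on label (set us)"
      using us(1) by (auto simp: distinct_map)
    then show ?thesis
      unfolding us(3) support_Off_Axis using indecomposable_off_axis_flat by blast
  qed
  moreover have "indecomposable (roots H \<alpha>)" if on: "?on"
  proof -
    obtain a us where us: "a \<in> A" "distinct (map label us)" "axial_size_ok P a us" "\<alpha> = support X pos (On_Axis a us)"
      using on by blast
    have "card (label ` set us) = length us"
      using distinct_card[OF us(2)] by simp
    then have "a \<in> P \<and> label ` set us \<noteq> {} \<or> 3 \<le> card (label ` set us)"
      using us(3) by (auto simp: axial_size_ok_def split: if_splits)
    then show ?thesis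
      unfolding us(4) support_On_Axis[OF us(1)] by (rule indecomposable_axial_flat[OF us(1)])
  qed
  ultimately have "indecomposable (roots H \<alpha>) \<longleftrightarrow> ?off \<or> ?on" by blast
  then show ?thesis
    unfolding Min_building_eq_irreducible_flats using \<alpha> by simp
qed

end

section \<open>Symmetric brackets as words with distinct labels\<close>

text \<open>
  Since the diagram may be in any order, a bracket can be drawn around every word with distinct
  labels, at either end of the diagram.
\<close>

lemma half_diagram_extension:
  fixes us :: "'n::finite particle list"
  assumes "distinct (map label us)"
  obtains vs where "half_diagram (us @ vs)" "half_diagram (vs @ us)"
proof -
  obtain ls where "set ls = - label ` set us" "distinct ls"
    using finite_distinct_list[of "- label ` set us"] by auto
  then have "half_diagram (us @ map Pos ls)" "half_diagram (map Pos ls @ us)"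
    using assms by (auto simp: half_diagram_def comp_def image_image)
  then show ?thesis by (rule that)
qed

lemma distinct_labels_sublist: "half_diagram ws \<Longrightarrow> sublist us ws \<Longrightarrow> distinct (map label us)"
  by (auto simp: half_diagram_def sublist_def)

lemma ex_half_diagram_iff:
  fixes us :: "'n::finite particle list"
  shows "(\<exists>ws. half_diagram ws \<and> sublist us ws) \<longleftrightarrow> distinct (map label us)"
    "(\<exists>ws. half_diagram ws \<and> prefix us ws) \<longleftrightarrow> distinct (map label us)"
    "(\<exists>ws. half_diagram ws \<and> suffix us ws) \<longleftrightarrow> distinct (map label us)"
proof -
  have "(\<exists>ws. half_diagram ws \<and> prefix us ws) \<and> (\<exists>ws. half_diagram ws \<and> suffix us ws)"
    if d: "distinct (map label us)"
    using half_diagram_extension[OF d] by (metis prefixI suffixI)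
  then show "(\<exists>ws. half_diagram ws \<and> sublist us ws) \<longleftrightarrow> distinct (map label us)"
    "(\<exists>ws. half_diagram ws \<and> prefix us ws) \<longleftrightarrow> distinct (map label us)"
    "(\<exists>ws. half_diagram ws \<and> suffix us ws) \<longleftrightarrow> distinct (map label us)"
    using distinct_labels_sublist prefix_imp_sublist suffix_imp_sublist by metis+
qed

lemma line_brackets_eq:
  "line_brackets P = {Off_Axis us | us :: 'n::finite particle list. distinct (map label us) \<and> 2 \<le> length us} \<union>
     {On_Axis 0 us | us. distinct (map label us) \<and> axial_size_ok P 0 us}"
proof -
  have "line_brackets P = {Off_Axis us | us :: 'n particle list. (\<exists>ws. half_diagram ws \<and> sublist us ws) \<and> 2 \<le> length us} \<union>
     {On_Axis 0 us | us. (\<exists>ws. half_diagram ws \<and> prefix us ws) \<and> axial_size_ok P 0 us}"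
    unfolding line_brackets_def by auto
  then show ?thesis
    unfolding ex_half_diagram_iff .
qed

lemma circle_brackets_eq:
  "circle_brackets P = {Off_Axis us | us :: 'n::finite particle list. distinct (map label us) \<and> 2 \<le> length us} \<union>
     {On_Axis a us | a us. a \<in> {1, -1} \<and> distinct (map label us) \<and> axial_size_ok P a us}"
proof -
  have "circle_brackets P = {Off_Axis us | us :: 'n::finite particle list. (\<exists>ws. half_diagram ws \<and> sublist us ws) \<and> 2 \<le> length us} \<union>
     {On_Axis 1 us | us. (\<exists>ws. half_diagram ws \<and> prefix us ws) \<and> axial_size_ok P 1 us} \<union>
     {On_Axis (- 1) us | us. (\<exists>ws. half_diagram ws \<and> suffix us ws) \<and> axial_size_ok P (- 1) us}"
    unfolding circle_brackets_def by auto
  then show ?thesis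
    unfolding ex_half_diagram_iff by auto
qed

section \<open>Spheres with reflection symmetry\<close>

lemma ex_other_label: 
  fixes L :: "'n::finite set"
  assumes "2 \<le> card L" "i \<in> L"
  obtains j where "j \<in> L" "j \<noteq> i"
proof -
  have "L \<noteq> {i}" using assms(1) by auto
  then show ?thesis using assms(2) that by blast
qed

lemma linear_realization_sphere:
  fixes H :: "('n::finite, real ^ 'n) arrangement"
  assumes "finite H" "\<And>v h. (v, h) \<in> H \<Longrightarrow> v \<noteq> 0" 
    and h: "\<And>v h. (v, h) \<in> H \<Longrightarrow> h = {x \<in> sphere_BD. v \<bullet> x = 0}"
  shows "linear_realization sphere_BD H"
proof
  fix u g w assume "(u, g) \<in> H" "u \<bullet> w \<noteq> 0"
  then have "w \<noteq> 0" by auto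
  let ?x = "(1 / norm w) *\<^sub>R w"
  have "norm ?x = 1" using \<open>w \<noteq> 0\<close> by simp
  then have "?x \<in> h \<longleftrightarrow> v \<bullet> w = 0" if "(v, h) \<in> H" for v h
    using h[OF that] \<open>w \<noteq> 0\<close> by (simp add: sphere_BD_def)
  then show "\<exists>x. \<forall>(v, h)\<in>H. x \<in> h \<longleftrightarrow> v \<bullet> w = 0" by (intro exI[of _ ?x]) blast
next
  fix x :: "real ^ 'n" assume "x \<in> sphere_BD"
  then have "x \<in> g \<longleftrightarrow> v \<bullet> x = 0" if "(v, g) \<in> H" for v g
    using h[OF that] by simp
  then show "\<exists>w. \<forall>(v, h)\<in>H. x \<in> h \<longleftrightarrow> v \<bullet> w = 0" by (intro exI[of _ x]) blast
qed (use assms in auto)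

lemma particle_vec_inner: "particle_vec p \<bullet> t = position uminus t p"
  by (cases p) (simp_all add: inner_axis')

lemma symmetric_complex_line:
  assumes P: "P \<subseteq> {0::real}"
  shows "symmetric_complex (sphere_BD :: (real ^ 'n::finite) set) uminus {0} P (spherical_flats (symmetric_arrangement sphere_BD uminus P))"
proof -
  interpret mirror_positions "sphere_BD :: (real ^ 'n) set" uminus "{0}" P
    by unfold_locales (use P finite_subset[OF P] in auto)
  have hyp: "h = {x \<in> sphere_BD. v \<bullet> x = 0}" if "(v, h) \<in> H" for v h
    using that
  proof (cases rule: hyperplane_cases)
    case (pair p q)
    then show ?thesis by (simp add: meet_def inner_diff_left particle_vec_inner)
  next
    case (axial i a)
    then have "a = 0" using P by blast
    then show ?thesis using axial by (simp add: inner_axis')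
  qed
  interpret linear_realization sphere_BD H
    by (rule linear_realization_sphere[OF finite_arrangement normal_nonzero hyp])
  show ?thesis
  proof (rule symmetric_complex.intro[OF mirror_positions_axioms], rule symmetric_complex_axioms.intro, goal_cases)
    case 1
    show ?case by (rule flat_geometry)
  next
    case (2 \<alpha> i)
    then show ?case by auto
  next
    case (3 \<alpha> a b)
    then show ?case by simp
  next
    case (4 S p q)
    note S = Inter_off_axis_hyps[OF 4]
    have "off_axis_flat S \<in> spherical_flats H"
      unfolding spherical_flats_def
      by (intro CollectI exI[of _ "off_axis_hyps S"] conjI S(1)[symmetric] off_axis_hyps_subset S(2))
    moreover have "roots H (off_axis_flat S) \<subseteq> span (differences S)"
      using roots_Inter_subset_span[OF off_axis_hyps_subset, of S] span_mono[OF fst_off_axis_hyps, of S]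
      unfolding S(1) span_span by (rule subset_trans)
    ultimately show ?case ..
  next
    case (5 a L)
    have a: "a = 0" using 5(1) by simp
    have ne: "axial_hyps L a \<noteq> {}" by (rule axial_hyps_nonempty[OF 5(2)])
    have eq: "\<Inter>(snd ` axial_hyps L a) = axial_flat L a"
    proof
      show "axial_flat L a \<subseteq> \<Inter>(snd ` axial_hyps L a)"
        by (rule axial_flat_subset_Inter[OF 5(1)])
      show "\<Inter>(snd ` axial_hyps L a) \<subseteq> axial_flat L a"
      proof
        fix x assume x: "x \<in> \<Inter>(snd ` axial_hyps L a)"
        then have in_h: "x \<in> h" if "(v, h) \<in> axial_hyps L a" for v h
          using that by force
        obtain v h where "(v, h) \<in> axial_hyps L a" using ne by auto
        then have "x \<in> sphere_BD"
          using in_h axial_hyps_subset hyperplane_subset by blast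
        moreover have "x $ i = a" if i: "i \<in> L" for i
        proof (cases "a \<in> P")
          case True
          then have "(axis i 1, {x \<in> sphere_BD. x $ i = a}) \<in> axial_hyps L a"
            using i unfolding axial_hyps_def by blast
          then show ?thesis using in_h by blast
        next
          case False
          then obtain j where j: "j \<in> L" "j \<noteq> i" using 5(2) i ex_other_label by metis
          obtain v w where "(v, meet (Pos i) (Pos j)) \<in> axial_hyps L a" "(w, meet (Pos i) (Neg j)) \<in> axial_hyps L a"
            using axial_hyps_pair[of "Pos i" L "Pos j" a] axial_hyps_pair[of "Pos i" L "Neg j" a] i j by auto
          then have "x \<in> meet (Pos i) (Pos j)" "x \<in> meet (Pos i) (Neg j)"
            using in_h by blast+
          then show ?thesis by (simp add: meet_def a)
        qed
        ultimately show "x \<in> axial_flat L a" by (simp add: axial_flat_def)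
      qed
    qed
    have "axial_flat L a \<in> spherical_flats H"
      unfolding spherical_flats_def
      by (intro CollectI exI[of _ "axial_hyps L a"] conjI eq[symmetric] axial_hyps_subset ne)
    moreover have "roots H (axial_flat L a) \<subseteq> span (axial_roots (a \<in> P) L)"
      using roots_Inter_subset_span[OF axial_hyps_subset, of L a] span_mono[OF fst_axial_hyps, of L a]
      unfolding eq span_span by (rule subset_trans)
    ultimately show ?case ..
  qed
qed

lemma line_pos_eq: "line_pos = position uminus"
proof (intro ext)
  fix x :: "real ^ 'n" and p
  show "line_pos x p = position uminus x p" by (cases p) simp_all
qed

lemma cox_sym_eq: "cox_sym P = symmetric_arrangement sphere_BD uminus P"
  unfolding cox_sym_def symmetric_arrangement_def ..

theorem Min_building_cox_sym:
  assumes P: "P \<subseteq> {0}" and \<alpha>: "\<alpha> \<in> spherical_flats (cox_sym P :: ('n::finite, real ^ 'n) arrangement)"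
  shows "\<alpha> \<in> Min_building (spherical_flats (cox_sym P)) (cox_sym P) \<longleftrightarrow> (\<exists>b\<in>line_brackets P. \<alpha> = line_support b)"
proof -
  interpret symmetric_complex "sphere_BD :: (real ^ 'n) set" uminus "{0}" P "spherical_flats (cox_sym P)"
    using symmetric_complex_line[OF P] unfolding cox_sym_eq .
  have "\<alpha> \<in> Min_building (spherical_flats (cox_sym P)) (cox_sym P) \<longleftrightarrow>
    (\<exists>us. distinct (map label us) \<and> 2 \<le> length us \<and> \<alpha> = line_support (Off_Axis us)) \<or>
    (\<exists>us. distinct (map label us) \<and> axial_size_ok P 0 us \<and> \<alpha> = line_support (On_Axis 0 us))"
    using Min_building_iff_bracket[OF \<alpha>] unfolding line_support_def line_pos_eq cox_sym_eq by simp
  also have "\<dots> \<longleftrightarrow> (\<exists>b\<in>line_brackets P. \<alpha> = line_support b)"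
    unfolding line_brackets_eq by blast
  finally show ?thesis .
qed

section \<open>Tori with reflection symmetry\<close>

lemma circle_pos_eq: "circle_pos = position cnj"
proof (intro ext)
  fix x :: "complex ^ 'n" and p
  show "circle_pos x p = position cnj x p" by (cases p) simp_all
qed

lemma cox_sym_tilde_eq: "cox_sym_tilde P = symmetric_arrangement torus cnj P"
  unfolding cox_sym_tilde_def symmetric_arrangement_def ..

lemma circle_position_shift:
  "position cnj (torus_shift z t) p = position cnj z p * cis (particle_vec p \<bullet> t)"
  by (cases p) (simp_all add: inner_axis' cis_cnj)

lemma torus_shift_in_torus: "z \<in> torus \<Longrightarrow> torus_shift z t \<in> torus"
  by (simp add: torus_def norm_mult)

lemma position_norm: "z \<in> torus \<Longrightarrow> norm (position cnj z p) = 1"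
  by (cases p) (simp_all add: torus_def)

lemma sum_abs_axis: "(\<Sum>k\<in>UNIV. \<bar>(axis i 1 :: real ^ 'n::finite) $ k\<bar>) = 1"
  by (simp add: axis_def if_distrib[of abs] cong: if_cong)

lemma sum_abs_particle_vec: "(\<Sum>k\<in>UNIV. \<bar>particle_vec p $ k\<bar>) = 1"
  by (cases p) (simp_all add: sum_abs_axis)

text \<open>
  A shift by \<open>t\<close> rotates the position of the particle \<open>p\<close> by the angle \<open>e\<^sub>p \<bullet> t\<close>, also for mirror
  images, whence all collision conditions become congruences modulo a full turn.
\<close>

lemma toric_arrangement_symmetric:
  assumes P: "P \<subseteq> {1, -1}"
  shows "toric_arrangement (symmetric_arrangement (torus :: (complex ^ 'n::finite) set) cnj P)"
proof -
  interpret mirror_positions "torus :: (complex ^ 'n) set" cnj "{1, -1}" P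
    by unfold_locales (use P finite_subset[OF P] in auto)
  show ?thesis
  proof
    show "finite H" by (rule finite_arrangement)
    show "v \<noteq> 0" "h \<subseteq> torus" if "(v, h) \<in> H" for v h
      using normal_nonzero[OF that] hyperplane_subset[OF that] by blast+
    show "(\<Sum>i\<in>UNIV. \<bar>v $ i\<bar>) \<le> 2" if "(v, h) \<in> H" for v h
      using that
    proof (cases rule: hyperplane_cases)
      case (pair p q)
      have "(\<Sum>i\<in>UNIV. \<bar>v $ i\<bar>) \<le> (\<Sum>i\<in>UNIV. \<bar>particle_vec p $ i\<bar> + \<bar>particle_vec q $ i\<bar>)"
        unfolding pair(2) by (intro sum_mono) simp
      also have "\<dots> = 2"
        by (simp add: sum.distrib sum_abs_particle_vec)
      finally show ?thesis .
    next
      case (axial i a)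
      then show ?thesis by (simp add: sum_abs_axis)
    qed
    show "torus_shift z t \<in> h \<longleftrightarrow> (\<exists>k::int. v \<bullet> t = 2 * pi * k)" if vh: "(v, h) \<in> H" "z \<in> h" for v h z t
      using vh(1)
    proof (cases rule: hyperplane_cases)
      case (pair p q)
      have z: "z \<in> torus" "pos z p = pos z q"
        using vh(2) by (simp_all add: pair(3) meet_def)
      have "pos z q \<noteq> 0" using position_norm[OF z(1), of q] by auto
      then have "torus_shift z t \<in> h \<longleftrightarrow> cis (particle_vec p \<bullet> t) = cis (particle_vec q \<bullet> t)"
        using torus_shift_in_torus[OF z(1), of t] by (simp add: pair(3) meet_def circle_position_shift z(2))
      then show ?thesis
        by (simp add: cis_eq_iff pair(2) inner_diff_left)
    next
      case (axial i a)
      have z: "z \<in> torus" "z $ i = a"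
        using vh(2) by (simp_all add: axial(3))
      have "a \<noteq> 0" using axial(1) P by auto
      then have "torus_shift z t \<in> h \<longleftrightarrow> cis (t $ i) = cis 0"
        using torus_shift_in_torus[OF z(1), of t] by (simp add: axial(3) z(2))
      then show ?thesis
        unfolding cis_eq_iff by (simp add: axial(2) inner_axis')
    qed
  qed
qed

text \<open>
  Each support is recognised as a leaf: an off-axis support as the leaf through the configuration
  with all particles at the axis point \<open>0\<close>, and an axial support as the leaf through the
  configuration with all particles at its own axis point.
\<close>

lemma symmetric_complex_circle:
  assumes P: "P \<subseteq> {1, -1}"
  shows "symmetric_complex (torus :: (complex ^ 'n::finite) set) cnj {1, -1} P
    (toroidal_flats (top_of_set torus) (symmetric_arrangement torus cnj P))"
proof -
  interpret mirror_positions "torus :: (complex ^ 'n) set" cnj "{1, -1}" P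
    by unfold_locales (use P finite_subset[OF P] in auto)
  interpret toric_arrangement H
    by (rule toric_arrangement_symmetric[OF P])
  let ?F = "toroidal_flats (top_of_set torus) H"
  have leaf_flat: "leaf z (fst ` K) \<in> ?F" "roots H (leaf z (fst ` K)) \<subseteq> span (fst ` K)"
    if "K \<subseteq> H" "K \<noteq> {}" "z \<in> \<Inter>(snd ` K)" for z K
  proof -
    show "leaf z (fst ` K) \<in> ?F"
      unfolding toroidal_flats_eq by (intro CollectI exI[of _ z] exI[of _ K] conjI refl that)
    show "roots H (leaf z (fst ` K)) \<subseteq> span (fst ` K)"
      unfolding roots_leaf by blast
  qed
  have nonempty: "\<alpha> \<noteq> {}" and conn: "connected \<alpha>" and sub: "\<alpha> \<subseteq> torus" if "\<alpha> \<in> ?F" for \<alpha>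
  proof -
    obtain z K where zK: "K \<subseteq> H" "K \<noteq> {}" "z \<in> \<Inter>(snd ` K)" "\<alpha> = leaf z (fst ` K)"
      using \<open>\<alpha> \<in> ?F\<close> unfolding toroidal_flats_eq by blast
    show "\<alpha> \<noteq> {}" using self_in_leaf zK(4) by blast
    show "connected \<alpha>" unfolding zK(4) by (rule connected_leaf)
    obtain v h where "(v, h) \<in> K" using zK(2) by auto
    then have "\<Inter>(snd ` K) \<subseteq> torus" using zK(1) hyperplane_subset by force
    then show "\<alpha> \<subseteq> torus" unfolding zK(4) using leaf_subset_Inter[OF zK(1,3)] by blast
  qed
  show ?thesis
  proof (rule symmetric_complex.intro[OF mirror_positions_axioms], rule symmetric_complex_axioms.intro, goal_cases)
    case 1
    show ?case by (rule flat_geometry)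
  next
    case (2 \<alpha> i)
    have real: "x $ i \<in> {1, -1}" if "x \<in> \<alpha>" for x
    proof -
      have "norm (x $ i) = 1" "cnj (x $ i) = x $ i"
        using 2 that sub by (auto simp: torus_def)
      then have "Im (x $ i) = 0" "Re (x $ i) = 1 \<or> Re (x $ i) = - 1"
        by (auto simp: complex_eq_iff cmod_def power2_eq_1_iff)
      then show ?thesis by (auto simp: complex_eq_iff)
    qed
    obtain y where y: "y \<in> \<alpha>" using nonempty[OF 2(1)] by blast
    have "(\<lambda>x. x $ i) ` \<alpha> \<subseteq> {1, -1}" using real by blast
    then have fin: "finite ((\<lambda>x. x $ i) ` \<alpha>)" by (rule finite_subset) simp
    have "connected ((\<lambda>x. x $ i) ` \<alpha>)"
      by (intro connected_continuous_image conn[OF 2(1)] continuous_intros)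
    then obtain c where c: "(\<lambda>x. x $ i) ` \<alpha> = {c}"
      using connected_finite_iff_sing[of "(\<lambda>x. x $ i) ` \<alpha>"] fin y by auto
    then have xc: "\<forall>x\<in>\<alpha>. x $ i = c" by blast
    moreover have "c \<in> {1, -1}" using real[OF y] bspec[OF xc y] by simp
    ultimately show ?case by blast
  next
    case (3 \<alpha> a b i)
    obtain x where "x \<in> \<alpha>" using nonempty[OF 3(1)] by blast
    then have "x $ i = a" "x $ i = b" using 3(4,5) by blast+
    then show ?case by simp
  next
    case (4 S p0 q0)
    note S = Inter_off_axis_hyps[OF 4]
    let ?one = "(\<chi> i. 1) :: complex ^ 'n"
    have pos_one: "pos ?one p = 1" for p by (cases p) simp_all
    have one_torus: "?one \<in> torus" by (simp add: torus_def)
    have one: "?one \<in> \<Inter>(snd ` off_axis_hyps S)"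
      unfolding S(1) off_axis_flat_def using pos_one one_torus by auto
    have pos_shift: "pos (torus_shift ?one t) p = cis (particle_vec p \<bullet> t)" for t p
      unfolding circle_position_shift pos_one by simp
    have eq: "leaf ?one (fst ` off_axis_hyps S) = off_axis_flat S"
    proof
      show "leaf ?one (fst ` off_axis_hyps S) \<subseteq> off_axis_flat S"
        using leaf_subset_Inter[OF off_axis_hyps_subset one] unfolding S(1) .
      show "off_axis_flat S \<subseteq> leaf ?one (fst ` off_axis_hyps S)"
      proof
        fix z assume z: "z \<in> off_axis_flat S"
        then have zt: "z \<in> torus" and zS: "\<And>p. p \<in> S \<Longrightarrow> pos z p = pos z p0"
          using 4(2) unfolding off_axis_flat_def by blast+
        have cis_Arg_torus: "cis (Arg (pos z p)) = pos z p" for p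
          by (rule cis_Arg_of_norm_1[OF position_norm[OF zt]])
        \<comment> \<open>All particles of the bracket have to use the same angle: the argument of a mirror image is not
           always minus the argument, as the point \<open>- 1\<close> shows.\<close>
        let ?\<theta> = "Arg (pos z p0)"
        define t :: "real ^ 'n" where
          "t = (\<chi> i. if Pos i \<in> S then ?\<theta> else if Neg i \<in> S then - ?\<theta> else Arg (z $ i))"
        have "cis (t $ i) = z $ i" for i
        proof -
          consider "Pos i \<in> S" | "Pos i \<notin> S" "Neg i \<in> S" | "Pos i \<notin> S" "Neg i \<notin> S" by blast
          then show ?thesis
          proof cases
            case 1
            then show ?thesis using zS[OF 1] cis_Arg_torus[of p0] by (simp add: t_def)
          next
            case 2
            have "cnj (z $ i) = cis ?\<theta>" using zS[OF 2(2)] cis_Arg_torus[of p0] by simp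
            then have "z $ i = cis (- ?\<theta>)" by (metis complex_cnj_cnj cis_cnj)
            then show ?thesis using 2 by (simp add: t_def)
          next
            case 3
            then show ?thesis using cis_Arg_torus[of "Pos i"] by (simp add: t_def)
          qed
        qed
        then have z_eq: "z = torus_shift ?one t" by (simp add: vec_eq_iff)
        have angle: "particle_vec p \<bullet> t = ?\<theta>" if p: "p \<in> S" for p
        proof (cases p)
          case (Pos i)
          then show ?thesis using p by (simp add: inner_axis' t_def)
        next
          case (Neg i)
          have "Pos i \<notin> S"
            using 4(1) p inj_onD[of label S "Pos i" "Neg i"] unfolding Neg by auto
          then show ?thesis using p by (simp add: Neg inner_axis' t_def)
        qed
        have diff: "d \<bullet> t = 0" if "d \<in> differences S" for d
          using that angle unfolding differences_def by (auto simp: inner_diff_left)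
        have "v \<bullet> t = 0" if "v \<in> fst ` off_axis_hyps S" for v
          using orthogonal_annihilates_span[OF subsetD[OF fst_off_axis_hyps that] diff] .
        then show "z \<in> leaf ?one (fst ` off_axis_hyps S)"
          unfolding in_leaf_iff using z_eq by blast
      qed
    qed
    have "off_axis_flat S \<in> ?F"
      using leaf_flat(1)[OF off_axis_hyps_subset S(2) one] unfolding eq .
    moreover have "roots H (off_axis_flat S) \<subseteq> span (differences S)"
      using leaf_flat(2)[OF off_axis_hyps_subset S(2) one] span_mono[OF fst_off_axis_hyps, of S]
      unfolding eq span_span by (rule subset_trans)
    ultimately show ?case ..
  next
    case (5 a L)
    note ne = axial_hyps_nonempty[OF 5(2)]
    let ?z = "(\<chi> i. a) :: complex ^ 'n"
    have a: "a \<noteq> 0" "norm a = 1" using 5(1) by auto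
    have "?z \<in> axial_flat L a"
      unfolding axial_flat_def using a by (simp add: torus_def)
    then have base: "?z \<in> \<Inter>(snd ` axial_hyps L a)"
      using axial_flat_subset_Inter[OF 5(1)] by blast
    have eq: "leaf ?z (fst ` axial_hyps L a) = axial_flat L a"
    proof
      show "leaf ?z (fst ` axial_hyps L a) \<subseteq> axial_flat L a"
      proof
        fix x assume "x \<in> leaf ?z (fst ` axial_hyps L a)"
        then obtain t where t: "x = torus_shift ?z t" "\<forall>v\<in>fst ` axial_hyps L a. v \<bullet> t = 0"
          unfolding in_leaf_iff by blast
        have "t $ i = 0" if i: "i \<in> L" for i
        proof (cases "a \<in> P")
          case True
          then have "(axis i 1, {x \<in> torus. x $ i = a}) \<in> axial_hyps L a"
            using i unfolding axial_hyps_def by blast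
          then have "axis i 1 \<bullet> t = 0" using t(2) by force
          then show ?thesis by (simp add: inner_axis')
        next
          case False
          then obtain j where j: "j \<in> L" "j \<noteq> i" using 5(2) i ex_other_label by metis
          have pair0: "(particle_vec p - particle_vec q) \<bullet> t = 0"
            if pq: "label p \<in> L" "label q \<in> L" "label p \<noteq> label q" for p q
          proof -
            obtain v where "(v, meet p q) \<in> axial_hyps L a"
              and v: "v = particle_vec p - particle_vec q \<or> v = - (particle_vec p - particle_vec q)"
              using axial_hyps_pair[OF pq] by blast
            then have "v \<bullet> t = 0" using t(2) by force
            then show ?thesis using v by (auto simp: inner_diff_left)
          qed
          show ?thesis
            using pair0[of "Pos i" "Pos j"] pair0[of "Pos i" "Neg j"] i j
            by (simp add: inner_diff_left inner_add_left inner_axis')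
        qed
        then show "x \<in> axial_flat L a"
          unfolding axial_flat_def using a(2) by (simp add: t(1) torus_def norm_mult)
      qed
      show "axial_flat L a \<subseteq> leaf ?z (fst ` axial_hyps L a)"
      proof
        fix x assume x: "x \<in> axial_flat L a"
        then have xt: "x \<in> torus" and xL: "\<And>i. i \<in> L \<Longrightarrow> x $ i = a"
          by (simp_all add: axial_flat_def)
        define t :: "real ^ 'n" where "t = (\<chi> i. Arg (x $ i / a))"
        have "cis (t $ i) = x $ i / a" for i
        proof -
          have "norm (x $ i / a) = 1" using xt a(2) by (simp add: torus_def norm_divide)
          then show ?thesis by (simp add: t_def cis_Arg_of_norm_1)
        qed
        then have x_eq: "x = torus_shift ?z t"
          using a(1) by (simp add: vec_eq_iff)
        have t0: "t $ i = 0" if "i \<in> L" for i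
          using xL[OF that] a(1) Arg_cis[of 0] by (simp add: t_def)
        have part0: "particle_vec p \<bullet> t = 0" if "label p \<in> L" for p
          using t0 that by (cases p) (simp_all add: inner_axis')
        have root0: "d \<bullet> t = 0" if "d \<in> axial_roots (a \<in> P) L" for d
          using that part0 t0 unfolding axial_roots_def by (auto simp: inner_diff_left inner_axis')
        have "v \<bullet> t = 0" if "v \<in> fst ` axial_hyps L a" for v
          using orthogonal_annihilates_span[OF subsetD[OF fst_axial_hyps that] root0] .
        then show "x \<in> leaf ?z (fst ` axial_hyps L a)"
          unfolding in_leaf_iff using x_eq by blast
      qed
    qed
    have "axial_flat L a \<in> ?F"
      using leaf_flat(1)[OF axial_hyps_subset ne base] unfolding eq .
    moreover have "roots H (axial_flat L a) \<subseteq> span (axial_roots (a \<in> P) L)"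
      using leaf_flat(2)[OF axial_hyps_subset ne base] span_mono[OF fst_axial_hyps, of L a]
      unfolding eq span_span by (rule subset_trans)
    ultimately show ?case ..
  qed
qed

theorem Min_building_cox_sym_tilde:
  assumes P: "P \<subseteq> {1, -1}"
    and \<alpha>: "\<alpha> \<in> toroidal_flats (top_of_set torus) (cox_sym_tilde P :: ('n::finite, complex ^ 'n) arrangement)"
  shows "\<alpha> \<in> Min_building (toroidal_flats (top_of_set torus) (cox_sym_tilde P)) (cox_sym_tilde P) \<longleftrightarrow>
    (\<exists>b\<in>circle_brackets P. \<alpha> = circle_support b)"
proof -
  interpret symmetric_complex "torus :: (complex ^ 'n) set" cnj "{1, -1}" P
    "toroidal_flats (top_of_set torus) (cox_sym_tilde P)"
    using symmetric_complex_circle[OF P] unfolding cox_sym_tilde_eq .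
  have "\<alpha> \<in> Min_building (toroidal_flats (top_of_set torus) (cox_sym_tilde P)) (cox_sym_tilde P) \<longleftrightarrow>
    (\<exists>us. distinct (map label us) \<and> 2 \<le> length us \<and> \<alpha> = circle_support (Off_Axis us)) \<or>
    (\<exists>a\<in>{1, -1}. \<exists>us. distinct (map label us) \<and> axial_size_ok P a us \<and> \<alpha> = circle_support (On_Axis a us))"
    using Min_building_iff_bracket[OF \<alpha>] unfolding circle_support_def circle_pos_eq cox_sym_tilde_eq .
  also have "\<dots> \<longleftrightarrow> (\<exists>b\<in>circle_brackets P. \<alpha> = circle_support b)"
    unfolding circle_brackets_eq by blast
  finally show ?thesis .
qed

section \<open>Spheres without symmetry\<close>

lemma brackets_A_two:
  assumes "us \<in> brackets_A"
  obtains k l where "k \<in> set us" "l \<in> set us" "k \<noteq> l"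
proof -
  have "distinct us" "2 \<le> length us"
    using assms by (auto simp: brackets_A_def diagram_def sublist_def)
  moreover from this obtain k l vs where "us = k # l # vs"
    by (auto simp: numeral_2_eq_2 Suc_le_length_iff)
  ultimately show ?thesis using that[of k l] by simp
qed

text \<open>
  A vector is brought onto the sphere by subtracting the mean of its coordinates and normalising,
  which preserves coincidences of coordinates.
\<close>

lemma type_A_arrangement_sphere:
  "type_A_arrangement sphere_A (\<lambda>i j. {x \<in> sphere_A. x $ i = x $ j}) (cox_A :: ('n::finite, real ^ 'n) arrangement)"
proof
  show "(cox_A :: ('n, real ^ 'n) arrangement) =
      {(axis i 1 - axis j 1, {x \<in> sphere_A. x $ i = x $ j}) |i j. i \<noteq> j}"
    by (rule cox_A_def)
  show "\<exists>w :: real ^ 'n. \<forall>i j. i \<noteq> j \<longrightarrow> (x \<in> {x \<in> sphere_A. x $ i = x $ j} \<longleftrightarrow> w $ i = w $ j)"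
    if "x \<in> sphere_A" for x :: "real ^ 'n"
    using that by (intro exI[of _ x]) simp
  show "\<exists>x :: real ^ 'n. \<forall>i j. i \<noteq> j \<longrightarrow> (x \<in> {x \<in> sphere_A. x $ i = x $ j} \<longleftrightarrow> w $ i = w $ j)"
    if kl: "w $ k \<noteq> w $ l" for w :: "real ^ 'n" and k l
  proof -
    define y :: "real ^ 'n" where "y = (\<chi> i. w $ i - (\<Sum>k\<in>UNIV. w $ k) / real CARD('n))"
    have y_eq: "y $ i = y $ j \<longleftrightarrow> w $ i = w $ j" for i j
      by (simp add: y_def)
    have "y \<noteq> 0" using y_eq[of k l] kl by auto
    have "(\<Sum>i\<in>UNIV. y $ i) = 0"
      by (simp add: y_def sum_subtractf)
    then have "(1 / norm y) *\<^sub>R y \<in> sphere_A"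
      using \<open>y \<noteq> 0\<close> by (simp add: sphere_A_def sum_divide_distrib[symmetric])
    then show ?thesis
      using \<open>y \<noteq> 0\<close> y_eq by (intro exI[of _ "(1 / norm y) *\<^sub>R y"]) simp
  qed
qed auto

theorem Min_building_cox_A:
  assumes \<alpha>: "\<alpha> \<in> spherical_flats (cox_A :: ('n::finite, real ^ 'n) arrangement)"
  shows "\<alpha> \<in> Min_building (spherical_flats cox_A) (cox_A :: ('n, real ^ 'n) arrangement) \<longleftrightarrow>
    (\<exists>b\<in>brackets_A. \<alpha> = support_A b)"
proof -
  interpret type_A_arrangement sphere_A "\<lambda>i j. {x \<in> sphere_A. x $ i = x $ j}" "cox_A :: ('n, real ^ 'n) arrangement"
    by (rule type_A_arrangement_sphere)
  have "collision (set us) = support_A us" if us: "us \<in> brackets_A" for us :: "'n list"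
  proof -
    obtain k l where "k \<in> set us" "l \<in> set us" "k \<noteq> l" using brackets_A_two[OF us] .
    then show ?thesis
      unfolding collision_def support_A_def by auto
  qed
  then show ?thesis
    unfolding Min_building_iff_collision[OF \<alpha>] by auto
qed

section \<open>The torus modulo rotations\<close>

lemma istopology_orbit_space:
  "istopology (\<lambda>U. U \<subseteq> rotation_orbit ` (torus :: (complex ^ 'n::finite) set) \<and>
     openin (top_of_set torus) {z \<in> torus. rotation_orbit z \<in> U})"
  unfolding istopology_def
proof (intro conjI allI impI)
  fix S T :: "(complex ^ 'n) set set"
  assume *: "S \<subseteq> rotation_orbit ` torus \<and> openin (top_of_set torus) {z \<in> torus. rotation_orbit z \<in> S}"
    "T \<subseteq> rotation_orbit ` torus \<and> openin (top_of_set torus) {z \<in> torus. rotation_orbit z \<in> T}"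
  then show "S \<inter> T \<subseteq> rotation_orbit ` torus" by blast
  have "{z \<in> torus. rotation_orbit z \<in> S \<inter> T} =
      {z \<in> torus. rotation_orbit z \<in> S} \<inter> {z \<in> torus. rotation_orbit z \<in> T}" by blast
  then show "openin (top_of_set torus) {z \<in> torus. rotation_orbit z \<in> S \<inter> T}"
    using * by (simp add: openin_Int)
next
  fix \<K> :: "(complex ^ 'n) set set set"
  assume *: "\<forall>K\<in>\<K>. K \<subseteq> rotation_orbit ` torus \<and> openin (top_of_set torus) {z \<in> torus. rotation_orbit z \<in> K}"
  then show "\<Union>\<K> \<subseteq> rotation_orbit ` torus" by blast
  have "{z \<in> torus. rotation_orbit z \<in> \<Union>\<K>} = (\<Union>K\<in>\<K>. {z \<in> torus. rotation_orbit z \<in> K})" by blast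
  then show "openin (top_of_set torus) {z \<in> torus. rotation_orbit z \<in> \<Union>\<K>}"
    using * by auto
qed

lemma openin_orbit_space:
  "openin orbit_space U \<longleftrightarrow> U \<subseteq> rotation_orbit ` (torus :: (complex ^ 'n::finite) set) \<and>
     openin (top_of_set torus) {z \<in> torus. rotation_orbit z \<in> U}"
  unfolding orbit_space_def topology_inverse'[OF istopology_orbit_space] ..

lemma topspace_orbit_space: "topspace orbit_space = rotation_orbit ` (torus :: (complex ^ 'n::finite) set)"
proof
  show "topspace orbit_space \<subseteq> rotation_orbit ` (torus :: (complex ^ 'n) set)"
    using openin_orbit_space[of "topspace orbit_space"] openin_topspace[of orbit_space] by blast
  have "{z \<in> torus. rotation_orbit z \<in> rotation_orbit ` torus} = (torus :: (complex ^ 'n) set)" by blast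
  then have "openin orbit_space (rotation_orbit ` (torus :: (complex ^ 'n) set))"
    unfolding openin_orbit_space by simp
  then show "rotation_orbit ` (torus :: (complex ^ 'n) set) \<subseteq> topspace orbit_space"
    by (rule openin_subset)
qed

lemma continuous_map_rotation_orbit: "continuous_map (top_of_set torus) orbit_space rotation_orbit"
  unfolding continuous_map by (simp add: topspace_orbit_space openin_orbit_space)

lemma rotation_orbit_eqD:
  assumes "rotation_orbit z = rotation_orbit z'"
  shows "\<exists>c. norm c = 1 \<and> (\<forall>i. z $ i = c * z' $ i)"
proof -
  have "z = (\<chi> i. 1 * z $ i)" by (simp add: vec_eq_iff)
  then have "z \<in> rotation_orbit z"
    unfolding rotation_orbit_def by (intro CollectI exI[of _ 1]) simp
  then have "z \<in> rotation_orbit z'" using assms by simp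
  then show ?thesis unfolding rotation_orbit_def by auto
qed

text \<open>
  Coincidences of particles are invariant under rotation, so they can be read off any representative
  of an orbit.
\<close>

lemma rotation_orbit_in_image_iff:
  assumes "z \<in> torus"
  shows "rotation_orbit z \<in> rotation_orbit ` {z \<in> torus. \<forall>i\<in>S. \<forall>j\<in>S. z $ i = z $ j} \<longleftrightarrow> (\<forall>i\<in>S. \<forall>j\<in>S. z $ i = z $ j)"
proof
  assume "rotation_orbit z \<in> rotation_orbit ` {z \<in> torus. \<forall>i\<in>S. \<forall>j\<in>S. z $ i = z $ j}"
  then obtain z' where z': "rotation_orbit z = rotation_orbit z'" "\<forall>i\<in>S. \<forall>j\<in>S. z' $ i = z' $ j" by blast
  then obtain c where c: "\<forall>i. z $ i = c * z' $ i" using rotation_orbit_eqD by blast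
  show "\<forall>i\<in>S. \<forall>j\<in>S. z $ i = z $ j"
  proof (intro ballI)
    fix i j assume "i \<in> S" "j \<in> S"
    then have "z' $ i = z' $ j" using z'(2) by blast
    then show "z $ i = z $ j" using c by simp
  qed
qed (use assms in blast)

abbreviation orbit_hyp :: "'n::finite \<Rightarrow> 'n \<Rightarrow> (complex ^ 'n) set set" where
  "orbit_hyp i j \<equiv> rotation_orbit ` {z \<in> torus. z $ i = z $ j}"

lemma rotation_orbit_in_hyp_iff:
  assumes "z \<in> torus"
  shows "rotation_orbit z \<in> orbit_hyp i j \<longleftrightarrow> z $ i = z $ j"
proof -
  have "(\<forall>k\<in>{i, j}. \<forall>l\<in>{i, j}. z $ k = z $ l) \<longleftrightarrow> z $ i = z $ j" for z :: "complex ^ 'a"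
    by auto
  then show ?thesis
    using rotation_orbit_in_image_iff[OF assms, of "{i, j}"] by simp
qed

lemma torus_angles:
  fixes z :: "complex ^ 'n::finite"
  assumes "z \<in> torus"
  shows "\<exists>t. z = torus_shift (\<chi> i. 1) t \<and> (\<forall>i j. z $ i = z $ j \<longleftrightarrow> t $ i = t $ j)"
proof -
  define t :: "real ^ 'n" where "t = (\<chi> i. Arg (z $ i))"
  have cis_t: "cis (t $ i) = z $ i" for i
    using assms by (simp add: t_def cis_Arg_of_norm_1 torus_def)
  have "z = torus_shift (\<chi> i. 1) t"
    using cis_t by (simp add: vec_eq_iff)
  moreover have "z $ i = z $ j \<longleftrightarrow> t $ i = t $ j" for i j
  proof
    assume "z $ i = z $ j"
    then show "t $ i = t $ j" by (simp add: t_def)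
  next
    assume "t $ i = t $ j"
    then show "z $ i = z $ j" using cis_t[of i] cis_t[of j] by simp
  qed
  ultimately show ?thesis by blast
qed

lemma one_shift_torus: "torus_shift (\<chi> i. 1) t \<in> torus"
  by (simp add: torus_def)

text \<open>
  Arguments of complex numbers turn a configuration into a vector with the same coincidences;
  conversely a vector is scaled down until its coordinates fit on less than half of the circle.
\<close>

lemma type_A_arrangement_circle:
  "type_A_arrangement (rotation_orbit ` torus) orbit_hyp (cox_A_tilde :: ('n::finite, (complex ^ 'n) set) arrangement)"
proof
  show "(cox_A_tilde :: ('n, (complex ^ 'n) set) arrangement) = {(axis i 1 - axis j 1, orbit_hyp i j) |i j. i \<noteq> j}"
    by (rule cox_A_tilde_def)
  show "orbit_hyp i j \<subseteq> rotation_orbit ` torus" for i j :: 'n by blast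
  show "\<exists>w :: real ^ 'n. \<forall>i j. i \<noteq> j \<longrightarrow> (x \<in> orbit_hyp i j \<longleftrightarrow> w $ i = w $ j)"
    if x: "x \<in> rotation_orbit ` torus" for x :: "(complex ^ 'n) set"
  proof -
    obtain z where z: "x = rotation_orbit z" "z \<in> torus" using x by blast
    obtain t :: "real ^ 'n" where "z = torus_shift (\<chi> i. 1) t" "\<forall>i j. z $ i = z $ j \<longleftrightarrow> t $ i = t $ j"
      using torus_angles[OF z(2)] by (elim exE conjE)
    then show ?thesis
      unfolding z(1) rotation_orbit_in_hyp_iff[OF z(2)] by (intro exI[of _ t]) simp
  qed
  show "\<exists>x. \<forall>i j. i \<noteq> j \<longrightarrow> (x \<in> orbit_hyp i j \<longleftrightarrow> w $ i = w $ j)" for w :: "real ^ 'n"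
  proof -
    define c where "c = 1 / (1 + norm w)"
    have c: "0 < c" by (simp add: c_def add_pos_nonneg)
    have small: "\<bar>c * w $ i\<bar> < 1" for i
    proof -
      have "\<bar>w $ i\<bar> < 1 + norm w" using component_le_norm_cart[of w i] by simp
      then show ?thesis
        using c by (simp add: c_def abs_mult divide_simps) 
    qed
    let ?z = "torus_shift (\<chi> i. 1) (c *\<^sub>R w)"
    have "?z $ i = ?z $ j \<longleftrightarrow> w $ i = w $ j" for i j
    proof
      assume "?z $ i = ?z $ j"
      then obtain k :: int where k: "c * w $ i - c * w $ j = 2 * pi * k"
        by (auto simp: cis_eq_iff)
      have "\<bar>2 * pi * real_of_int k\<bar> < 2" using small[of i] small[of j] k by linarith
      also have "2 < 2 * pi * 1" using pi_gt3 by simp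
      finally have "2 * pi * \<bar>real_of_int k\<bar> < 2 * pi * 1" by (simp add: abs_mult)
      then have "\<bar>real_of_int k\<bar> < 1" by (rule mult_left_less_imp_less) simp
      then have "k = 0" by linarith
      then show "w $ i = w $ j" using k c by (simp add: right_diff_distrib[symmetric])
    qed simp
    then show ?thesis
      by (intro exI[of _ "rotation_orbit ?z"]) (simp only: rotation_orbit_in_hyp_iff[OF one_shift_torus] simp_thms)
  qed
qed

text \<open>
  In contrast to the symmetric tori, an intersection of hyperplanes never falls into several
  components: it is the image of a single leaf, through the configuration with all particles at the
  same position.
\<close>

lemma connectedin_orbit_intersection:
  assumes K: "K \<subseteq> (cox_A_tilde :: ('n::finite, (complex ^ 'n) set) arrangement)" "K \<noteq> {}"
  shows "connectedin orbit_space (\<Inter>(snd ` K))" "\<Inter>(snd ` K) \<noteq> {}"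
proof -
  let ?L = "leaf (\<chi> i. 1) (fst ` K)"
  have hyp: "\<exists>i j. v = axis i 1 - axis j 1 \<and> h = orbit_hyp i j" if "(v, h) \<in> K" for v h
    using that K(1) unfolding cox_A_tilde_def by blast
  have in_Inter: "rotation_orbit (torus_shift (\<chi> i. 1) t) \<in> \<Inter>(snd ` K)"
    if t: "\<forall>v\<in>fst ` K. v \<bullet> t = 0" for t
  proof (intro INT_I)
    fix vh assume vh: "vh \<in> K"
    obtain v h where vh_eq: "vh = (v, h)" by (cases vh)
    obtain i j where ij: "v = axis i 1 - axis j 1" "h = orbit_hyp i j"
      using hyp vh vh_eq by blast
    have "v \<bullet> t = 0" using t vh vh_eq by force
    then have "t $ i = t $ j" by (simp add: ij axis_diff_inner)
    then show "rotation_orbit (torus_shift (\<chi> i. 1) t) \<in> snd vh"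
      unfolding vh_eq snd_conv ij(2) rotation_orbit_in_hyp_iff[OF one_shift_torus] by simp
  qed
  have eq: "\<Inter>(snd ` K) = rotation_orbit ` ?L"
  proof
    show "rotation_orbit ` ?L \<subseteq> \<Inter>(snd ` K)"
    proof (rule image_subsetI)
      fix z assume "z \<in> ?L"
      then obtain t where "z = torus_shift (\<chi> i. 1) t" "\<forall>v\<in>fst ` K. v \<bullet> t = 0"
        unfolding in_leaf_iff by (elim exE conjE)
      then show "rotation_orbit z \<in> \<Inter>(snd ` K)" using in_Inter[of t] by (simp only:)
    qed
    show "\<Inter>(snd ` K) \<subseteq> rotation_orbit ` ?L"
    proof
      fix x assume x: "x \<in> \<Inter>(snd ` K)"
      then have xh: "x \<in> h" if "(v, h) \<in> K" for v h using that by force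
      obtain v0 h0 where "(v0, h0) \<in> K" using K(2) by auto
      then obtain z where z: "x = rotation_orbit z" "z \<in> torus"
        using xh hyp by blast
      obtain t where t: "z = torus_shift (\<chi> i. 1) t" "\<forall>i j. z $ i = z $ j \<longleftrightarrow> t $ i = t $ j"
        using torus_angles[OF z(2)] by (elim exE conjE)
      have "v \<bullet> t = 0" if vh: "(v, h) \<in> K" for v h
      proof -
        obtain i j where ij: "v = axis i 1 - axis j 1" "h = orbit_hyp i j" using hyp[OF vh] by blast
        have "z $ i = z $ j"
          using xh[OF vh] unfolding z(1) ij(2) rotation_orbit_in_hyp_iff[OF z(2)] .
        then show ?thesis using t(2) by (simp add: ij(1) axis_diff_inner)
      qed
      then have "z \<in> ?L" unfolding in_leaf_iff using t(1) by force
      then show "x \<in> rotation_orbit ` ?L" unfolding z(1) by (rule imageI)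
    qed
  qed
  have "?L \<subseteq> torus" using one_shift_torus by (auto simp: in_leaf_iff)
  then have "connectedin (top_of_set torus) ?L"
    by (simp add: connectedin_subtopology connected_leaf)
  then show "connectedin orbit_space (\<Inter>(snd ` K))"
    unfolding eq by (rule connectedin_continuous_map_image[OF continuous_map_rotation_orbit])
  show "\<Inter>(snd ` K) \<noteq> {}"
    unfolding eq using self_in_leaf by blast
qed

lemma toroidal_flats_cox_A_tilde:
  "toroidal_flats orbit_space (cox_A_tilde :: ('n::finite, (complex ^ 'n) set) arrangement) = spherical_flats cox_A_tilde"
proof -
  have comp: "connected_components_of (subtopology orbit_space (\<Inter>(snd ` K))) = {\<Inter>(snd ` K)}"
    if K: "K \<subseteq> (cox_A_tilde :: ('n, (complex ^ 'n) set) arrangement)" "K \<noteq> {}" for K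
  proof -
    let ?T = "subtopology orbit_space (\<Inter>(snd ` K))"
    have "connectedin orbit_space (\<Inter>(snd ` K))" by (rule connectedin_orbit_intersection[OF K])
    then have T: "connected_space ?T" "topspace ?T = \<Inter>(snd ` K)"
      by (auto simp: connectedin_def)
    have "connected_component_of_set ?T x = topspace ?T" if "x \<in> topspace ?T" for x
      using T(1) that unfolding connected_space_connected_component_set by blast
    then have "connected_components_of ?T = (\<lambda>x. topspace ?T) ` topspace ?T"
      unfolding connected_components_of_def by (rule image_cong[OF refl])
    then show ?thesis
      using connectedin_orbit_intersection(2)[OF K] unfolding T(2) by (simp add: image_constant_conv)
  qed
  have "toroidal_flats orbit_space (cox_A_tilde :: ('n, (complex ^ 'n) set) arrangement) =
      (\<Union>K\<in>{K. K \<subseteq> cox_A_tilde \<and> K \<noteq> {}}. {\<Inter>(snd ` K)})"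
    unfolding toroidal_flats_def by (intro SUP_cong refl comp) simp_all
  also have "\<dots> = spherical_flats cox_A_tilde"
    unfolding spherical_flats_def by blast
  finally show ?thesis .
qed

theorem Min_building_cox_A_tilde:
  assumes "\<alpha> \<in> toroidal_flats orbit_space (cox_A_tilde :: ('n::finite, (complex ^ 'n) set) arrangement)"
  shows "\<alpha> \<in> Min_building (toroidal_flats orbit_space cox_A_tilde)
      (cox_A_tilde :: ('n, (complex ^ 'n) set) arrangement) \<longleftrightarrow> (\<exists>b\<in>brackets_A. \<alpha> = support_A_tilde b)"
proof -
  interpret type_A_arrangement "rotation_orbit ` torus" orbit_hyp "cox_A_tilde :: ('n, (complex ^ 'n) set) arrangement"
    by (rule type_A_arrangement_circle)
  have coll: "collision (set us) = support_A_tilde us" if us: "us \<in> brackets_A" for us :: "'n list"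
  proof -
    obtain k l where kl: "k \<in> set us" "l \<in> set us" "k \<noteq> l" using brackets_A_two[OF us] .
    have "collision (set us) \<subseteq> rotation_orbit ` torus"
      using kl hyp_subset[of k l] unfolding collision_def by blast
    moreover have "support_A_tilde us \<subseteq> rotation_orbit ` torus"
      unfolding support_A_tilde_def by blast
    moreover have "rotation_orbit z \<in> collision (set us) \<longleftrightarrow> rotation_orbit z \<in> support_A_tilde us"
      if z: "z \<in> torus" for z
    proof -
      have "rotation_orbit z \<in> collision (set us) \<longleftrightarrow>
          (\<forall>i\<in>set us. \<forall>j\<in>set us. i \<noteq> j \<longrightarrow> rotation_orbit z \<in> orbit_hyp i j)"
        unfolding collision_def by auto
      also have "\<dots> \<longleftrightarrow> (\<forall>i\<in>set us. \<forall>j\<in>set us. z $ i = z $ j)"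
        unfolding rotation_orbit_in_hyp_iff[OF z] by metis
      finally show ?thesis
        unfolding support_A_tilde_def rotation_orbit_in_image_iff[OF z] .
    qed
    ultimately show ?thesis by blast
  qed
  show ?thesis
    unfolding toroidal_flats_cox_A_tilde
    unfolding Min_building_iff_collision[OF assms[unfolded toroidal_flats_cox_A_tilde]]
    using coll by auto
qed

section \<open>Supports of brackets in the seven complexes\<close>

theorem lemma5p5:
  shows
    "(\<forall>\<alpha> \<in> spherical_flats (cox_A :: ('n::finite, real ^ 'n) arrangement).
        \<alpha> \<in> Min_building (spherical_flats cox_A) (cox_A :: ('n, real ^ 'n) arrangement) \<longleftrightarrow>
        (\<exists>b \<in> brackets_A. \<alpha> = support_A b)) \<and>
     (\<forall>\<alpha> \<in> spherical_flats (cox_B :: ('n, real ^ 'n) arrangement).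
        \<alpha> \<in> Min_building (spherical_flats cox_B) (cox_B :: ('n, real ^ 'n) arrangement) \<longleftrightarrow>
        (\<exists>b \<in> line_brackets {0}. \<alpha> = line_support b)) \<and>
     (\<forall>\<alpha> \<in> spherical_flats (cox_D :: ('n, real ^ 'n) arrangement).
        \<alpha> \<in> Min_building (spherical_flats cox_D) (cox_D :: ('n, real ^ 'n) arrangement) \<longleftrightarrow>
        (\<exists>b \<in> line_brackets {}. \<alpha> = line_support b)) \<and>
     (\<forall>\<alpha> \<in> toroidal_flats orbit_space (cox_A_tilde :: ('n, (complex ^ 'n) set) arrangement).
        \<alpha> \<in> Min_building (toroidal_flats orbit_space cox_A_tilde)
              (cox_A_tilde :: ('n, (complex ^ 'n) set) arrangement) \<longleftrightarrow>
        (\<exists>b \<in> brackets_A. \<alpha> = support_A_tilde b)) \<and>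
     (\<forall>\<alpha> \<in> toroidal_flats (top_of_set torus) (cox_B_tilde :: ('n, complex ^ 'n) arrangement).
        \<alpha> \<in> Min_building (toroidal_flats (top_of_set torus) cox_B_tilde)
              (cox_B_tilde :: ('n, complex ^ 'n) arrangement) \<longleftrightarrow>
        (\<exists>b \<in> circle_brackets {- 1}. \<alpha> = circle_support b)) \<and>
     (\<forall>\<alpha> \<in> toroidal_flats (top_of_set torus) (cox_C_tilde :: ('n, complex ^ 'n) arrangement).
        \<alpha> \<in> Min_building (toroidal_flats (top_of_set torus) cox_C_tilde)
              (cox_C_tilde :: ('n, complex ^ 'n) arrangement) \<longleftrightarrow>
        (\<exists>b \<in> circle_brackets {- 1, 1}. \<alpha> = circle_support b)) \<and>
     (\<forall>\<alpha> \<in> toroidal_flats (top_of_set torus) (cox_D_tilde :: ('n, complex ^ 'n) arrangement).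
        \<alpha> \<in> Min_building (toroidal_flats (top_of_set torus) cox_D_tilde)
              (cox_D_tilde :: ('n, complex ^ 'n) arrangement) \<longleftrightarrow>
        (\<exists>b \<in> circle_brackets {}. \<alpha> = circle_support b))"
  using Min_building_cox_A Min_building_cox_sym[of "{0}"] Min_building_cox_sym[of "{}"]
    Min_building_cox_A_tilde Min_building_cox_sym_tilde[of "{- 1}"]
    Min_building_cox_sym_tilde[of "{- 1, 1}"] Min_building_cox_sym_tilde[of "{}"]
  unfolding cox_B_def cox_D_def cox_B_tilde_def cox_C_tilde_def cox_D_tilde_def
  by (intro conjI ballI) simp_all

end
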